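(* Let $\varphi_0:X(\mathfrak{so}_4,\mathfrak{gl}_2)^{tw}\hookrightarrow Y^+(2)\otimes Y^-(2)$ be the algebra embedding $S(u)\mapsto S^\circ(u-1/2)\,K_1\,S^\bullet(u-1/2)$, and let $\mathrm{Pr}_1$ and $\mathrm{Pr}_2$ denote the natural projection $Y^\pm(2)\to SY^\pm(2)$ applied to the first and to the second tensor factor, respectively. The compositions $\chi_0^{(1)}=\mathrm{Pr}_1\circ\varphi_0$ and $\chi_0^{(2)}=\mathrm{Pr}_2\circ\varphi_0$ define algebra isomorphisms $$X(\mathfrak{so}_4,\mathfrak{gl}_2)^{tw}\cong SY^+(2)\otimes Y^-(2)\qquad\text{and}\qquad X(\mathfrak{so}_4,\mathfrak{gl}_2)^{tw}\cong Y^+(2)\otimes SY^-(2),$$ respectively.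
   Context: All algebras are unital associative over $\mathbb C$; $P=\sum E_{ij}\otimes E_{ji}$. $2\times2$ notation: indices in $\{-1,1\}$, $K=E_{11}-E_{-1,-1}$, $(E_{ij})^{t_+}=E_{-j,-i}$, $(E_{ij})^{t_-}=\mathrm{sign}(i)\,\mathrm{sign}(j)E_{-j,-i}$, $R^\circ(u)=I-\frac Pu$. $Y(2)$ is generated by the coefficients of $T^\circ(u)=I+O(u^{-1})$ with relation $R^\circ(u-v)T^\circ_1(u)T^\circ_2(v)=T^\circ_2(v)T^\circ_1(u)R^\circ(u-v)$. The series $\mathrm{qdet}\,T^\circ(u)=t^\circ_{-1,-1}(u-1)t^\circ_{11}(u)-t^\circ_{-1,1}(u-1)t^\circ_{1,-1}(u)$ has central coefficients; $SY(2)=Y(2)/(\mathrm{qdet}\,T^\circ(u)-1)$, and $\mathcal T^\circ(u)$ is the image of $T^\circ(u)$. $Y^\pm(2)\subset Y(2)$ is the subalgebra generated by the coefficients of its generating matrix $T^\circ(u)T^\circ(-u)^{t_\pm}$; $SY^\pm(2)\subset SY(2)$ is the subalgebra generated by the coefficients of $\mathcal T^\circ(u)\mathcal T^\circ(-u)^{t_\pm}$; the natural projection $Y^\pm(2)\to SY^\pm(2)$ is the restriction of $Y(2)\to SY(2)$. $S^\circ(u)$ and $S^\bullet(u)$ denote the generating matrices of the factors $Y^+(2)$ and $Y^-(2)$ of $Y^+(2)\otimes Y^-(2)$. $\mathfrak{so}_4$: $4\times4$ matrices are indexed by $\{-2,-1,1,2\}$, $(E_{ij})^t=E_{-j,-i}$,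 $Q=\sum E_{ij}\otimes E_{-i,-j}$, $R(u)=I-\frac Pu+\frac Q{u-1}$. $X(\mathfrak{so}_4)$ is generated by the coefficients of the $4\times4$ matrix $T(u)=I+O(u^{-1})$ with relation $R(u-v)T_1(u)T_2(v)=T_2(v)T_1(u)R(u-v)$. $X(\mathfrak{so}_4,\mathfrak{gl}_2)^{tw}\subset X(\mathfrak{so}_4)$ is the subalgebra generated by the coefficients of $S(u)=T(u-\frac12)\,\mathcal G\,T(-u+\frac12)^t$ with $\mathcal G=E_{11}+E_{22}-E_{-1,-1}-E_{-2,-2}$. Identification: $\mathbb C^4=\mathbb C^2\otimes\mathbb C^2$ via $v_{-2}=e_{-1}\otimes e_{-1}$, $v_{-1}=e_{-1}\otimes e_1$, $v_1=e_1\otimes e_{-1}$, $v_2=-e_1\otimes e_1$. In the formula for $\varphi_0$, $S^\circ$ and $K_1$ act on the first factor $\mathbb C^2$, $S^\bullet$ on the second, and $s_{ij}(u)$ is sent to the $(i,j)$ entry of the right-hand side in the basis $v_{-2},v_{-1},v_1,v_2$. *)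

theory Defs
  imports
    "HOL-Analysis.Finite_Cartesian_Product"
    "HOL-Computational_Algebra.Formal_Power_Series"
    "HOL-Library.Poly_Mapping"
begin

section \<open>Unital associative algebras over the complex numbers\<close>

class scaleC =
  fixes scaleC :: "complex \<Rightarrow> 'a \<Rightarrow> 'a"  (infixr \<open>*\<^sub>C\<close> 75)

class complex_algebra_1 = ring_1 + scaleC +
  assumes scaleC_add_right: "c *\<^sub>C (x + y) = c *\<^sub>C x + c *\<^sub>C y"
    and scaleC_add_left: "(c + d) *\<^sub>C x = c *\<^sub>C x + d *\<^sub>C x"
    and scaleC_scaleC: "c *\<^sub>C d *\<^sub>C x = (c * d) *\<^sub>C x"
    and scaleC_one: "1 *\<^sub>C x = x"
    and mult_scaleC_left: "(c *\<^sub>C x) * y = c *\<^sub>C (x * y)"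
    and mult_scaleC_right: "x * (c *\<^sub>C y) = c *\<^sub>C (x * y)"
begin

lemma scaleC_zero_left [simp]: "0 *\<^sub>C x = 0"
  using scaleC_add_left[of 0 0 x] by simp

lemma scaleC_zero_right [simp]: "c *\<^sub>C 0 = 0"
  using scaleC_add_right[of c 0 0] by simp

lemma scaleC_minus_one: "(-1) *\<^sub>C x = - x"
  using scaleC_add_left[of 1 "-1" x] by (simp add: scaleC_one eq_neg_iff_add_eq_0 add.commute)

end

instantiation complex :: complex_algebra_1
begin
definition scaleC_complex :: "complex \<Rightarrow> complex \<Rightarrow> complex"
  where "scaleC_complex c x = c * x"
instance by standard (simp_all add: scaleC_complex_def algebra_simps)
end

definition clinear :: "('a::complex_algebra_1 \<Rightarrow> 'b::complex_algebra_1) \<Rightarrow> bool" where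
  "clinear h \<longleftrightarrow> (\<forall>x y. h (x + y) = h x + h y) \<and> (\<forall>c x. h (c *\<^sub>C x) = c *\<^sub>C h x)"

definition alg_hom :: "('a::complex_algebra_1 \<Rightarrow> 'b::complex_algebra_1) \<Rightarrow> bool" where
  "alg_hom h \<longleftrightarrow> clinear h \<and> (\<forall>x y. h (x * y) = h x * h y) \<and> h 1 = 1"

definition alg_iso :: "('a::complex_algebra_1 \<Rightarrow> 'b::complex_algebra_1) \<Rightarrow> bool" where
  "alg_iso h \<longleftrightarrow> alg_hom h \<and> bij h"

inductive_set subalg_gen :: "'a::complex_algebra_1 set \<Rightarrow> 'a set" for G where
  subalg_gen_base: "x \<in> G \<Longrightarrow> x \<in> subalg_gen G"
| subalg_gen_one: "1 \<in> subalg_gen G"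
| subalg_gen_add: "x \<in> subalg_gen G \<Longrightarrow> y \<in> subalg_gen G \<Longrightarrow> x + y \<in> subalg_gen G"
| subalg_gen_mult: "x \<in> subalg_gen G \<Longrightarrow> y \<in> subalg_gen G \<Longrightarrow> x * y \<in> subalg_gen G"
| subalg_gen_scale: "x \<in> subalg_gen G \<Longrightarrow> c *\<^sub>C x \<in> subalg_gen G"

inductive_set ideal_gen :: "'a::ring_1 set \<Rightarrow> 'a set" for G where
  ideal_gen_base: "x \<in> G \<Longrightarrow> x \<in> ideal_gen G"
| ideal_gen_zero: "0 \<in> ideal_gen G"
| ideal_gen_add: "x \<in> ideal_gen G \<Longrightarrow> y \<in> ideal_gen G \<Longrightarrow> x + y \<in> ideal_gen G"
| ideal_gen_left: "x \<in> ideal_gen G \<Longrightarrow> a * x \<in> ideal_gen G"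
| ideal_gen_right: "x \<in> ideal_gen G \<Longrightarrow> x * a \<in> ideal_gen G"

lemma subalg_gen_zero: "0 \<in> subalg_gen G"
  using subalg_gen_scale[OF subalg_gen_one, of 0 G] by simp

lemma subalg_gen_uminus: "x \<in> subalg_gen G \<Longrightarrow> - x \<in> subalg_gen G"
  using subalg_gen_scale[of x G "-1"] by (simp add: scaleC_minus_one)

lemma subalg_gen_diff: "x \<in> subalg_gen G \<Longrightarrow> y \<in> subalg_gen G \<Longrightarrow> x - y \<in> subalg_gen G"
  using subalg_gen_add[OF _ subalg_gen_uminus, of x G y] by simp

lemma ideal_gen_uminus: "x \<in> ideal_gen G \<Longrightarrow> - x \<in> ideal_gen G"
  using ideal_gen_left[of x G "-1"] by simp

lemma ideal_gen_diff: "x \<in> ideal_gen G \<Longrightarrow> y \<in> ideal_gen G \<Longrightarrow> x - y \<in> ideal_gen G"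
  using ideal_gen_add[OF _ ideal_gen_uminus, of x G y] by simp

lemma equivp_ideal_gen: "equivp (\<lambda>p q. p - q \<in> ideal_gen G)"
proof (rule equivpI)
  show "reflp (\<lambda>p q. p - q \<in> ideal_gen G)"
    by (simp add: reflp_def ideal_gen_zero)
  show "symp (\<lambda>p q. p - q \<in> ideal_gen G)"
    using ideal_gen_uminus by (fastforce simp: symp_def)
  show "transp (\<lambda>p q. p - q \<in> ideal_gen G)"
    using ideal_gen_add by (fastforce simp: transp_def)
qed

lemma ideal_gen_cong_add:
  "a - b \<in> ideal_gen G \<Longrightarrow> c - d \<in> ideal_gen G \<Longrightarrow> (a + c) - (b + d) \<in> ideal_gen G"
  using ideal_gen_add[of "a - b" G "c - d"] by (simp add: algebra_simps)

lemma ideal_gen_cong_diff: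
  "a - b \<in> ideal_gen G \<Longrightarrow> c - d \<in> ideal_gen G \<Longrightarrow> (a - c) - (b - d) \<in> ideal_gen G"
  using ideal_gen_diff[of "a - b" G "c - d"] by (simp add: algebra_simps)

lemma ideal_gen_cong_uminus: "a - b \<in> ideal_gen G \<Longrightarrow> (- a) - (- b) \<in> ideal_gen G"
  using ideal_gen_uminus[of "a - b" G] by (simp add: algebra_simps)

lemma ideal_gen_cong_mult:
  assumes "a - b \<in> ideal_gen G" "c - d \<in> ideal_gen G"
  shows "a * c - b * d \<in> ideal_gen G"
proof -
  have "a * c - b * d = (a - b) * c + b * (c - d)" by (simp add: algebra_simps)
  then show ?thesis using assms by (simp add: ideal_gen_add ideal_gen_left ideal_gen_right)
qed

lemma ideal_gen_eqI: "a = b \<Longrightarrow> a - b \<in> ideal_gen G"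
  by (simp add: ideal_gen_zero)

lemma ideal_gen_cong_scaleC:
  fixes a b :: "'a::complex_algebra_1"
  assumes "a - b \<in> ideal_gen G"
  shows "c *\<^sub>C a - c *\<^sub>C b \<in> ideal_gen G"
proof -
  have "c *\<^sub>C a - c *\<^sub>C b = (c *\<^sub>C 1) * (a - b)"
    by (simp add: right_diff_distrib mult_scaleC_left)
  with assms show ?thesis by (simp add: ideal_gen_left)
qed

section \<open>Free algebras\<close>

text \<open>
  The free algebra on generators \<open>'g\<close> consists of the finitely supported functions from words
  to scalars under convolution.  \<open>Poly_Mapping\<close> convolves along \<open>+\<close>, so concatenation is
  written additively.
\<close>

datatype 'g word = Word "'g list"

instantiation word :: (type) monoid_add
begin
definition "0 = Word []"
fun plus_word :: "'a word \<Rightarrow> 'a word \<Rightarrow> 'a word" where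
  "Word v + Word w = Word (v @ w)"
instance
proof
  fix a b c :: "'a word"
  show "a + b + c = a + (b + c)" by (cases a; cases b; cases c) simp
  show "0 + a = a" by (cases a) (simp add: zero_word_def)
  show "a + 0 = a" by (cases a) (simp add: zero_word_def)
qed
end

type_synonym 'g free_alg = "'g word \<Rightarrow>\<^sub>0 complex"

definition free_gen :: "'g \<Rightarrow> 'g free_alg" where
  "free_gen g = Poly_Mapping.single (Word [g]) 1"

definition pm_scale :: "complex \<Rightarrow> ('m::monoid_add \<Rightarrow>\<^sub>0 complex) \<Rightarrow> ('m \<Rightarrow>\<^sub>0 complex)" where
  "pm_scale c p = Poly_Mapping.single 0 c * p"

lemma lookup_pm_scale: "Poly_Mapping.lookup (pm_scale c p) k = c * Poly_Mapping.lookup p k"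
  by (simp add: pm_scale_def mult_map_scale_conv_mult[symmetric] Poly_Mapping.map.rep_eq when_def)

lemma pm_scale_comm:
  fixes p :: "'a::monoid_add \<Rightarrow>\<^sub>0 complex"
  shows "pm_scale c p = p * Poly_Mapping.single 0 c"
proof (rule poly_mapping_eqI)
  fix k :: 'a
  have inner: "Sum_any (\<lambda>q. Poly_Mapping.lookup (Poly_Mapping.single 0 c) q when k = l + q) = (c when k = l)" for l
  proof -
    have "Sum_any (\<lambda>q. Poly_Mapping.lookup (Poly_Mapping.single 0 c) q when k = l + q)
        = Sum_any (\<lambda>q::'a. (c when k = l) when q = 0)"
      by (rule Sum_any.cong) (auto simp: when_def lookup_single)
    then show ?thesis by simp
  qed
  have "Poly_Mapping.lookup (p * Poly_Mapping.single 0 c) k = Sum_any (\<lambda>l. Poly_Mapping.lookup p l * c when k = l)"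
    by (simp only: lookup_mult inner mult_when)
  also have "\<dots> = c * Poly_Mapping.lookup p k"
    by (simp add: mult.commute)
  finally show "Poly_Mapping.lookup (pm_scale c p) k = Poly_Mapping.lookup (p * Poly_Mapping.single 0 c) k"
    by (simp add: lookup_pm_scale)
qed

lemma pm_scale_add_right: "pm_scale c (p + q) = pm_scale c p + pm_scale c q"
  and pm_scale_add_left: "pm_scale (c + d) p = pm_scale c p + pm_scale d p"
  and pm_scale_pm_scale: "pm_scale c (pm_scale d p) = pm_scale (c * d) p"
  and pm_scale_one: "pm_scale 1 p = p"
  by (auto intro!: poly_mapping_eqI simp: lookup_pm_scale lookup_add algebra_simps)

lemma pm_scale_mult_left: "pm_scale c p * q = pm_scale c (p * q)"
  by (simp add: pm_scale_def mult.assoc)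

lemma pm_scale_mult_right: "p * pm_scale c q = pm_scale c (p * q)"
  by (metis pm_scale_comm mult.assoc)

lemma ideal_gen_cong_pm_scale:
  "a - b \<in> ideal_gen G \<Longrightarrow> pm_scale c a - pm_scale c b \<in> ideal_gen G"
  using ideal_gen_left[of "a - b" G "Poly_Mapping.single 0 c"]
  by (simp add: pm_scale_def algebra_simps)

section \<open>Matrices of power series\<close>

text \<open>
  A series \<open>f(u) = \<Sum>r. f\<^sub>r u\<^sup>-\<^sup>r\<close> is an element of \<open>'a fps\<close> whose variable stands for \<open>u\<^sup>-\<^sup>1\<close>.
  A series in two spectral parameters is an element of \<open>'a fps fps\<close> with inner variable \<open>u\<^sup>-\<^sup>1\<close>
  and outer variable \<open>v\<^sup>-\<^sup>1\<close>; the two variables are central.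
\<close>

definition matrix_map :: "('a \<Rightarrow> 'b) \<Rightarrow> 'a^'n^'m \<Rightarrow> 'b^'n^'m" where
  "matrix_map h A = (\<chi> i j. h (A $ i $ j))"

definition fps_map :: "('a \<Rightarrow> 'b) \<Rightarrow> 'a fps \<Rightarrow> 'b fps" where
  "fps_map h f = Abs_fps (\<lambda>n. h (fps_nth f n))"

definition series_coeffs :: "'a fps^'n^'m \<Rightarrow> 'a set" where
  "series_coeffs A = {fps_nth (A $ i $ j) n | i j n. True}"

text \<open>
  \<open>lin_subst e b f\<close> is \<open>f(e u + b)\<close> for \<open>e \<noteq> 0\<close>: each \<open>u\<^sup>-\<^sup>r\<close> is replaced by the \<open>r\<close>-th power of
  \<open>(e u + b)\<^sup>-\<^sup>1 = u\<^sup>-\<^sup>1 / (e + b u\<^sup>-\<^sup>1)\<close>.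
\<close>

definition lin_subst :: "complex \<Rightarrow> complex \<Rightarrow> 'a::complex_algebra_1 fps \<Rightarrow> 'a fps" where
  "lin_subst e b f = Abs_fps (\<lambda>n. \<Sum>r\<le>n.
     fps_nth ((fps_X * inverse (fps_const e + fps_const b * fps_X)) ^ r) n *\<^sub>C fps_nth f r)"

definition matrix_unit :: "'m \<Rightarrow> 'n \<Rightarrow> 'a::{zero,one}^'n^'m" where
  "matrix_unit i j = (\<chi> k l. if k = i \<and> l = j then 1 else 0)"

definition kron :: "'a::times^'n^'n \<Rightarrow> 'a^'m^'m \<Rightarrow> 'a^('n \<times> 'm)^('n \<times> 'm)" where
  "kron A B = (\<chi> p q. A $ fst p $ fst q * B $ snd p $ snd q)"

definition P_mat :: "'a::ring_1^('n::finite \<times> 'n)^('n \<times> 'n)" where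
  "P_mat = (\<Sum>i\<in>UNIV. \<Sum>j\<in>UNIV. kron (matrix_unit i j) (matrix_unit j i))"

definition uinv :: "'a::ring_1 fps fps" where "uinv = fps_const fps_X"
definition vinv :: "'a::ring_1 fps fps" where "vinv = fps_X"

definition series_u :: "'a::ring_1 fps \<Rightarrow> 'a fps fps" where
  "series_u f = fps_const f"
definition series_v :: "'a::ring_1 fps \<Rightarrow> 'a fps fps" where
  "series_v f = Abs_fps (\<lambda>s. fps_const (fps_nth f s))"

definition RTT ::
  "'a::ring_1 fps fps^('n::finite \<times> 'n)^('n \<times> 'n) \<Rightarrow> 'a fps^'n^'n \<Rightarrow> 'a fps fps^('n \<times> 'n)^('n \<times> 'n)"
where
  "RTT R T =
    (let T\<^sub>1 = kron (matrix_map series_u T) (mat 1); T\<^sub>2 = kron (mat 1) (matrix_map series_v T)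
     in R ** T\<^sub>1 ** T\<^sub>2 - T\<^sub>2 ** T\<^sub>1 ** R)"

definition RTT_coeffs ::
  "'a::ring_1 fps fps^('n::finite \<times> 'n)^('n \<times> 'n) \<Rightarrow> 'a fps^'n^'n \<Rightarrow> 'a set"
where
  "RTT_coeffs R T = {fps_nth (fps_nth (RTT R T $ p $ q) s) r | p q r s. True}"

text \<open>
  The generating matrix \<open>T(u) = I + \<Sum>r\<ge>1. t\<^sup>(\<^sup>r\<^sup>) u\<^sup>-\<^sup>r\<close> over the free algebra; the generator
  \<open>(i, j, k)\<close> is the coefficient \<open>t\<^sub>i\<^sub>j\<^sup>(\<^sup>k\<^sup>+\<^sup>1\<^sup>)\<close>.
\<close>

definition free_T :: "('n::finite \<times> 'n \<times> nat) free_alg fps^'n^'n" where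
  "free_T = (\<chi> i j. Abs_fps (\<lambda>r. case r of
     0 \<Rightarrow> if i = j then 1 else 0 | Suc k \<Rightarrow> free_gen (i, j, k)))"

subsection \<open>Functoriality\<close>

definition ring_hom1 :: "('a::ring_1 \<Rightarrow> 'b::ring_1) \<Rightarrow> bool" where
  "ring_hom1 h \<longleftrightarrow> (\<forall>x y. h (x + y) = h x + h y) \<and> (\<forall>x y. h (x * y) = h x * h y) \<and> h 1 = 1"

lemma ring_hom1_simps:
  assumes "ring_hom1 h"
  shows "h (x + y) = h x + h y" "h (x * y) = h x * h y" "h 1 = 1" "h 0 = 0" "h (- x) = - h x"
    "h (x - y) = h x - h y" "h (sum f A) = (\<Sum>a\<in>A. h (f a))"
proof -
  show add: "h (x + y) = h x + h y" for x y using assms by (auto simp: ring_hom1_def)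
  show "h (x * y) = h x * h y" "h 1 = 1" using assms by (auto simp: ring_hom1_def)
  show zero: "h 0 = 0" using add[of 0 0] by simp
  show um: "h (- x) = - h x" for x using add[of x "- x"] zero by (simp add: add_eq_0_iff)
  show "h (x - y) = h x - h y" using add[of x "- y"] um by simp
  show "h (sum f A) = (\<Sum>a\<in>A. h (f a))"
    by (induction A rule: infinite_finite_induct) (auto simp: zero add)
qed

lemma alg_hom_ring_hom1: "alg_hom h \<Longrightarrow> ring_hom1 h"
  by (auto simp: alg_hom_def clinear_def ring_hom1_def)

lemma alg_hom_scaleC: "alg_hom h \<Longrightarrow> h (c *\<^sub>C x) = c *\<^sub>C h x"
  by (auto simp: alg_hom_def clinear_def)

lemma fps_nth_fps_map [simp]: "fps_nth (fps_map h f) n = h (fps_nth f n)"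
  by (simp add: fps_map_def)

lemma matrix_map_nth [simp]: "matrix_map h A $ i $ j = h (A $ i $ j)"
  by (simp add: matrix_map_def)

lemma ring_hom1_fps_map: "ring_hom1 h \<Longrightarrow> ring_hom1 (fps_map h)"
  unfolding ring_hom1_def[of "fps_map h"]
  by (auto simp: fps_eq_iff fps_mult_nth ring_hom1_simps fps_one_nth)

lemma matrix_map_mult:
  "ring_hom1 h \<Longrightarrow> matrix_map h (A ** B) = matrix_map h A ** matrix_map h B"
  by (simp add: vec_eq_iff matrix_matrix_mult_def ring_hom1_simps)

lemma matrix_map_diff: "ring_hom1 h \<Longrightarrow> matrix_map h (A - B) = matrix_map h A - matrix_map h B"
  by (simp add: vec_eq_iff ring_hom1_simps)

lemma matrix_map_one: "ring_hom1 h \<Longrightarrow> matrix_map h (mat 1) = mat 1"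
  by (simp add: vec_eq_iff mat_def ring_hom1_simps)

lemma matrix_map_kron:
  "ring_hom1 h \<Longrightarrow> matrix_map h (kron A B) = kron (matrix_map h A) (matrix_map h B)"
  by (simp add: vec_eq_iff kron_def ring_hom1_simps)

lemma kron_one: "kron (mat 1) (mat 1) = (mat 1 :: 'a::ring_1^_^_)"
  by (auto simp: vec_eq_iff kron_def mat_def)

lemma fps_map_lin_subst: "alg_hom h \<Longrightarrow> fps_map h (lin_subst e b f) = lin_subst e b (fps_map h f)"
  by (simp add: fps_eq_iff lin_subst_def alg_hom_scaleC ring_hom1_simps alg_hom_ring_hom1)

lemma lin_subst_zero [simp]: "lin_subst e b 0 = 0"
  by (simp add: fps_eq_iff lin_subst_def)

lemma lin_subst_one [simp]: "lin_subst e b 1 = 1"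
  by (simp add: fps_eq_iff lin_subst_def fps_one_nth if_distrib scaleC_one cong: if_cong)

lemma series_coeffs_map: "series_coeffs (matrix_map (fps_map h) A) = h ` series_coeffs A"
  by (auto simp: series_coeffs_def)

lemma in_series_coeffs: "fps_nth (A $ i $ j) n \<in> series_coeffs A"
  by (auto simp: series_coeffs_def)

lemma subalg_gen_map:
  assumes "alg_hom h" "x \<in> subalg_gen G"
  shows "h x \<in> subalg_gen (h ` G)"
  using assms(2)
proof induction
qed (use assms(1) in \<open>auto simp: alg_hom_def clinear_def intro: subalg_gen.intros\<close>)

lemma ring_hom1_ideal_gen:
  assumes "ring_hom1 h" "\<And>x. x \<in> G \<Longrightarrow> h x = 0" "x \<in> ideal_gen G"
  shows "h x = 0"
  using assms(3) by induction (auto simp: assms(2) ring_hom1_simps[OF assms(1)])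

text \<open>The counit \<open>T(u) \<mapsto> I\<close>, which shows that the presented algebras below are nonzero.\<close>

lemma ring_hom1_counit: "ring_hom1 (\<lambda>p::'g free_alg. Poly_Mapping.lookup p 0)"
proof -
  have "Poly_Mapping.lookup (p * q) 0 = Poly_Mapping.lookup p 0 * Poly_Mapping.lookup q 0" for p q :: "'g free_alg"
  proof -
    have split: "(0 = k + l) = (k = 0 \<and> l = 0)" for k l :: "'g word"
      by (cases k; cases l) (auto simp: zero_word_def)
    have "Poly_Mapping.lookup (p * q) 0 = Sum_any (\<lambda>k. Poly_Mapping.lookup p k * Sum_any (\<lambda>l. (Poly_Mapping.lookup q l when k = 0) when l = 0))"
      unfolding lookup_mult
      by (intro Sum_any.cong arg_cong2[where f = "(*)"] refl) (auto simp: split when_def)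
    also have "\<dots> = Sum_any (\<lambda>k. Poly_Mapping.lookup p k * Poly_Mapping.lookup q 0 when k = 0)"
      by (simp add: mult_when)
    finally show ?thesis by simp
  qed
  then show ?thesis by (auto simp: ring_hom1_def lookup_add lookup_one)
qed

lemma counit_free_T:
  "matrix_map (fps_map (\<lambda>p. Poly_Mapping.lookup p 0)) (free_T :: ('n::finite \<times> 'n \<times> nat) free_alg fps^'n^'n) = mat 1"
  by (auto simp: vec_eq_iff fps_eq_iff free_T_def mat_def lookup_one free_gen_def lookup_single
      zero_word_def split: nat.split)

lemma RTT_coeffs_counit:
  assumes h: "ring_hom1 h" and T: "matrix_map (fps_map h) T = mat 1" and x: "x \<in> RTT_coeffs R T"
  shows "h x = 0"
proof -
  let ?h = "fps_map (fps_map h)"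
  have H: "ring_hom1 ?h" by (intro ring_hom1_fps_map h)
  have T': "fps_map h (T $ i $ j) = (if i = j then 1 else 0)" for i j
    using T by (simp add: vec_eq_iff mat_def)
  have u: "matrix_map ?h (matrix_map series_u T) = mat 1"
    using T' by (auto simp: vec_eq_iff fps_eq_iff series_u_def mat_def ring_hom1_simps[OF h])
  have v: "matrix_map ?h (matrix_map series_v T) = mat 1"
    using T' by (auto simp: vec_eq_iff fps_eq_iff series_v_def mat_def ring_hom1_simps[OF h] fps_one_nth)
  have "matrix_map ?h (RTT R T) = 0"
    by (simp add: RTT_def Let_def matrix_map_diff matrix_map_mult matrix_map_kron matrix_map_one
        H u v kron_one)
  moreover obtain p q r s where "x = fps_nth (fps_nth (RTT R T $ p $ q) s) r"
    using x by (auto simp: RTT_coeffs_def)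
  ultimately show ?thesis
    by (simp add: vec_eq_iff fps_eq_iff del: split_paired_All)
qed


section \<open>Tensor products of algebras\<close>

text \<open>
  \<open>A \<otimes> B\<close> is the vector space with basis \<open>A \<times> B\<close> modulo the span of the bilinearity relators.
  The product \<open>(x \<otimes> y)(x' \<otimes> y') = xx' \<otimes> yy'\<close> is inherited from the monoid algebra of the
  multiplicative monoid \<open>A \<times> B\<close>, which is written additively because \<open>Poly_Mapping\<close> convolves
  along \<open>+\<close>.
\<close>

datatype ('a, 'b) mult_pair = Mult_Pair 'a 'b

instantiation mult_pair :: (monoid_mult, monoid_mult) monoid_add
begin
definition "0 = Mult_Pair 1 1"
fun plus_mult_pair :: "('a, 'b) mult_pair \<Rightarrow> ('a, 'b) mult_pair \<Rightarrow> ('a, 'b) mult_pair" where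
  "Mult_Pair x y + Mult_Pair x' y' = Mult_Pair (x * x') (y * y')"
instance
proof
  fix a b c :: "('a, 'b) mult_pair"
  show "a + b + c = a + (b + c)" by (cases a; cases b; cases c) (simp add: mult.assoc)
  show "0 + a = a" by (cases a) (simp add: zero_mult_pair_def)
  show "a + 0 = a" by (cases a) (simp add: zero_mult_pair_def)
qed
end

definition pre_tensor :: "'a \<Rightarrow> 'b \<Rightarrow> ('a, 'b) mult_pair \<Rightarrow>\<^sub>0 complex" where
  "pre_tensor x y = Poly_Mapping.single (Mult_Pair x y) 1"

inductive_set tensor_null ::
  "(('a::complex_algebra_1, 'b::complex_algebra_1) mult_pair \<Rightarrow>\<^sub>0 complex) set" where
  tensor_null_add_left: "pre_tensor (x + x') y - (pre_tensor x y + pre_tensor x' y) \<in> tensor_null"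
| tensor_null_add_right: "pre_tensor x (y + y') - (pre_tensor x y + pre_tensor x y') \<in> tensor_null"
| tensor_null_scale_left: "pre_tensor (c *\<^sub>C x) y - pm_scale c (pre_tensor x y) \<in> tensor_null"
| tensor_null_scale_right: "pre_tensor x (c *\<^sub>C y) - pm_scale c (pre_tensor x y) \<in> tensor_null"
| tensor_null_zero: "0 \<in> tensor_null"
| tensor_null_add: "p \<in> tensor_null \<Longrightarrow> q \<in> tensor_null \<Longrightarrow> p + q \<in> tensor_null"
| tensor_null_scale: "p \<in> tensor_null \<Longrightarrow> pm_scale c p \<in> tensor_null"

lemma pm_scale_diff_right: "pm_scale c (p - q) = pm_scale c p - pm_scale c q"
  by (auto intro!: poly_mapping_eqI simp: lookup_pm_scale lookup_minus right_diff_distrib)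

lemma pm_scale_minus_one: "pm_scale (-1) p = - p"
  by (auto intro!: poly_mapping_eqI simp: lookup_pm_scale)

lemma pm_expand: "p = (\<Sum>k\<in>Poly_Mapping.keys p. pm_scale (Poly_Mapping.lookup p k) (Poly_Mapping.single k 1))"
  by (rule poly_mapping_eqI)
     (auto simp: lookup_sum lookup_pm_scale lookup_single when_def in_keys_iff if_distrib cong: if_cong)

lemma pre_tensor_mult: "pre_tensor x y * pre_tensor x' y' = pre_tensor (x * x') (y * y')"
  by (simp add: pre_tensor_def mult_single)

lemma tensor_null_uminus: "p \<in> tensor_null \<Longrightarrow> - p \<in> tensor_null"
  using tensor_null_scale[of p "-1"] by (simp add: pm_scale_minus_one)

lemma tensor_null_sum: "(\<And>k. k \<in> A \<Longrightarrow> f k \<in> tensor_null) \<Longrightarrow> sum f A \<in> tensor_null"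
  by (induction A rule: infinite_finite_induct) (auto intro: tensor_null.intros)

lemma tensor_null_pre_left: "p \<in> tensor_null \<Longrightarrow> pre_tensor a b * p \<in> tensor_null"
  by (induction rule: tensor_null.induct)
     (auto simp: right_diff_distrib distrib_left pre_tensor_mult pm_scale_mult_right mult_scaleC_right
        intro: tensor_null.intros)

lemma tensor_null_pre_right: "p \<in> tensor_null \<Longrightarrow> p * pre_tensor a b \<in> tensor_null"
  by (induction rule: tensor_null.induct)
     (auto simp: left_diff_distrib distrib_right pre_tensor_mult pm_scale_mult_left mult_scaleC_left
        intro: tensor_null.intros)

lemma tensor_null_left:
  assumes "p \<in> tensor_null"
  shows "q * p \<in> tensor_null"
proof -
  have "Poly_Mapping.single k 1 * p \<in> tensor_null" for k
    using tensor_null_pre_left[OF assms] by (cases k) (auto simp: pre_tensor_def)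
  then have "(\<Sum>k\<in>Poly_Mapping.keys q. pm_scale (Poly_Mapping.lookup q k) (Poly_Mapping.single k 1)) * p \<in> tensor_null"
    by (auto simp: sum_distrib_right pm_scale_mult_left intro!: tensor_null_sum tensor_null_scale)
  then show ?thesis by (simp flip: pm_expand)
qed

lemma tensor_null_right:
  assumes "p \<in> tensor_null"
  shows "p * q \<in> tensor_null"
proof -
  have "p * Poly_Mapping.single k 1 \<in> tensor_null" for k
    using tensor_null_pre_right[OF assms] by (cases k) (auto simp: pre_tensor_def)
  then have "p * (\<Sum>k\<in>Poly_Mapping.keys q. pm_scale (Poly_Mapping.lookup q k) (Poly_Mapping.single k 1)) \<in> tensor_null"
    by (auto simp: sum_distrib_left pm_scale_mult_right intro!: tensor_null_sum tensor_null_scale)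
  then show ?thesis by (simp flip: pm_expand)
qed

lemma ideal_gen_tensor_null: "ideal_gen tensor_null = tensor_null"
proof -
  have "p \<in> tensor_null" if "p \<in> ideal_gen tensor_null" for p :: "('a, 'b) mult_pair \<Rightarrow>\<^sub>0 complex"
    using that by induction (auto intro: tensor_null_left tensor_null_right tensor_null.intros)
  then show ?thesis by (auto intro: ideal_gen_base)
qed

subsection \<open>Bilinear maps\<close>

definition cbilinear ::
  "('a::complex_algebra_1 \<Rightarrow> 'b::complex_algebra_1 \<Rightarrow> 'c::complex_algebra_1) \<Rightarrow> bool" where
  "cbilinear \<beta> \<longleftrightarrow> (\<forall>y. clinear (\<lambda>x. \<beta> x y)) \<and> (\<forall>x. clinear (\<beta> x))"

definition pre_lift ::
  "('a \<Rightarrow> 'b \<Rightarrow> 'c) \<Rightarrow> (('a, 'b) mult_pair \<Rightarrow>\<^sub>0 complex) \<Rightarrow> 'c::complex_algebra_1" where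
  "pre_lift \<beta> p = (\<Sum>k\<in>Poly_Mapping.keys p. Poly_Mapping.lookup p k *\<^sub>C (case k of Mult_Pair x y \<Rightarrow> \<beta> x y))"

lemma scaleC_sum_right: "c *\<^sub>C sum f A = (\<Sum>a\<in>A. c *\<^sub>C (f a :: 'a::complex_algebra_1))"
  by (induction A rule: infinite_finite_induct) (auto simp: scaleC_add_right)

lemma pre_lift_superset:
  assumes "finite A" "Poly_Mapping.keys p \<subseteq> A"
  shows "pre_lift \<beta> p = (\<Sum>k\<in>A. Poly_Mapping.lookup p k *\<^sub>C (case k of Mult_Pair x y \<Rightarrow> \<beta> x y))"
  unfolding pre_lift_def by (rule sum.mono_neutral_left) (use assms in \<open>auto simp: in_keys_iff\<close>)

lemma pre_lift_add: "pre_lift \<beta> (p + q) = pre_lift \<beta> p + pre_lift \<beta> q"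
proof -
  let ?A = "Poly_Mapping.keys p \<union> Poly_Mapping.keys q"
  have "Poly_Mapping.keys (p + q) \<subseteq> ?A" by (rule keys_add)
  then show ?thesis
    using pre_lift_superset[of ?A p \<beta>] pre_lift_superset[of ?A q \<beta>] pre_lift_superset[of ?A "p + q" \<beta>]
    by (simp add: lookup_add scaleC_add_left sum.distrib)
qed

lemma pre_lift_zero [simp]: "pre_lift \<beta> 0 = 0"
  by (simp add: pre_lift_def)

lemma pre_lift_scale:
  fixes p :: "('a::monoid_mult, 'b::monoid_mult) mult_pair \<Rightarrow>\<^sub>0 complex"
  shows "pre_lift \<beta> (pm_scale c p) = c *\<^sub>C pre_lift \<beta> p"
proof -
  have "Poly_Mapping.keys (pm_scale c p) \<subseteq> Poly_Mapping.keys p" by (auto simp: in_keys_iff lookup_pm_scale)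
  then show ?thesis
    using pre_lift_superset[of "Poly_Mapping.keys p" "pm_scale c p" \<beta>]
    by (simp add: lookup_pm_scale pre_lift_def scaleC_sum_right scaleC_scaleC)
qed

lemma pre_lift_diff:
  fixes p :: "('a::monoid_mult, 'b::monoid_mult) mult_pair \<Rightarrow>\<^sub>0 complex"
  shows "pre_lift \<beta> (p - q) = pre_lift \<beta> p - pre_lift \<beta> q"
  using pre_lift_add[of \<beta> p "- q"] pre_lift_scale[of \<beta> "-1" q]
  by (simp add: pm_scale_minus_one scaleC_minus_one)

lemma pre_lift_pre_tensor: "pre_lift \<beta> (pre_tensor x y) = \<beta> x y"
  by (simp add: pre_lift_def pre_tensor_def scaleC_one)

lemma pre_lift_null:
  assumes "cbilinear \<beta>" "p \<in> tensor_null"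
  shows "pre_lift \<beta> p = 0"
  using assms(2)
  by induction
     (use assms(1) in \<open>auto simp: pre_lift_diff pre_lift_add pre_lift_scale pre_lift_pre_tensor
        cbilinear_def clinear_def\<close>)

lemma exists_clinear_one: "\<exists>f::'a::complex_algebra_1 \<Rightarrow> complex. clinear f \<and> f 1 = 1"
proof -
  have "vector_space (scaleC :: complex \<Rightarrow> 'a \<Rightarrow> 'a)"
    by unfold_locales (simp_all add: scaleC_add_left scaleC_add_right scaleC_scaleC scaleC_one)
  moreover have "vector_space ((*) :: complex \<Rightarrow> complex \<Rightarrow> complex)"
    by unfold_locales (simp_all add: algebra_simps)
  ultimately interpret vector_space_pair "scaleC :: complex \<Rightarrow> 'a \<Rightarrow> 'a" "(*) :: complex \<Rightarrow> complex \<Rightarrow> complex"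
    by (simp add: vector_space_pair_def)
  have "vs1.independent {1::'a}" by (simp add: vs1.dependent_single)
  from linear_independent_extend[OF this, of "\<lambda>_. 1"]
  obtain g :: "'a \<Rightarrow> complex" where g: "Vector_Spaces.linear scaleC (*) g" "g 1 = 1" by auto
  have "g (x + y) = g x + g y" "g (c *\<^sub>C x) = c * g x" for x y c
    using linear_add[OF g(1)] linear_scale[OF g(1)] by auto
  with g(2) show ?thesis by (auto simp: clinear_def scaleC_complex_def)
qed

lemma one_notin_tensor_null:
  "(1 :: ('a::complex_algebra_1, 'b::complex_algebra_1) mult_pair \<Rightarrow>\<^sub>0 complex) \<notin> tensor_null"
proof
  assume *: "(1 :: ('a, 'b) mult_pair \<Rightarrow>\<^sub>0 complex) \<in> tensor_null"
  obtain f :: "'a \<Rightarrow> complex" where f: "clinear f" "f 1 = 1" using exists_clinear_one by blast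
  obtain g :: "'b \<Rightarrow> complex" where g: "clinear g" "g 1 = 1" using exists_clinear_one by blast
  have "cbilinear (\<lambda>x y. f x * g y)"
    using f g by (auto simp: cbilinear_def clinear_def algebra_simps scaleC_complex_def)
  from pre_lift_null[OF this *] have "pre_lift (\<lambda>x y. f x * g y) (pre_tensor 1 1) = 0"
    by (simp add: pre_tensor_def flip: zero_mult_pair_def single_one)
  with f g show False by (simp add: pre_lift_pre_tensor)
qed

subsection \<open>The tensor product algebra\<close>

text \<open>The linear span \<open>tensor_null\<close> is already an ideal, see \<open>ideal_gen_tensor_null\<close>.\<close>

quotient_type (overloaded) ('a, 'b) tensor = "('a::complex_algebra_1, 'b::complex_algebra_1) mult_pair \<Rightarrow>\<^sub>0 complex" / "\<lambda>p q. p - q \<in> ideal_gen tensor_null"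
  by (rule equivp_ideal_gen)

instantiation tensor :: (complex_algebra_1, complex_algebra_1) complex_algebra_1
begin
lift_definition zero_tensor :: "('a, 'b) tensor" is 0 .
lift_definition one_tensor :: "('a, 'b) tensor" is 1 .
lift_definition plus_tensor :: "('a, 'b) tensor \<Rightarrow> ('a, 'b) tensor \<Rightarrow> ('a, 'b) tensor" is "(+)" by (rule ideal_gen_cong_add)
lift_definition minus_tensor :: "('a, 'b) tensor \<Rightarrow> ('a, 'b) tensor \<Rightarrow> ('a, 'b) tensor" is "(-)" by (rule ideal_gen_cong_diff)
lift_definition uminus_tensor :: "('a, 'b) tensor \<Rightarrow> ('a, 'b) tensor" is uminus by (rule ideal_gen_cong_uminus)
lift_definition times_tensor :: "('a, 'b) tensor \<Rightarrow> ('a, 'b) tensor \<Rightarrow> ('a, 'b) tensor" is "(*)" by (rule ideal_gen_cong_mult)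
lift_definition scaleC_tensor :: "complex \<Rightarrow> ('a, 'b) tensor \<Rightarrow> ('a, 'b) tensor" is pm_scale
  by (rule ideal_gen_cong_pm_scale)
instance
proof
  show "(0::('a, 'b) tensor) \<noteq> 1"
    by transfer (metis ideal_gen_tensor_null one_notin_tensor_null diff_0 add.inverse_inverse tensor_null_uminus)
qed (transfer, rule ideal_gen_eqI,
    simp add: algebra_simps pm_scale_add_right pm_scale_add_left pm_scale_pm_scale pm_scale_one pm_scale_mult_left pm_scale_mult_right)+
end

lift_definition tensor :: "'a::complex_algebra_1 \<Rightarrow> 'b::complex_algebra_1 \<Rightarrow> ('a, 'b) tensor"
  (infixl \<open>\<otimes>\<close> 70) is pre_tensor .

text \<open>Independent of the representative only for bilinear \<open>\<beta>\<close>, see \<open>tensor_lift_abs\<close>.\<close>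

definition tensor_lift ::
  "('a \<Rightarrow> 'b \<Rightarrow> 'c) \<Rightarrow> ('a::complex_algebra_1, 'b::complex_algebra_1) tensor \<Rightarrow> 'c::complex_algebra_1"
where
  "tensor_lift \<beta> t = pre_lift \<beta> (rep_tensor t)"

definition tensor_map ::
  "('a::complex_algebra_1 \<Rightarrow> 'c::complex_algebra_1) \<Rightarrow> ('b::complex_algebra_1 \<Rightarrow> 'd::complex_algebra_1)
    \<Rightarrow> ('a, 'b) tensor \<Rightarrow> ('c, 'd) tensor"
where
  "tensor_map f g = tensor_lift (\<lambda>x y. f x \<otimes> g y)"

lemma tensor_lift_abs:
  assumes "cbilinear \<beta>"
  shows "tensor_lift \<beta> (abs_tensor p) = pre_lift \<beta> p"
proof -
  have "rep_tensor (abs_tensor p) - p \<in> tensor_null"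
    using Quotient3_rep_abs[OF Quotient3_tensor, of p] ideal_gen_eqI[of p p tensor_null]
    by (simp add: ideal_gen_tensor_null)
  from pre_lift_null[OF assms this] show ?thesis
    by (simp add: tensor_lift_def pre_lift_diff)
qed

lemma tensor_lift_tensor: "cbilinear \<beta> \<Longrightarrow> tensor_lift \<beta> (x \<otimes> y) = \<beta> x y"
  by (simp add: tensor.abs_eq tensor_lift_abs pre_lift_pre_tensor)

lemma clinear_tensor_lift:
  fixes \<beta> :: "'a::complex_algebra_1 \<Rightarrow> 'b::complex_algebra_1 \<Rightarrow> 'c::complex_algebra_1"
  assumes "cbilinear \<beta>"
  shows "clinear (tensor_lift \<beta>)"
  unfolding clinear_def
proof (intro conjI allI)
  fix s t :: "('a, 'b) tensor" and c :: complex
  obtain p q where "s = abs_tensor p" "t = abs_tensor q"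
    by (metis Quotient3_abs_rep[OF Quotient3_tensor])
  then show "tensor_lift \<beta> (s + t) = tensor_lift \<beta> s + tensor_lift \<beta> t"
    and "tensor_lift \<beta> (c *\<^sub>C s) = c *\<^sub>C tensor_lift \<beta> s"
    by (simp_all add: tensor_lift_abs assms plus_tensor.abs_eq scaleC_tensor.abs_eq
        pre_lift_add pre_lift_scale)
qed

lemma tensor_mult: "(x \<otimes> y) * (x' \<otimes> y') = (x * x') \<otimes> (y * y')"
  by (simp add: tensor.abs_eq times_tensor.abs_eq pre_tensor_mult)

lemma one_tensor_one: "1 \<otimes> 1 = 1"
  by (simp add: tensor.abs_eq one_tensor.abs_eq pre_tensor_def flip: zero_mult_pair_def single_one)

lemma tensor_linear:
  "(x + x') \<otimes> y = x \<otimes> y + x' \<otimes> y" "x \<otimes> (y + y') = x \<otimes> y + x \<otimes> y'"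
  "(c *\<^sub>C x) \<otimes> y = c *\<^sub>C (x \<otimes> y)" "x \<otimes> (c *\<^sub>C y) = c *\<^sub>C (x \<otimes> y)"
  by (transfer, simp only: ideal_gen_tensor_null, rule tensor_null.intros)+

lemma cbilinear_tensor: "cbilinear (\<otimes>)"
  by (simp add: cbilinear_def clinear_def tensor_linear)

lemma tensor_map_tensor:
  assumes "clinear f" "clinear g"
  shows "tensor_map f g (x \<otimes> y) = f x \<otimes> g y"
proof -
  have "cbilinear (\<lambda>x y. f x \<otimes> g y)"
    using assms by (simp add: cbilinear_def clinear_def tensor_linear)
  then show ?thesis by (simp add: tensor_map_def tensor_lift_tensor)
qed

section \<open>The Yangian \<open>Y(2)\<close> and its twisted subalgebras\<close>

text \<open>The indices \<open>-1\<close> and \<open>1\<close>.\<close>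

datatype ix2 = Minus | Plus

lemma UNIV_ix2: "UNIV = {Minus, Plus}"
  using ix2.exhaust by auto

instance ix2 :: finite
  by standard (simp add: UNIV_ix2)

instantiation ix2 :: uminus
begin
fun uminus_ix2 :: "ix2 \<Rightarrow> ix2" where
  "- Minus = Plus" | "- Plus = Minus"
instance ..
end

fun ix_sign :: "ix2 \<Rightarrow> 'a::ring_1" where
  "ix_sign Minus = -1" | "ix_sign Plus = 1"

text \<open>\<open>flip_t\<close> is the linear map \<open>E\<^sub>i\<^sub>j \<mapsto> E\<^sub>-\<^sub>j\<^sub>,\<^sub>-\<^sub>i\<close>: this is \<open>t\<^sub>+\<close> for \<open>2 \<times> 2\<close> matrices and \<open>t\<close> for
  \<open>4 \<times> 4\<close> matrices.\<close>

definition flip_t :: "'a^('n::{finite,uminus})^('n::{finite,uminus}) \<Rightarrow> 'a^('n::{finite,uminus})^('n::{finite,uminus})" where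
  "flip_t A = (\<chi> i j. A $ (- j) $ (- i))"

definition t_minus :: "'a::ring_1^ix2^ix2 \<Rightarrow> 'a^ix2^ix2" where
  "t_minus A = (\<chi> i j. ix_sign i * ix_sign j * A $ (- j) $ (- i))"

definition K_mat :: "'a::ring_1^ix2^ix2" where
  "K_mat = matrix_unit Plus Plus - matrix_unit Minus Minus"

text \<open>\<open>R\<^sup>\<circ>(u - v) = I - P / (u - v)\<close> multiplied by \<open>u\<^sup>-\<^sup>1 v\<^sup>-\<^sup>1 (u - v) = v\<^sup>-\<^sup>1 - u\<^sup>-\<^sup>1\<close>, which has
  coefficients in power series in \<open>u\<^sup>-\<^sup>1\<close> and \<open>v\<^sup>-\<^sup>1\<close>.\<close>

definition R_circ :: "'a::ring_1 fps fps^(ix2 \<times> ix2)^(ix2 \<times> ix2)" where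
  "R_circ = mat (vinv - uinv) - mat (uinv * vinv) ** P_mat"

definition Y2_rels :: "(ix2 \<times> ix2 \<times> nat) free_alg set" where
  "Y2_rels = RTT_coeffs R_circ free_T"

lemma one_notin_RTT_ideal:
  "(1 :: ('n::finite \<times> 'n \<times> nat) free_alg) \<notin> ideal_gen (RTT_coeffs R free_T)"
proof
  assume "(1 :: ('n \<times> 'n \<times> nat) free_alg) \<in> ideal_gen (RTT_coeffs R free_T)"
  with ring_hom1_ideal_gen[OF ring_hom1_counit] RTT_coeffs_counit[OF ring_hom1_counit counit_free_T]
  have "Poly_Mapping.lookup (1 :: ('n \<times> 'n \<times> nat) free_alg) 0 = 0" by blast
  then show False by simp
qed

quotient_type Y2 = "(ix2 \<times> ix2 \<times> nat) free_alg" / "\<lambda>p q. p - q \<in> ideal_gen Y2_rels"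
  by (rule equivp_ideal_gen)

instantiation Y2 :: complex_algebra_1
begin
lift_definition zero_Y2 :: "Y2" is 0 .
lift_definition one_Y2 :: "Y2" is 1 .
lift_definition plus_Y2 :: "Y2 \<Rightarrow> Y2 \<Rightarrow> Y2" is "(+)" by (rule ideal_gen_cong_add)
lift_definition minus_Y2 :: "Y2 \<Rightarrow> Y2 \<Rightarrow> Y2" is "(-)" by (rule ideal_gen_cong_diff)
lift_definition uminus_Y2 :: "Y2 \<Rightarrow> Y2" is uminus by (rule ideal_gen_cong_uminus)
lift_definition times_Y2 :: "Y2 \<Rightarrow> Y2 \<Rightarrow> Y2" is "(*)" by (rule ideal_gen_cong_mult)
lift_definition scaleC_Y2 :: "complex \<Rightarrow> Y2 \<Rightarrow> Y2" is pm_scale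
  by (rule ideal_gen_cong_pm_scale)
instance
proof
  show "(0::Y2) \<noteq> 1"
    by transfer (metis one_notin_RTT_ideal Y2_rels_def diff_0 add.inverse_inverse ideal_gen_uminus)
qed (transfer, rule ideal_gen_eqI,
    simp add: algebra_simps pm_scale_add_right pm_scale_add_left pm_scale_pm_scale pm_scale_one pm_scale_mult_left pm_scale_mult_right)+
end

definition T_circ :: "Y2 fps^ix2^ix2" where
  "T_circ = matrix_map (fps_map abs_Y2) free_T"

definition qdet :: "'a::complex_algebra_1 fps^ix2^ix2 \<Rightarrow> 'a fps" where
  "qdet T = lin_subst 1 (-1) (T $ Minus $ Minus) * T $ Plus $ Plus
          - lin_subst 1 (-1) (T $ Minus $ Plus) * T $ Plus $ Minus"

definition SY2_rels :: "Y2 set" where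
  "SY2_rels = range (fps_nth (qdet T_circ - 1))"

lift_definition counit_Y2 :: "Y2 \<Rightarrow> complex" is "\<lambda>p. Poly_Mapping.lookup p 0"
proof -
  fix p q :: "(ix2 \<times> ix2 \<times> nat) free_alg"
  assume "p - q \<in> ideal_gen Y2_rels"
  with ring_hom1_ideal_gen[OF ring_hom1_counit] RTT_coeffs_counit[OF ring_hom1_counit counit_free_T]
  have "Poly_Mapping.lookup (p - q) 0 = 0" unfolding Y2_rels_def by blast
  then show "Poly_Mapping.lookup p 0 = Poly_Mapping.lookup q 0" by (simp add: lookup_minus)
qed

lemma alg_hom_counit_Y2: "alg_hom counit_Y2"
  unfolding alg_hom_def clinear_def
  by (intro conjI allI; transfer)
     (simp_all add: ring_hom1_simps(2)[OF ring_hom1_counit] lookup_add lookup_pm_scale scaleC_complex_def)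

lemma one_notin_SY2_ideal: "1 \<notin> ideal_gen SY2_rels"
proof
  assume *: "1 \<in> ideal_gen SY2_rels"
  note hom = alg_hom_counit_Y2 ring_hom1_fps_map[OF alg_hom_ring_hom1[OF alg_hom_counit_Y2]]
  have "matrix_map (fps_map counit_Y2) T_circ = mat 1"
    using counit_free_T[where 'n = ix2]
    by (simp add: T_circ_def vec_eq_iff fps_eq_iff counit_Y2.abs_eq)
  then have "fps_map counit_Y2 (T_circ $ i $ j) = (if i = j then 1 else 0)" for i j
    by (simp add: vec_eq_iff mat_def)
  then have "fps_map counit_Y2 (qdet T_circ - 1) = 0"
    by (simp add: qdet_def ring_hom1_simps[OF hom(2)] fps_map_lin_subst[OF hom(1)])
  then have "counit_Y2 x = 0" if "x \<in> SY2_rels" for x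
    using that by (auto simp: SY2_rels_def fps_eq_iff)
  from ring_hom1_ideal_gen[OF alg_hom_ring_hom1[OF alg_hom_counit_Y2] this *]
  show False using alg_hom_counit_Y2 by (simp add: alg_hom_def)
qed

quotient_type SY2 = "Y2" / "\<lambda>p q. p - q \<in> ideal_gen SY2_rels"
  by (rule equivp_ideal_gen)

instantiation SY2 :: complex_algebra_1
begin
lift_definition zero_SY2 :: "SY2" is 0 .
lift_definition one_SY2 :: "SY2" is 1 .
lift_definition plus_SY2 :: "SY2 \<Rightarrow> SY2 \<Rightarrow> SY2" is "(+)" by (rule ideal_gen_cong_add)
lift_definition minus_SY2 :: "SY2 \<Rightarrow> SY2 \<Rightarrow> SY2" is "(-)" by (rule ideal_gen_cong_diff)
lift_definition uminus_SY2 :: "SY2 \<Rightarrow> SY2" is uminus by (rule ideal_gen_cong_uminus)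
lift_definition times_SY2 :: "SY2 \<Rightarrow> SY2 \<Rightarrow> SY2" is "(*)" by (rule ideal_gen_cong_mult)
lift_definition scaleC_SY2 :: "complex \<Rightarrow> SY2 \<Rightarrow> SY2" is scaleC
  by (rule ideal_gen_cong_scaleC)
instance
proof
  show "(0::SY2) \<noteq> 1"
    by transfer (metis one_notin_SY2_ideal diff_0 add.inverse_inverse ideal_gen_uminus)
qed (transfer, rule ideal_gen_eqI,
    simp add: algebra_simps scaleC_add_right scaleC_add_left scaleC_scaleC scaleC_one mult_scaleC_left mult_scaleC_right)+
end

lemma alg_hom_abs_SY2: "alg_hom abs_SY2"
  by (simp add: alg_hom_def clinear_def plus_SY2.abs_eq times_SY2.abs_eq scaleC_SY2.abs_eq one_SY2.abs_eq)

definition T_cal :: "SY2 fps^ix2^ix2" where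
  "T_cal = matrix_map (fps_map abs_SY2) T_circ"

definition twist_plus :: "'a::complex_algebra_1 fps^ix2^ix2 \<Rightarrow> 'a fps^ix2^ix2" where
  "twist_plus T = T ** flip_t (matrix_map (lin_subst (-1) 0) T)"

definition twist_minus :: "'a::complex_algebra_1 fps^ix2^ix2 \<Rightarrow> 'a fps^ix2^ix2" where
  "twist_minus T = T ** t_minus (matrix_map (lin_subst (-1) 0) T)"

typedef Yplus = "subalg_gen (series_coeffs (twist_plus T_circ))"
  by (rule exI, rule subalg_gen_one)

setup_lifting type_definition_Yplus

instantiation Yplus :: complex_algebra_1
begin
lift_definition zero_Yplus :: Yplus is 0 by (rule subalg_gen_zero)
lift_definition one_Yplus :: Yplus is 1 by (rule subalg_gen_one)
lift_definition plus_Yplus :: "Yplus \<Rightarrow> Yplus \<Rightarrow> Yplus" is "(+)" by (rule subalg_gen_add)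
lift_definition minus_Yplus :: "Yplus \<Rightarrow> Yplus \<Rightarrow> Yplus" is "(-)" by (rule subalg_gen_diff)
lift_definition uminus_Yplus :: "Yplus \<Rightarrow> Yplus" is uminus by (rule subalg_gen_uminus)
lift_definition times_Yplus :: "Yplus \<Rightarrow> Yplus \<Rightarrow> Yplus" is "(*)" by (rule subalg_gen_mult)
lift_definition scaleC_Yplus :: "complex \<Rightarrow> Yplus \<Rightarrow> Yplus" is scaleC by (rule subalg_gen_scale)
instance
  by standard (transfer, simp add: algebra_simps scaleC_add_right scaleC_add_left scaleC_scaleC
    scaleC_one mult_scaleC_left mult_scaleC_right)+
end

typedef Yminus = "subalg_gen (series_coeffs (twist_minus T_circ))"
  by (rule exI, rule subalg_gen_one)

setup_lifting type_definition_Yminus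

instantiation Yminus :: complex_algebra_1
begin
lift_definition zero_Yminus :: Yminus is 0 by (rule subalg_gen_zero)
lift_definition one_Yminus :: Yminus is 1 by (rule subalg_gen_one)
lift_definition plus_Yminus :: "Yminus \<Rightarrow> Yminus \<Rightarrow> Yminus" is "(+)" by (rule subalg_gen_add)
lift_definition minus_Yminus :: "Yminus \<Rightarrow> Yminus \<Rightarrow> Yminus" is "(-)" by (rule subalg_gen_diff)
lift_definition uminus_Yminus :: "Yminus \<Rightarrow> Yminus" is uminus by (rule subalg_gen_uminus)
lift_definition times_Yminus :: "Yminus \<Rightarrow> Yminus \<Rightarrow> Yminus" is "(*)" by (rule subalg_gen_mult)
lift_definition scaleC_Yminus :: "complex \<Rightarrow> Yminus \<Rightarrow> Yminus" is scaleC by (rule subalg_gen_scale)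
instance
  by standard (transfer, simp add: algebra_simps scaleC_add_right scaleC_add_left scaleC_scaleC
    scaleC_one mult_scaleC_left mult_scaleC_right)+
end

typedef SYplus = "subalg_gen (series_coeffs (twist_plus T_cal))"
  by (rule exI, rule subalg_gen_one)

setup_lifting type_definition_SYplus

instantiation SYplus :: complex_algebra_1
begin
lift_definition zero_SYplus :: SYplus is 0 by (rule subalg_gen_zero)
lift_definition one_SYplus :: SYplus is 1 by (rule subalg_gen_one)
lift_definition plus_SYplus :: "SYplus \<Rightarrow> SYplus \<Rightarrow> SYplus" is "(+)" by (rule subalg_gen_add)
lift_definition minus_SYplus :: "SYplus \<Rightarrow> SYplus \<Rightarrow> SYplus" is "(-)" by (rule subalg_gen_diff)
lift_definition uminus_SYplus :: "SYplus \<Rightarrow> SYplus" is uminus by (rule subalg_gen_uminus)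
lift_definition times_SYplus :: "SYplus \<Rightarrow> SYplus \<Rightarrow> SYplus" is "(*)" by (rule subalg_gen_mult)
lift_definition scaleC_SYplus :: "complex \<Rightarrow> SYplus \<Rightarrow> SYplus" is scaleC by (rule subalg_gen_scale)
instance
  by standard (transfer, simp add: algebra_simps scaleC_add_right scaleC_add_left scaleC_scaleC
    scaleC_one mult_scaleC_left mult_scaleC_right)+
end

typedef SYminus = "subalg_gen (series_coeffs (twist_minus T_cal))"
  by (rule exI, rule subalg_gen_one)

setup_lifting type_definition_SYminus

instantiation SYminus :: complex_algebra_1
begin
lift_definition zero_SYminus :: SYminus is 0 by (rule subalg_gen_zero)
lift_definition one_SYminus :: SYminus is 1 by (rule subalg_gen_one)
lift_definition plus_SYminus :: "SYminus \<Rightarrow> SYminus \<Rightarrow> SYminus" is "(+)" by (rule subalg_gen_add)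
lift_definition minus_SYminus :: "SYminus \<Rightarrow> SYminus \<Rightarrow> SYminus" is "(-)" by (rule subalg_gen_diff)
lift_definition uminus_SYminus :: "SYminus \<Rightarrow> SYminus" is uminus by (rule subalg_gen_uminus)
lift_definition times_SYminus :: "SYminus \<Rightarrow> SYminus \<Rightarrow> SYminus" is "(*)" by (rule subalg_gen_mult)
lift_definition scaleC_SYminus :: "complex \<Rightarrow> SYminus \<Rightarrow> SYminus" is scaleC by (rule subalg_gen_scale)
instance
  by standard (transfer, simp add: algebra_simps scaleC_add_right scaleC_add_left scaleC_scaleC
    scaleC_one mult_scaleC_left mult_scaleC_right)+
end

definition S_circ :: "Yplus fps^ix2^ix2" where
  "S_circ = matrix_map (fps_map Abs_Yplus) (twist_plus T_circ)"

lemma Rep_S_circ: "matrix_map (fps_map Rep_Yplus) S_circ = twist_plus T_circ"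
  by (simp add: S_circ_def vec_eq_iff fps_eq_iff Abs_Yplus_inverse subalg_gen_base in_series_coeffs)

definition S_bullet :: "Yminus fps^ix2^ix2" where
  "S_bullet = matrix_map (fps_map Abs_Yminus) (twist_minus T_circ)"

lemma Rep_S_bullet: "matrix_map (fps_map Rep_Yminus) S_bullet = twist_minus T_circ"
  by (simp add: S_bullet_def vec_eq_iff fps_eq_iff Abs_Yminus_inverse subalg_gen_base in_series_coeffs)

lemma T_cal_twist_plus: "twist_plus T_cal = matrix_map (fps_map abs_SY2) (twist_plus T_circ)"
proof -
  note h = ring_hom1_fps_map[OF alg_hom_ring_hom1[OF alg_hom_abs_SY2]]
  show ?thesis
    unfolding twist_plus_def matrix_map_mult[OF h] T_cal_def
    by (rule arg_cong2[where f = "(**)"])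
       (simp_all add: vec_eq_iff flip_t_def fps_map_lin_subst[OF alg_hom_abs_SY2])
qed

lemma T_cal_twist_minus: "twist_minus T_cal = matrix_map (fps_map abs_SY2) (twist_minus T_circ)"
proof -
  note h = ring_hom1_fps_map[OF alg_hom_ring_hom1[OF alg_hom_abs_SY2]]
  have sgn: "fps_map abs_SY2 (ix_sign i) = ix_sign i" for i
    by (cases i) (simp_all add: ring_hom1_simps[OF h])
  show ?thesis
    unfolding twist_minus_def matrix_map_mult[OF h] T_cal_def
    by (rule arg_cong2[where f = "(**)"])
       (simp_all add: vec_eq_iff t_minus_def fps_map_lin_subst[OF alg_hom_abs_SY2]
          ring_hom1_simps[OF h] sgn)
qed

lift_definition Pr_plus :: "Yplus \<Rightarrow> SYplus" is abs_SY2
  using subalg_gen_map[OF alg_hom_abs_SY2] by (simp add: T_cal_twist_plus series_coeffs_map)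

lift_definition Pr_minus :: "Yminus \<Rightarrow> SYminus" is abs_SY2
  using subalg_gen_map[OF alg_hom_abs_SY2] by (simp add: T_cal_twist_minus series_coeffs_map)

definition Pr1 :: "(Yplus, Yminus) tensor \<Rightarrow> (SYplus, Yminus) tensor" where
  "Pr1 = tensor_map Pr_plus id"

definition Pr2 :: "(Yplus, Yminus) tensor \<Rightarrow> (Yplus, SYminus) tensor" where
  "Pr2 = tensor_map id Pr_minus"

section \<open>The extended Yangian of \<open>so\<^sub>4\<close> and its twisted subalgebra\<close>

text \<open>The indices \<open>-2\<close>, \<open>-1\<close>, \<open>1\<close> and \<open>2\<close>.\<close>

datatype ix4 = M2 | M1 | P1 | P2

lemma UNIV_ix4: "UNIV = {M2, M1, P1, P2}"
  using ix4.exhaust by auto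

instance ix4 :: finite
  by standard (simp add: UNIV_ix4)

instantiation ix4 :: uminus
begin
fun uminus_ix4 :: "ix4 \<Rightarrow> ix4" where
  "- M2 = P2" | "- M1 = P1" | "- P1 = M1" | "- P2 = M2"
instance ..
end

definition Q_mat :: "'a::ring_1^(ix4 \<times> ix4)^(ix4 \<times> ix4)" where
  "Q_mat = (\<Sum>i\<in>UNIV. \<Sum>j\<in>UNIV. kron (matrix_unit i j) (matrix_unit (- i) (- j)))"

text \<open>\<open>R(u - v) = I - P / (u - v) + Q / (u - v - 1)\<close> multiplied by
  \<open>u\<^sup>-\<^sup>1 v\<^sup>-\<^sup>1 (u - v) = v\<^sup>-\<^sup>1 - u\<^sup>-\<^sup>1\<close> and by
  \<open>u\<^sup>-\<^sup>1 v\<^sup>-\<^sup>1 (u - v - 1) = v\<^sup>-\<^sup>1 - u\<^sup>-\<^sup>1 - u\<^sup>-\<^sup>1 v\<^sup>-\<^sup>1\<close>.\<close>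

definition R_so4 :: "'a::ring_1 fps fps^(ix4 \<times> ix4)^(ix4 \<times> ix4)" where
  "R_so4 = (let d = vinv - uinv; d' = vinv - uinv - uinv * vinv in
     mat (d * d') - mat (uinv * vinv * d') ** P_mat + mat (uinv * vinv * d) ** Q_mat)"

definition Xso4_rels :: "(ix4 \<times> ix4 \<times> nat) free_alg set" where
  "Xso4_rels = RTT_coeffs R_so4 free_T"

quotient_type Xso4 = "(ix4 \<times> ix4 \<times> nat) free_alg" / "\<lambda>p q. p - q \<in> ideal_gen Xso4_rels"
  by (rule equivp_ideal_gen)

instantiation Xso4 :: complex_algebra_1
begin
lift_definition zero_Xso4 :: "Xso4" is 0 .
lift_definition one_Xso4 :: "Xso4" is 1 .
lift_definition plus_Xso4 :: "Xso4 \<Rightarrow> Xso4 \<Rightarrow> Xso4" is "(+)" by (rule ideal_gen_cong_add)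
lift_definition minus_Xso4 :: "Xso4 \<Rightarrow> Xso4 \<Rightarrow> Xso4" is "(-)" by (rule ideal_gen_cong_diff)
lift_definition uminus_Xso4 :: "Xso4 \<Rightarrow> Xso4" is uminus by (rule ideal_gen_cong_uminus)
lift_definition times_Xso4 :: "Xso4 \<Rightarrow> Xso4 \<Rightarrow> Xso4" is "(*)" by (rule ideal_gen_cong_mult)
lift_definition scaleC_Xso4 :: "complex \<Rightarrow> Xso4 \<Rightarrow> Xso4" is pm_scale
  by (rule ideal_gen_cong_pm_scale)
instance
proof
  show "(0::Xso4) \<noteq> 1"
    by transfer (metis one_notin_RTT_ideal Xso4_rels_def diff_0 add.inverse_inverse ideal_gen_uminus)
qed (transfer, rule ideal_gen_eqI,
    simp add: algebra_simps pm_scale_add_right pm_scale_add_left pm_scale_pm_scale pm_scale_one pm_scale_mult_left pm_scale_mult_right)+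
end

definition T_so4 :: "Xso4 fps^ix4^ix4" where
  "T_so4 = matrix_map (fps_map abs_Xso4) free_T"

definition G_mat :: "'a::ring_1^ix4^ix4" where
  "G_mat = matrix_unit P1 P1 + matrix_unit P2 P2 - matrix_unit M1 M1 - matrix_unit M2 M2"

definition twist_so4 :: "'a::complex_algebra_1 fps^ix4^ix4 \<Rightarrow> 'a fps^ix4^ix4" where
  "twist_so4 T = matrix_map (lin_subst 1 (-1/2)) T ** G_mat ** flip_t (matrix_map (lin_subst (-1) (1/2)) T)"

typedef Xtw = "subalg_gen (series_coeffs (twist_so4 T_so4))"
  by (rule exI, rule subalg_gen_one)

setup_lifting type_definition_Xtw

instantiation Xtw :: complex_algebra_1
begin
lift_definition zero_Xtw :: Xtw is 0 by (rule subalg_gen_zero)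
lift_definition one_Xtw :: Xtw is 1 by (rule subalg_gen_one)
lift_definition plus_Xtw :: "Xtw \<Rightarrow> Xtw \<Rightarrow> Xtw" is "(+)" by (rule subalg_gen_add)
lift_definition minus_Xtw :: "Xtw \<Rightarrow> Xtw \<Rightarrow> Xtw" is "(-)" by (rule subalg_gen_diff)
lift_definition uminus_Xtw :: "Xtw \<Rightarrow> Xtw" is uminus by (rule subalg_gen_uminus)
lift_definition times_Xtw :: "Xtw \<Rightarrow> Xtw \<Rightarrow> Xtw" is "(*)" by (rule subalg_gen_mult)
lift_definition scaleC_Xtw :: "complex \<Rightarrow> Xtw \<Rightarrow> Xtw" is scaleC by (rule subalg_gen_scale)
instance
  by standard (transfer, simp add: algebra_simps scaleC_add_right scaleC_add_left scaleC_scaleC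
    scaleC_one mult_scaleC_left mult_scaleC_right)+
end

definition S_mat :: "Xtw fps^ix4^ix4" where
  "S_mat = matrix_map (fps_map Abs_Xtw) (twist_so4 T_so4)"

lemma Rep_S_mat: "matrix_map (fps_map Rep_Xtw) S_mat = twist_so4 T_so4"
  by (simp add: S_mat_def vec_eq_iff fps_eq_iff Abs_Xtw_inverse subalg_gen_base in_series_coeffs)

section \<open>The image of \<open>S(u)\<close> in \<open>Y\<^sup>+(2) \<otimes> Y\<^sup>-(2)\<close>\<close>

text \<open>The identification of \<open>\<complex>\<^sup>4\<close> with \<open>\<complex>\<^sup>2 \<otimes> \<complex>\<^sup>2\<close> is \<open>v\<^sub>i = basis_sign i \<cdot> (e\<^sub>a \<otimes> e\<^sub>b)\<close> with
  \<open>(a, b) = basis_ix i\<close>.\<close>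

fun basis_ix :: "ix4 \<Rightarrow> ix2 \<times> ix2" where
  "basis_ix M2 = (Minus, Minus)"
| "basis_ix M1 = (Minus, Plus)"
| "basis_ix P1 = (Plus, Minus)"
| "basis_ix P2 = (Plus, Plus)"

fun basis_sign :: "ix4 \<Rightarrow> 'a::ring_1" where
  "basis_sign M2 = 1" | "basis_sign M1 = 1" | "basis_sign P1 = 1" | "basis_sign P2 = -1"

text \<open>The matrix of an operator on \<open>\<complex>\<^sup>2 \<otimes> \<complex>\<^sup>2\<close> in the basis \<open>v\<close>; each sign is its own inverse.\<close>

definition in_basis_v :: "'a::ring_1^(ix2 \<times> ix2)^(ix2 \<times> ix2) \<Rightarrow> 'a^ix4^ix4" where
  "in_basis_v A = (\<chi> i j. basis_sign i * A $ basis_ix i $ basis_ix j * basis_sign j)"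

definition phi0_image :: "(Yplus, Yminus) tensor fps^ix4^ix4" where
  "phi0_image = in_basis_v
     (kron (matrix_map (fps_map (\<lambda>x. x \<otimes> 1) \<circ> lin_subst 1 (-1/2)) S_circ) (mat 1)
      ** kron K_mat (mat 1)
      ** kron (mat 1) (matrix_map (fps_map (\<lambda>y. 1 \<otimes> y) \<circ> lin_subst 1 (-1/2)) S_bullet))"

end

theory Submission
  imports Defs
begin

text \<open>
  The quantum determinant is central because the RTT relation gives both
  \<open>T(u) T\<^sup>t\<^sup>-(u + 1) = qdet T(u + 1) I\<close> and commutators with \<open>T(v)\<close> that cancel along a row.
  Hence \<open>qdet T\<^sup>\<circ>(u) = d(u) d(u - 1)\<close> for a central series \<open>d\<close>, and
  \<open>\<T>\<^sup>\<circ>(u) \<mapsto> d(u)\<^sup>-\<^sup>1 T\<^sup>\<circ>(u) \<otimes> 1\<close>, \<open>T\<^sup>\<circ>(u) \<mapsto> d(u) \<otimes> T\<^sup>\<circ>(u)\<close> define a homomorphism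
  \<open>SY(2) \<otimes> Y(2) \<rightarrow> Y(2) \<otimes> Y(2)\<close>.  The factors \<open>d\<close> cancel in \<open>S\<^sup>\<circ>(u) K \<otimes> S\<^sup>\<bullet>(u)\<close>, so after \<open>Pr\<^sub>1\<close> it
  recovers the image of \<open>\<phi>\<^sub>0\<close>; this gives injectivity without a PBW theorem.

  For surjectivity, both \<open>A(u) = S\<^sup>\<circ>(u) K\<close> and \<open>A(u) = S\<^sup>\<bullet>(u)\<close> have the form \<open>T(u) G T\<^sup>t\<^sup>-(-u)\<close> with
  \<open>G\<^sup>2 = I\<close>, so that \<open>A(u) A(-u - 1) = I\<close> over \<open>SY(2)\<close>.  This eliminates the special factor from products
  of entries of \<open>S(u)\<close> and \<open>S(-u - 1)\<close>, leaving all products of two entries of the other factor at \<open>u\<close> and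
  \<open>-u - 1\<close>.  Their coefficients yield the generators recursively; the one missing combination, the
  twisted trace in odd degree, vanishes by the RTT relation at \<open>v = -u\<close>.
\<close>

section \<open>Substitutions in power series\<close>

lemma scaleC_sum_left: "sum f A *\<^sub>C (x :: 'a::complex_algebra_1) = (\<Sum>a\<in>A. f a *\<^sub>C x)"
  by (induction A rule: infinite_finite_induct) (auto simp: scaleC_add_left)

lemma scaleC_mult_scaleC:
  "(c *\<^sub>C x) * (d *\<^sub>C y) = (c * d) *\<^sub>C (x * (y :: 'a::complex_algebra_1))"
  by (simp add: mult_scaleC_left mult_scaleC_right scaleC_scaleC mult.commute)

text \<open>With \<open>fps_X\<close> standing for u^{-1}, this is 1/(e u + b) expanded in u^{-1}.
  Its powers are scalar series, so they can be manipulated apart from the coefficients in the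
  algebra.\<close>

definition lin_series :: "complex \<Rightarrow> complex \<Rightarrow> complex fps" where
  "lin_series e b = fps_X * inverse (fps_const e + fps_const b * fps_X)"

lemma lin_series_nth_0 [simp]: "fps_nth (lin_series e b) 0 = 0"
  by (simp add: lin_series_def)

lemma lin_series_power_nth_less: "n < r \<Longrightarrow> fps_nth (lin_series e b ^ r) n = 0"
  using startsby_zero_power_prefix[OF lin_series_nth_0] by blast

lemma lin_series_power_nth_same: "fps_nth (lin_series e b ^ n) n = inverse e ^ n"
  using startsby_zero_power_nth_same[OF lin_series_nth_0, of e b n]
  by (simp add: lin_series_def)

lemma lin_subst_nth:
  "fps_nth (lin_subst e b f) n = (\<Sum>r\<le>n. fps_nth (lin_series e b ^ r) n *\<^sub>C fps_nth f r)"
  by (simp add: lin_subst_def lin_series_def)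

text \<open>The r-th power starts in degree r, so the added terms vanish. A common range for all
  coefficients up to m lets finite sums be interchanged.\<close>

lemma lin_subst_nth_ge:
  assumes "n \<le> m"
  shows "fps_nth (lin_subst e b f) n = (\<Sum>r\<le>m. fps_nth (lin_series e b ^ r) n *\<^sub>C fps_nth f r)"
  unfolding lin_subst_nth
  by (rule sum.mono_neutral_left) (use assms in \<open>auto simp: lin_series_power_nth_less\<close>)

lemma lin_subst_nth_0 [simp]: "fps_nth (lin_subst e b f) 0 = fps_nth f 0"
  by (simp add: lin_subst_nth scaleC_one)

text \<open>\<open>lin_series e b\<close> has leading coefficient 1/e, so the substitution is
  triangular on coefficients. The recursions for the central root and for the generators rest on
  this.\<close>

lemma lin_subst_nth_lead:
  "fps_nth (lin_subst e b f) n =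
    inverse e ^ n *\<^sub>C fps_nth f n + (\<Sum>r<n. fps_nth (lin_series e b ^ r) n *\<^sub>C fps_nth f r)"
  by (cases n)
     (simp_all add: lin_subst_nth lin_series_power_nth_same lessThan_Suc_atMost add.commute
        del: power_Suc)

text \<open>The powers are scalar series, so the exponent i + j splits into a Cauchy product while
  the order of the coefficients of f and g is kept.\<close>

lemma lin_subst_mult: "lin_subst e b (f * g) = lin_subst e b f * lin_subst e b g"
proof (rule fps_ext)
  fix n
  let ?p = "\<lambda>r. fps_nth (lin_series e b ^ r)"
  have "fps_nth (lin_subst e b (f * g)) n
      = (\<Sum>r\<le>n. \<Sum>i\<le>r. ?p (i + (r - i)) n *\<^sub>C (fps_nth f i * fps_nth g (r - i)))"
    by (simp add: lin_subst_nth fps_mult_nth scaleC_sum_right atLeast0AtMost)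
  also have "\<dots> = (\<Sum>(i, j)\<in>{(i, j). i + j \<le> n}. ?p (i + j) n *\<^sub>C (fps_nth f i * fps_nth g j))"
    by (rule sum.triangle_reindex_eq[symmetric])
  \<comment> \<open>The triangle may be enlarged to a square, since for i + j > n the power starts
    beyond degree n. Over the square the sums over i and j separate.\<close>
  also have "\<dots> = (\<Sum>(i, j)\<in>{..n} \<times> {..n}. ?p (i + j) n *\<^sub>C (fps_nth f i * fps_nth g j))"
    by (rule sum.mono_neutral_left)
       (auto, metis lin_series_power_nth_less not_le scaleC_zero_left)
  also have "\<dots> = (\<Sum>i\<le>n. \<Sum>j\<le>n. \<Sum>k\<le>n. (?p i k * ?p j (n - k)) *\<^sub>C (fps_nth f i * fps_nth g j))"
    by (simp add: sum.cartesian_product[symmetric] power_add fps_mult_nth scaleC_sum_left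
        atLeast0AtMost)
  also have "\<dots> = (\<Sum>k\<le>n. \<Sum>i\<le>n. \<Sum>j\<le>n. (?p i k * ?p j (n - k)) *\<^sub>C (fps_nth f i * fps_nth g j))"
    by (rule trans[OF sum.cong[OF refl sum.swap] sum.swap])
  also have "\<dots> = (\<Sum>k\<le>n. (\<Sum>i\<le>n. ?p i k *\<^sub>C fps_nth f i) * (\<Sum>j\<le>n. ?p j (n - k) *\<^sub>C fps_nth g j))"
    by (simp add: sum_product scaleC_mult_scaleC)
  also have "\<dots> = (\<Sum>k\<le>n. fps_nth (lin_subst e b f) k * fps_nth (lin_subst e b g) (n - k))"
    by (rule sum.cong) (auto simp: lin_subst_nth_ge[of _ n])
  finally show "fps_nth (lin_subst e b (f * g)) n = fps_nth (lin_subst e b f * lin_subst e b g) n"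
    by (simp add: fps_mult_nth atLeast0AtMost)
qed

lemma ring_hom1_lin_subst: "ring_hom1 (lin_subst e b)"
  by (simp add: ring_hom1_def lin_subst_mult fps_eq_iff lin_subst_nth scaleC_add_right sum.distrib)

lemmas lin_subst_simps = ring_hom1_simps[OF ring_hom1_lin_subst]

text \<open>Replacing u by e' u + b' in f(e u + b): the outer operator supplies the inner affine
  map. The proof composes the two scalar series.\<close>

lemma lin_subst_lin_subst:
  assumes "e \<noteq> 0" "e' \<noteq> 0"
  shows "lin_subst e' b' (lin_subst e b f) = lin_subst (e * e') (e * b' + b) f"
proof (rule fps_ext)
  fix n
  let ?x = "lin_series e b" and ?y = "lin_series e' b'"
  have y: "inverse (fps_const e + fps_const b * fps_X) oo ?y = inverse (fps_const e + fps_const b * ?y)"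
    using assms by (subst fps_inverse_compose) (simp_all add: fps_compose_add_distrib fps_compose_mult_distrib)
  let ?D = "fps_const e' + fps_const b' * fps_X"
  have D0: "fps_nth ?D 0 \<noteq> 0" using assms by simp
  \<comment> \<open>Common denominator: \<open>?D\<close> will cancel against the one contained in
    \<open>?y\<close>.\<close>
  have id: "fps_const e + fps_const b * (fps_X * inverse ?D)
      = (fps_const (e * e') + fps_const (e * b' + b) * fps_X) * inverse ?D"
  proof -
    have "fps_const e = fps_const e * (?D * inverse ?D)"
      using inverse_mult_eq_1'[OF D0] by simp
    then show ?thesis
      by (simp add: algebra_simps flip: fps_const_mult fps_const_add)
  qed
  have "?x oo ?y = ?y * inverse (fps_const e + fps_const b * ?y)"
    by (simp add: lin_series_def[of e b] fps_compose_mult_distrib y)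
  also have "\<dots> = fps_X * inverse ?D * inverse ((fps_const (e * e') + fps_const (e * b' + b) * fps_X) * inverse ?D)"
    by (simp only: lin_series_def id)
  also have "\<dots> = fps_X * inverse (fps_const (e * e') + fps_const (e * b' + b) * fps_X) * (inverse ?D * ?D)"
    using assms D0 by (simp add: fps_inverse_mult ac_simps)
  also have "\<dots> = lin_series (e * e') (e * b' + b)"
    by (simp only: inverse_mult_eq_1[OF D0] mult_1_right lin_series_def)
  finally have xy: "?x oo ?y = lin_series (e * e') (e * b' + b)" .
  have "fps_nth (lin_subst e' b' (lin_subst e b f)) n
      = (\<Sum>s\<le>n. fps_nth (?y ^ s) n *\<^sub>C (\<Sum>r\<le>n. fps_nth (?x ^ r) s *\<^sub>C fps_nth f r))"
    unfolding lin_subst_nth[of e'] by (rule sum.cong) (auto simp: lin_subst_nth_ge[of _ n])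
  also have "\<dots> = (\<Sum>r\<le>n. \<Sum>s\<le>n. (fps_nth (?x ^ r) s * fps_nth (?y ^ s) n) *\<^sub>C fps_nth f r)"
    by (subst sum.swap) (simp add: scaleC_sum_right scaleC_scaleC mult.commute)
  also have "\<dots> = (\<Sum>r\<le>n. fps_nth ((?x ^ r) oo ?y) n *\<^sub>C fps_nth f r)"
    by (simp add: fps_compose_nth scaleC_sum_left atLeast0AtMost)
  finally show "fps_nth (lin_subst e' b' (lin_subst e b f)) n = fps_nth (lin_subst (e * e') (e * b' + b) f) n"
    by (simp add: lin_subst_nth fps_compose_power[symmetric] xy)
qed

lemma lin_subst_one_zero [simp]: "lin_subst 1 0 f = f"
proof (rule fps_ext)
  fix n
  have "lin_series 1 0 = fps_X" by (simp add: lin_series_def)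
  then show "fps_nth (lin_subst 1 0 f) n = fps_nth f n"
    by (simp add: lin_subst_nth if_distrib if_distribR scaleC_one cong: if_cong)
qed

lemma lin_subst_const [simp]: "lin_subst e b (fps_const x) = fps_const x"
  by (rule fps_ext) (auto simp: lin_subst_nth if_distrib scaleC_one sum.delta' cong: if_cong)

text \<open>This is (u + 1)^{-1} = u^{-1} / (1 + u^{-1}) with the denominator cleared, the form in
  which it is used when u is shifted by 1 in the RTT relation.\<close>

lemma lin_subst_X_pos_shift: "(1 + fps_X) * lin_subst 1 1 fps_X = (fps_X :: 'a::complex_algebra_1 fps)"
proof -
  have X: "lin_subst 1 1 (fps_X :: 'a fps) = Abs_fps (\<lambda>n. fps_nth (lin_series 1 1) n *\<^sub>C 1)"
    by (rule fps_ext, case_tac n) (auto simp: lin_subst_nth fps_X_def if_distrib cong: if_cong)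
  have "(1 + fps_X) * lin_series 1 1 = fps_X"
    using inverse_mult_eq_1'[of "1 + fps_X :: complex fps"] by (simp add: lin_series_def ac_simps)
  then have *: "fps_nth ((1 + fps_X) * lin_series 1 1) n = fps_nth fps_X n" for n by simp
  show ?thesis
  proof (rule fps_ext)
    fix n show "fps_nth ((1 + fps_X) * lin_subst 1 1 fps_X) n = fps_nth (fps_X :: 'a fps) n"
      using *[of n] by (cases n) (auto simp: X distrib_right scaleC_add_left[symmetric] scaleC_one)
  qed
qed

lemma lin_series_minus_one: "lin_series (-1) 0 = - fps_X"
  by (simp add: lin_series_def fps_const_inverse flip: fps_const_neg)

lemma lin_subst_X_neg: "lin_subst (-1) 0 fps_X = - (fps_X :: 'a::complex_algebra_1 fps)"
proof (rule fps_ext)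
  fix n
  note lin_series_minus_one
  then show "fps_nth (lin_subst (-1) 0 fps_X) n = fps_nth (- fps_X :: 'a fps) n"
    by (auto simp: lin_subst_nth fps_X_def if_distrib scaleC_minus_one fps_eq_iff cong: if_cong)
qed

lemma lin_subst_neg_nth: "fps_nth (lin_subst (-1) 0 f) n = (-1) ^ n *\<^sub>C fps_nth f n"
proof -
  have "lin_series (-1) 0 ^ r = fps_const ((-1) ^ r) * fps_X ^ r" for r
    by (simp add: lin_series_minus_one power_minus[of fps_X] flip: fps_const_power fps_const_neg)
  then have "fps_nth (lin_series (-1) 0 ^ r) n = (if r = n then (-1) ^ n else 0)" for r
    by (auto simp: fps_X_power_nth)
  then show ?thesis
    by (simp add: lin_subst_nth if_distrib[of "\<lambda>c. c *\<^sub>C _"] cong: if_cong)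
qed

section \<open>Series in two spectral parameters\<close>

text \<open>The specialisation \<open>u = e v + b\<close> of a relation in \<open>u\<close> and \<open>v\<close> is \<open>fps_map (lin_subst e b)\<close>, which acts
  on the inner variable, followed by \<open>diag_series\<close>, which sets \<open>u = v\<close>.\<close>

definition diag_series :: "'a::ring_1 fps fps \<Rightarrow> 'a fps" where
  "diag_series F = Abs_fps (\<lambda>n. \<Sum>s\<le>n. fps_nth (fps_nth F s) (n - s))"

text \<open>Transposing the array of coefficients exchanges the parameters u and v.\<close>

definition swap_series :: "'a::ring_1 fps fps \<Rightarrow> 'a fps fps" where
  "swap_series F = Abs_fps (\<lambda>s. Abs_fps (\<lambda>r. fps_nth (fps_nth F r) s))"

lemma fps_nth_diag_series: "fps_nth (diag_series F) n = (\<Sum>s\<le>n. fps_nth (fps_nth F s) (n - s))"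
  by (simp add: diag_series_def)

lemma diag_series_add: "diag_series (F + G) = diag_series F + diag_series G"
  by (simp add: fps_eq_iff fps_nth_diag_series sum.distrib)

lemma diag_series_const [simp]: "diag_series (fps_const f) = f"
proof (rule fps_ext)
  fix n
  have "(\<Sum>s\<le>n. fps_nth (fps_nth (fps_const f) s) (n - s)) = (\<Sum>s\<le>n. if s = 0 then fps_nth f n else 0)"
    by (rule sum.cong) auto
  then show "fps_nth (diag_series (fps_const f)) n = fps_nth f n"
    by (simp add: fps_nth_diag_series)
qed

lemma diag_series_vinv_mult: "diag_series (fps_X * F) = fps_X * diag_series F"
proof (rule fps_ext)
  fix n show "fps_nth (diag_series (fps_X * F)) n = fps_nth (fps_X * diag_series F) n"
    by (cases n) (simp_all add: fps_nth_diag_series sum.atMost_Suc_shift del: sum.atMost_Suc)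
qed

lemma diag_series_const_mult: "diag_series (fps_const f * G) = f * diag_series G"
proof (rule fps_ext)
  fix n
  have "fps_nth (diag_series (fps_const f * G)) n
     = (\<Sum>s\<le>n. \<Sum>a\<le>n - s. fps_nth f a * fps_nth (fps_nth G s) (n - s - a))"
    unfolding fps_nth_diag_series fps_mult_left_const_nth by (simp add: fps_mult_nth atLeast0AtMost)
  also have "\<dots> = (\<Sum>a\<le>n. \<Sum>s\<le>n - a. fps_nth f a * fps_nth (fps_nth G s) (n - s - a))"
    unfolding sum.Sigma[OF finite_atMost ballI[OF finite_atMost]]
    by (rule sum.reindex_bij_witness[of _ "\<lambda>(i, j). (j, i)" "\<lambda>(i, j). (j, i)"]) auto
  also have "\<dots> = fps_nth (f * diag_series G) n"
    by (simp add: fps_nth_diag_series fps_mult_nth atLeast0AtMost sum_distrib_left add.commute)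
  finally show "fps_nth (diag_series (fps_const f * G)) n = fps_nth (f * diag_series G) n" .
qed

lemma fps_decompose: "(F :: 'a::ring_1 fps) = fps_const (fps_nth F 0) + fps_X * fps_shift 1 F"
  by (rule fps_ext, case_tac n) auto

text \<open>Induction on the degree with F arbitrary: the part of F constant in v^{-1} is handled by
  \<open>diag_series_const_mult\<close>, and the rest carries a factor v^{-1}, which lowers the
  degree by one.\<close>

lemma diag_series_mult: "diag_series (F * G) = diag_series F * diag_series G"
proof (rule fps_ext)
  fix n show "fps_nth (diag_series (F * G)) n = fps_nth (diag_series F * diag_series G) n"
  proof (induction n arbitrary: F rule: less_induct)
    case (less n)
    let ?f = "fps_nth F 0" and ?F' = "fps_shift 1 F"
    have "diag_series (F * G) = ?f * diag_series G + fps_X * diag_series (?F' * G)"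
      by (subst fps_decompose[of F])
         (simp only: distrib_right mult.assoc diag_series_add diag_series_const_mult diag_series_vinv_mult)
    moreover have "diag_series F = ?f + fps_X * diag_series ?F'"
      by (subst fps_decompose[of F])
         (simp only: diag_series_add diag_series_const diag_series_vinv_mult)
    moreover have "fps_nth (fps_X * diag_series (?F' * G)) n = fps_nth (fps_X * (diag_series ?F' * diag_series G)) n"
      using less.IH[of "n - 1"] by (cases n) simp_all
    ultimately show ?case by (simp add: distrib_right mult.assoc)
  qed
qed

lemma ring_hom1_diag_series: "ring_hom1 diag_series"
  unfolding ring_hom1_def using diag_series_const[of 1] by (simp add: diag_series_add diag_series_mult)

lemma diag_series_simps [simp]:
  "diag_series (series_u f) = f" "diag_series (series_v f) = f"
  "diag_series uinv = fps_X"
proof -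
  show "diag_series (series_v f) = f"
  proof (rule fps_ext)
    fix n
    have "(\<Sum>s\<le>n. fps_nth (fps_nth (series_v f) s) (n - s)) = (\<Sum>s\<le>n. if s = n then fps_nth f n else 0)"
      by (rule sum.cong) (auto simp: series_v_def)
    then show "fps_nth (diag_series (series_v f)) n = fps_nth f n"
      by (simp add: fps_nth_diag_series)
  qed
qed (simp_all add: series_u_def uinv_def)

lemma diag_series_vinv [simp]: "diag_series (vinv :: 'a::ring_1 fps fps) = fps_X"
  using diag_series_vinv_mult[of "1 :: 'a fps fps"] diag_series_const[of "1 :: 'a fps"]
  by (simp add: vinv_def)

lemma ring_hom1_swap_series: "ring_hom1 (swap_series :: 'a::ring_1 fps fps \<Rightarrow> 'a fps fps)"
proof -
  have "swap_series (F * G) = swap_series F * swap_series G" for F G :: "'a fps fps"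
    by (rule fps_ext, rule fps_ext)
       (simp add: swap_series_def fps_mult_nth fps_sum_nth, (rule sum.swap)?)
  moreover have "swap_series (1 :: 'a fps fps) = 1"
    by (simp add: swap_series_def fps_eq_iff fps_one_nth)
  ultimately show ?thesis
    by (simp add: ring_hom1_def) (simp add: fps_eq_iff swap_series_def)
qed

lemma swap_series_simps [simp]:
  "swap_series (series_u f) = series_v f" "swap_series (series_v f) = series_u f"
  "swap_series uinv = vinv" "swap_series vinv = uinv"
  by (auto simp: fps_eq_iff swap_series_def series_u_def series_v_def uinv_def vinv_def fps_X_def)

lemma fps_map_lin_subst_simps [simp]:
  "fps_map (lin_subst e b) (series_u f) = series_u (lin_subst e b f)"
  "fps_map (lin_subst e b) (series_v f) = series_v f"
  "fps_map (lin_subst e b) uinv = series_u (lin_subst e b fps_X)"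
  "fps_map (lin_subst e b) vinv = vinv"
  by (auto simp: fps_eq_iff series_u_def series_v_def uinv_def vinv_def fps_X_def)

lemma ring_hom1_series_u: "ring_hom1 series_u"
  by (simp add: ring_hom1_def series_u_def)

lemma ring_hom1_series_v: "ring_hom1 series_v"
  by (simp add: ring_hom1_def series_v_def fps_eq_iff fps_mult_nth fps_sum_nth fps_one_nth)

section \<open>The RTT relation entry by entry\<close>

lemma vinv_commute: "x * vinv = vinv * x"
  unfolding vinv_def by (rule fps_mult_fps_X_commute[symmetric])

lemma uinv_commute: "x * uinv = uinv * x"
  unfolding uinv_def by (rule fps_ext) (simp add: fps_mult_fps_X_commute)

lemma P_mat_nth: "P_mat $ p $ q = (if q = (snd p, fst p) then 1 else 0)"
proof -
  have "P_mat $ p $ q = (\<Sum>i\<in>UNIV. \<Sum>j\<in>UNIV. if i = fst p \<and> j = fst q \<and> j = snd p \<and> i = snd q then 1 else 0)"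
    unfolding P_mat_def by (auto simp: kron_def matrix_unit_def intro!: sum.cong)
  also have "\<dots> = (\<Sum>i\<in>UNIV. if i = fst p then (\<Sum>j\<in>UNIV. if j = fst q then
      (if fst q = snd p \<and> fst p = snd q then 1 else 0) else 0) else 0)"
    by (intro sum.cong refl) (auto intro!: sum.cong sum.neutral)
  also have "\<dots> = (if fst q = snd p \<and> fst p = snd q then 1 else 0)"
    by simp
  finally show ?thesis by (auto simp: prod_eq_iff)
qed

lemma P_mat_mult: "(P_mat ** M) $ p $ q = M $ (snd p, fst p) $ q"
  by (simp add: matrix_matrix_mult_def P_mat_nth if_distrib[of "\<lambda>c. c * _"] cong: if_cong)

lemma mult_P_mat: "(M ** P_mat) $ p $ q = M $ p $ (snd q, fst q)"
proof -
  have "(q = (snd k, fst k)) = (k = (snd q, fst q))" for k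
    by (auto simp: prod_eq_iff)
  then show ?thesis
    by (simp add: matrix_matrix_mult_def P_mat_nth if_distrib[of "\<lambda>c. _ * c"] cong: if_cong)
qed

lemma mat_mult_nth: "(mat c ** M) $ p $ q = c * (M $ p $ q :: 'a::semiring_1)"
  by (simp add: matrix_matrix_mult_def mat_def if_distrib[of "\<lambda>c. c * _"] cong: if_cong)

lemma mult_mat_nth: "(M ** mat c) $ p $ q = (M $ p $ q :: 'a::semiring_1) * c"
  by (simp add: matrix_matrix_mult_def mat_def if_distrib[of "\<lambda>c. _ * c"] cong: if_cong)

lemma kron_mult_nth: "(kron A (mat 1) ** kron (mat 1) B) $ p $ q = (A $ fst p $ fst q * B $ snd p $ snd q :: 'a::ring_1)"
proof -
  have "(kron A (mat 1) ** kron (mat 1) B) $ p $ q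
     = (\<Sum>k\<in>UNIV. if k = (fst q, snd p) then A $ fst p $ fst q * B $ snd p $ snd q else 0)"
    unfolding matrix_matrix_mult_def
    by (auto simp: kron_def mat_def prod_eq_iff intro!: sum.cong)
  then show ?thesis by simp
qed

text \<open>Here the entry of B stands first, opposite to \<open>kron_mult_nth\<close>. This
  difference is what becomes a commutator in the RTT relation.\<close>

lemma kron_mult_swap_nth: "(kron (mat 1) B ** kron A (mat 1)) $ p $ q = (B $ snd p $ snd q * A $ fst p $ fst q :: 'a::ring_1)"
proof -
  have "(kron (mat 1) B ** kron A (mat 1)) $ p $ q
     = (\<Sum>k\<in>UNIV. if k = (fst p, snd q) then B $ snd p $ snd q * A $ fst p $ fst q else 0)"
    unfolding matrix_matrix_mult_def
    by (auto simp: kron_def mat_def prod_eq_iff intro!: sum.cong)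
  then show ?thesis by simp
qed

lemma matrix_diff_mult: "(A - B) ** C = A ** C - B ** (C :: 'a::ring_1^'m^'n)"
  by (simp add: matrix_matrix_mult_def vec_eq_iff left_diff_distrib sum_subtractf)

lemma matrix_mult_diff: "C ** (A - B) = C ** A - C ** (B :: 'a::ring_1^'m^'n)"
  by (simp add: matrix_matrix_mult_def vec_eq_iff right_diff_distrib sum_subtractf)

text \<open>Vanishing of this entry is (u - v) [t_ij(u), t_kl(v)] = t_kj(u) t_il(v) - t_kj(v)
  t_il(u), multiplied by u^{-1} v^{-1}.\<close>

lemma RTT_R_circ_nth:
  "RTT R_circ T $ (i, k) $ (j, l) =
     (vinv - uinv) * (series_u (T $ i $ j) * series_v (T $ k $ l) - series_v (T $ k $ l) * series_u (T $ i $ j))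
     - uinv * vinv * (series_u (T $ k $ j) * series_v (T $ i $ l) - series_v (T $ k $ j) * series_u (T $ i $ l))"
proof -
  let ?T1 = "kron (matrix_map series_u T) (mat 1)" and ?T2 = "kron (mat 1) (matrix_map series_v T)"
  have "RTT R_circ T = mat (vinv - uinv) ** (?T1 ** ?T2) - mat (uinv * vinv) ** (P_mat ** (?T1 ** ?T2))
      - ((?T2 ** ?T1) ** mat (vinv - uinv) - (?T2 ** ?T1) ** mat (uinv * vinv) ** P_mat)"
    by (simp add: RTT_def R_circ_def Let_def matrix_diff_mult matrix_mult_diff matrix_mul_assoc)
  \<comment> \<open>The scalars are built from the central variables, so they also pass to the left
    of the product T_2 T_1.\<close>
  moreover have "x * (vinv - uinv) = (vinv - uinv) * x" "x * (uinv * vinv) = uinv * vinv * x"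
    for x :: "'a fps fps"
    by (simp add: right_diff_distrib left_diff_distrib uinv_commute vinv_commute)
       (metis mult.assoc uinv_commute vinv_commute)
  ultimately show ?thesis
    by (simp add: mat_mult_nth mult_mat_nth P_mat_mult mult_P_mat kron_mult_nth kron_mult_swap_nth right_diff_distrib)
qed

lemma RTT_R_circ_iff:
  "RTT R_circ T = 0 \<longleftrightarrow> (\<forall>i j k l.
     (vinv - uinv) * (series_u (T $ i $ j) * series_v (T $ k $ l) - series_v (T $ k $ l) * series_u (T $ i $ j))
     = uinv * vinv * (series_u (T $ k $ j) * series_v (T $ i $ l) - series_v (T $ k $ j) * series_u (T $ i $ l)))"
  unfolding vec_eq_iff split_paired_All RTT_R_circ_nth zero_index right_minus_eq by blast

section \<open>Central elements; rescaling and functoriality of the RTT relation\<close>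

definition central :: "'a::ring_1 \<Rightarrow> bool" where
  "central z \<longleftrightarrow> (\<forall>x. z * x = x * z)"

lemma central_mult_mult:
  fixes a b :: "'a::monoid_mult"
  assumes "\<And>x. x * a = a * x" "\<And>x. x * b = b * x"
  shows "(a * x) * (b * y) = (a * b) * (x * y)"
proof -
  have "(a * x) * (b * y) = a * (x * b) * y" by (simp only: mult.assoc)
  also have "\<dots> = (a * b) * (x * y)" unfolding assms(2)[of x] by (simp only: mult.assoc)
  finally show ?thesis .
qed

text \<open>Every term of the relation has one factor in u and one in v, so the whole relation is
  multiplied by the central series c(u) c(v).\<close>

lemma RTT_R_circ_scale:
  assumes T: "RTT R_circ T = 0" and c: "central c"
  shows "RTT R_circ (\<chi> i j. c * T $ i $ j) = 0"
  unfolding RTT_R_circ_iff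
proof (intro allI)
  fix i j k l
  let ?c = "series_u c * series_v c"
  have cc: "series_u (c * f) = series_u c * series_u f" "series_v (c * f) = series_v c * series_v f" for f
    using ring_hom1_simps(2)[OF ring_hom1_series_u] ring_hom1_simps(2)[OF ring_hom1_series_v] by auto
  have com: "x * series_u c = series_u c * x" "x * series_v c = series_v c * x" for x :: "'a fps fps"
  proof -
    show "x * series_u c = series_u c * x"
      using c by (simp add: fps_eq_iff series_u_def central_def)
    \<comment> \<open>Commuting c with a constant series isolates its single coefficients.\<close>
    have "fps_nth c n * f = f * fps_nth c n" for n f
    proof -
      have "c * fps_const f = fps_const f * c" using c by (simp add: central_def)
      then have "fps_nth (c * fps_const f) n = fps_nth (fps_const f * c) n" by simp
      then show ?thesis by simp
    qed
    then have *: "fps_const (fps_nth c n) * g = g * fps_const (fps_nth c n)" for n g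
      by (simp add: fps_eq_iff)
    show "x * series_v c = series_v c * x"
    proof (rule fps_ext)
      fix n
      have "fps_nth (x * series_v c) n = (\<Sum>i=0..n. fps_const (fps_nth c (n - i)) * fps_nth x i)"
        unfolding fps_mult_nth * by (simp add: series_v_def)
      also have "\<dots> = (\<Sum>i=0..n. fps_const (fps_nth c i) * fps_nth x (n - i))"
        by (subst sum.atLeastAtMost_rev) simp
      finally show "fps_nth (x * series_v c) n = fps_nth (series_v c * x) n"
        by (simp add: fps_mult_nth series_v_def)
    qed
  qed
  have *: "series_u (c * f) * series_v (c * g) = ?c * (series_u f * series_v g)"
      "series_v (c * g) * series_u (c * f) = ?c * (series_v g * series_u f)" for f g
    using central_mult_mult[OF com, of "series_u f" "series_v g"]
      central_mult_mult[OF com(2,1), of "series_v g" "series_u f"]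
    by (simp_all only: cc com(1)[of "series_v c"])
  have eq: "?c * ((vinv - uinv) * (series_u (T $ i $ j) * series_v (T $ k $ l) - series_v (T $ k $ l) * series_u (T $ i $ j)))
     = ?c * (uinv * vinv * (series_u (T $ k $ j) * series_v (T $ i $ l) - series_v (T $ k $ j) * series_u (T $ i $ l)))"
    using T by (simp add: RTT_R_circ_iff)
  have lc: "?c * (y * x) = y * (?c * x)" for x y
  proof -
    have "y * (?c * x) = (y * series_u c) * series_v c * x" by (simp only: mult.assoc)
    also have "\<dots> = series_u c * (y * series_v c) * x" by (simp only: com(1)[of y] mult.assoc)
    also have "\<dots> = series_u c * (series_v c * y) * x" by (simp only: com(2)[of y])
    also have "\<dots> = ?c * (y * x)" by (simp only: mult.assoc)
    finally show ?thesis by (rule sym)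
  qed
  show "(vinv - uinv) * (series_u ((\<chi> i j. c * T $ i $ j) $ i $ j) * series_v ((\<chi> i j. c * T $ i $ j) $ k $ l)
        - series_v ((\<chi> i j. c * T $ i $ j) $ k $ l) * series_u ((\<chi> i j. c * T $ i $ j) $ i $ j))
     = uinv * vinv * (series_u ((\<chi> i j. c * T $ i $ j) $ k $ j) * series_v ((\<chi> i j. c * T $ i $ j) $ i $ l)
        - series_v ((\<chi> i j. c * T $ i $ j) $ k $ j) * series_u ((\<chi> i j. c * T $ i $ j) $ i $ l))"
    using eq unfolding lc[of "vinv - uinv"] lc[of "uinv * vinv"]
    by (simp only: vec_lambda_beta * flip: right_diff_distrib[of ?c])
qed

lemma RTT_R_circ_map:
  assumes h: "ring_hom1 h"
  shows "RTT R_circ (matrix_map (fps_map h) T) = matrix_map (fps_map (fps_map h)) (RTT R_circ T)"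
proof -
  note H = ring_hom1_fps_map[OF ring_hom1_fps_map[OF h]]
  have "series_u (fps_map h f) = fps_map (fps_map h) (series_u f)"
    "series_v (fps_map h f) = fps_map (fps_map h) (series_v f)" for f
    by (auto simp: fps_eq_iff series_u_def series_v_def ring_hom1_simps[OF h])
  moreover have "fps_map (fps_map h) uinv = uinv" "fps_map (fps_map h) vinv = vinv"
    by (auto simp: fps_eq_iff uinv_def vinv_def fps_X_def ring_hom1_simps[OF h] )
  ultimately show ?thesis
    by (simp add: vec_eq_iff RTT_R_circ_nth ring_hom1_simps[OF H])
qed

lemma fps_X_mult_cancel: "fps_X * f = fps_X * g \<longleftrightarrow> f = (g :: 'a::ring_1 fps)"
proof
  assume *: "fps_X * f = fps_X * g"
  show "f = g"
  proof (rule fps_ext)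
    fix n show "fps_nth f n = fps_nth g n"
      using arg_cong[OF *, of "\<lambda>h. fps_nth h (Suc n)"] by simp
  qed
qed simp

text \<open>In degree s of v^{-1} the hypothesis reads u^{-1} F_s = F_{s-1}, with 0 on the right for
  s = 0; hence the F_s vanish one after the other.\<close>

lemma uinv_minus_vinv_cancel:
  assumes "(uinv - vinv) * F = (0 :: 'a::ring_1 fps fps)"
  shows "F = 0"
proof -
  have "uinv * F = vinv * F" using assms by (simp add: left_diff_distrib)
  then have "fps_nth (uinv * F) s = fps_nth (vinv * F) s" for s by simp
  then have *: "fps_X * fps_nth F s = (if s = 0 then 0 else fps_nth F (s - 1))" for s
    by (simp add: uinv_def vinv_def)
  have X: "fps_X * f = 0 \<Longrightarrow> f = 0" for f :: "'a fps"
    using fps_X_mult_cancel[of f 0] by simp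
  have "fps_nth F s = 0" for s
  proof (induction s)
    case 0
    have "fps_X * fps_nth F 0 = 0" using *[of 0] by simp
    then show ?case by (rule X)
  next
    case (Suc s)
    have "fps_X * fps_nth F (Suc s) = 0" using *[of "Suc s"] Suc by simp
    then show ?case by (rule X)
  qed
  then show ?thesis by (simp add: fps_eq_iff)
qed

section \<open>Entries of 2 x 2 matrices and commutators with quantum minors\<close>

lemma sum_ix2: "(\<Sum>i\<in>UNIV. f i) = f Minus + f Plus"
  by (simp add: UNIV_ix2)

lemma matrix_mult_ix2: "(A ** B) $ i $ j = A $ i $ Minus * B $ Minus $ j + A $ i $ Plus * B $ Plus $ j"
  for A B :: "'a::semiring_1^ix2^ix2"
  by (simp add: matrix_matrix_mult_def sum_ix2)

lemma all_ix2: "(\<forall>i. P i) \<longleftrightarrow> P Minus \<and> P Plus"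
  by (metis ix2.exhaust)

lemma matrix_eq_ix2: "A = B \<longleftrightarrow> A $ Minus $ Minus = B $ Minus $ Minus \<and> A $ Minus $ Plus = B $ Minus $ Plus
   \<and> A $ Plus $ Minus = B $ Plus $ Minus \<and> A $ Plus $ Plus = B $ Plus $ Plus" for A B :: "'a^ix2^ix2"
  by (simp add: vec_eq_iff all_ix2 conj_assoc)

lemma t_minus_simps [simp]:
  "t_minus A $ Minus $ Minus = A $ Plus $ Plus" "t_minus A $ Plus $ Plus = A $ Minus $ Minus"
  "t_minus A $ Minus $ Plus = - (A $ Minus $ Plus)" "t_minus A $ Plus $ Minus = - (A $ Plus $ Minus)"
  by (simp_all add: t_minus_def)

text \<open>Leibniz rule for the commutator of v with the minor d A - c B. All commutators carry the
  factor x, later \<open>uinv - vinv\<close>, because they are known only after multiplication by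
  it.\<close>

lemma scaled_commutator_expand:
  fixes x k :: "'a::ring_1"
  assumes x: "\<And>y z. y * (x * z) = x * (y * z)" and k: "\<And>y z. y * (k * z) = k * (y * z)"
    and d: "x * (v * d - d * v) = k * d'" and A: "x * (v * A - A * v) = k * A'"
    and c: "x * (v * c - c * v) = k * c'" and B: "x * (v * B - B * v) = k * B'"
  shows "x * (v * (d * A - c * B) - (d * A - c * B) * v) = k * (d' * A + d * A' - c' * B - c * B')"
proof -
  have lin: "z * (p + q - r - s) = z * p + z * q - z * r - z * s" for z p q r s :: 'a
    by (simp add: algebra_simps)
  have "v * (d * A - c * B) - (d * A - c * B) * v
      = (v * d - d * v) * A + d * (v * A - A * v) - (v * c - c * v) * B - c * (v * B - B * v)"
    by (simp add: algebra_simps)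
  moreover have "x * ((v * d - d * v) * A) = k * (d' * A)" "x * ((v * c - c * v) * B) = k * (c' * B)"
    by (simp_all only: d c flip: mult.assoc)
  moreover have "x * (d * (v * A - A * v)) = k * (d * A')" "x * (c * (v * B - B * v)) = k * (c * B')"
    by (simp_all only: A B k[of d] k[of c] flip: x[of d] x[of c])
  ultimately show ?thesis
    by (simp only: lin)
qed

section \<open>Consequences of the RTT relation for a 2 x 2 matrix over an arbitrary algebra\<close>

locale yangian_matrix =
  fixes T :: "'a::complex_algebra_1 fps^ix2^ix2"
  assumes RTT: "RTT R_circ T = 0"
begin

lemma RTT_uv:
  "(vinv - uinv) * (series_u (T $ i $ j) * series_v (T $ k $ l) - series_v (T $ k $ l) * series_u (T $ i $ j))
     = uinv * vinv * (series_u (T $ k $ j) * series_v (T $ i $ l) - series_v (T $ k $ j) * series_u (T $ i $ l))"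
  using RTT by (simp add: RTT_R_circ_iff)

abbreviation T_shift :: "'a fps^ix2^ix2" where
  "T_shift \<equiv> matrix_map (lin_subst 1 1) T"

abbreviation T_neg :: "'a fps^ix2^ix2" where
  "T_neg \<equiv> matrix_map (lin_subst (-1) 0) T"

text \<open>The relation at u = v + 1, where u - v = 1 and the R-matrix degenerates to I - P. All
  quantum determinant identities come from it.\<close>

lemma RTT_shift:
  "T_shift $ i $ j * T $ k $ l - T $ k $ l * T_shift $ i $ j
    = T_shift $ k $ j * T $ i $ l - T $ k $ j * T_shift $ i $ l" (is "?L = ?R")
proof -
  let ?x = "lin_subst 1 1 (fps_X :: 'a fps)"
  note hL = ring_hom1_simps[OF ring_hom1_fps_map[OF ring_hom1_lin_subst]]
  note hD = ring_hom1_simps[OF ring_hom1_diag_series]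
  have "(fps_X - ?x) * ?L = ?x * fps_X * ?R"
    using arg_cong[OF RTT_uv[of i j k l], of "\<lambda>F. diag_series (fps_map (lin_subst 1 1) F)"]
    by (simp add: hL hD)
  \<comment> \<open>The factor 1 + u^{-1} clears the denominator of (u + 1)^{-1}; both sides then
    become \<open>fps_X\<close> squared times \<open>?L\<close> and \<open>?R\<close>.\<close>
  then have "(1 + fps_X) * (fps_X - ?x) * ?L = (1 + fps_X) * ?x * fps_X * ?R"
    by (simp only: mult.assoc)
  moreover have "(1 + fps_X) * (fps_X - ?x) = fps_X * fps_X"
    using lin_subst_X_pos_shift[where 'a = 'a] by (simp add: algebra_simps)
  ultimately have "fps_X * (fps_X * ?L) = fps_X * (fps_X * ?R)"
    by (simp only: lin_subst_X_pos_shift mult.assoc)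
  then show ?thesis by (simp only: fps_X_mult_cancel)
qed

text \<open>The relation at u = -v, where u - v = -2v. The doubled left side is the factor
  2.\<close>

lemma RTT_neg:
  "(T_neg $ i $ j * T $ k $ l - T $ k $ l * T_neg $ i $ j) + (T_neg $ i $ j * T $ k $ l - T $ k $ l * T_neg $ i $ j)
    = - (fps_X * (T_neg $ k $ j * T $ i $ l - T $ k $ j * T_neg $ i $ l))" (is "?L + ?L = - (fps_X * ?R)")
proof -
  note hL = ring_hom1_simps[OF ring_hom1_fps_map[OF ring_hom1_lin_subst]]
  note hD = ring_hom1_simps[OF ring_hom1_diag_series]
  have "(fps_X - - fps_X) * ?L = - fps_X * fps_X * ?R"
    using arg_cong[OF RTT_uv[of i j k l], of "\<lambda>F. diag_series (fps_map (lin_subst (-1) 0) F)"]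
    by (simp add: hL hD lin_subst_X_neg)
  then have "fps_X * (?L + ?L) = fps_X * (- (fps_X * ?R))"
    by (simp only: distrib_left distrib_right mult.assoc diff_minus_eq_add mult_minus_left mult_minus_right)
  then show ?thesis by (simp only: fps_X_mult_cancel)
qed

text \<open>For k = i one product occurs on both sides of \<open>RTT_shift\<close> and cancels;
  \<open>col_shift\<close> is the same for l = j.\<close>

lemma row_shift: "T $ i $ l * T_shift $ i $ j = T $ i $ j * T_shift $ i $ l"
  using RTT_shift[of i j i l] by simp

lemma col_shift: "T_shift $ i $ j * T $ k $ j = T_shift $ k $ j * T $ i $ j"
  using RTT_shift[of i j k j] by simp

section \<open>The quantum determinant and its centrality\<close>

definition shifted_qdet where "shifted_qdet = lin_subst 1 1 (qdet T)"

text \<open>After the shift by one only T(u) and T(u + 1) occur, the matrices related by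
  \<open>RTT_shift\<close>.\<close>

lemma shifted_qdet_eq: "shifted_qdet = T $ Minus $ Minus * T_shift $ Plus $ Plus - T $ Minus $ Plus * T_shift $ Plus $ Minus"
  by (simp add: shifted_qdet_def qdet_def lin_subst_simps lin_subst_lin_subst)

lemma qdet_eq: "qdet T = lin_subst 1 (-1) shifted_qdet"
  by (simp add: shifted_qdet_def lin_subst_lin_subst)

text \<open>Each form is linked to an earlier one by a single instance of \<open>RTT_shift\<close>.
  Together with \<open>shifted_qdet_eq\<close> they are the diagonal entries of both products of T
  with its quantum adjugate.\<close>

lemma qdet_forms:
  "T $ Plus $ Plus * T_shift $ Minus $ Minus - T $ Plus $ Minus * T_shift $ Minus $ Plus = shifted_qdet"
  "T_shift $ Plus $ Plus * T $ Minus $ Minus - T_shift $ Minus $ Plus * T $ Plus $ Minus = shifted_qdet"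
  "T_shift $ Minus $ Minus * T $ Plus $ Plus - T_shift $ Plus $ Minus * T $ Minus $ Plus = shifted_qdet"
proof -
  show 2: "T_shift $ Plus $ Plus * T $ Minus $ Minus - T_shift $ Minus $ Plus * T $ Plus $ Minus = shifted_qdet"
    using RTT_shift[of Plus Plus Minus Minus] by (simp add: shifted_qdet_eq algebra_simps)
  show 1: "T $ Plus $ Plus * T_shift $ Minus $ Minus - T $ Plus $ Minus * T_shift $ Minus $ Plus = shifted_qdet"
    using RTT_shift[of Minus Plus Plus Minus] unfolding 2[symmetric] by (simp add: algebra_simps)
  show "T_shift $ Minus $ Minus * T $ Plus $ Plus - T_shift $ Plus $ Minus * T $ Minus $ Plus = shifted_qdet"
    using RTT_shift[of Minus Minus Plus Plus] unfolding 1[symmetric] by (simp add: algebra_simps)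
qed

text \<open>On 2 x 2 matrices \<open>t_minus\<close> is the adjugate. The diagonal comes from the
  forms of the quantum determinant, the off-diagonal zeros from \<open>row_shift\<close>.\<close>

lemma T_adjugate: "T ** t_minus T_shift = mat shifted_qdet"
  using qdet_forms(1) row_shift[of _ Minus Plus] shifted_qdet_eq
  by (simp add: matrix_eq_ix2 matrix_mult_ix2 mat_def del: matrix_map_nth)

lemma adjugate_T: "t_minus T_shift ** T = mat shifted_qdet"
  using qdet_forms(2,3) col_shift[of Minus _ Plus]
  by (simp add: matrix_eq_ix2 matrix_mult_ix2 mat_def del: matrix_map_nth)

text \<open>Expresses the minor with its shifted factors in a prescribed row i, to match the row of
  the entry with which it is commuted.\<close>

lemma shifted_qdet_eq_row:
  "shifted_qdet = T $ (- i) $ (- i) * T_shift $ i $ i - T $ (- i) $ i * T_shift $ i $ (- i)"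
  using arg_cong[OF T_adjugate, of "\<lambda>A. A $ (- i) $ (- i)"]
  by (cases i) (simp_all add: matrix_mult_ix2 mat_def)

text \<open>The minor is written with its shifted entries in the row i of \<open>T $ i $ j\<close>.
  Then both kinds of commutators carry the same factor \<open>uinv - vinv\<close>, the Leibniz rule
  applies, and the resulting terms cancel.\<close>

lemma series_v_shifted_qdet_commute:
  "series_v (T $ i $ j) * series_u shifted_qdet = series_u shifted_qdet * series_v (T $ i $ j)"
proof -
  let ?u = "\<lambda>k l. series_u (T $ k $ l)" and ?w = "\<lambda>k l. series_u (T_shift $ k $ l)"
    and ?v = "\<lambda>k l. series_v (T $ k $ l)"
  let ?x = "uinv - vinv :: 'a fps fps" and ?k = "uinv * vinv :: 'a fps fps"
  let ?n = "- i"
  note hL = ring_hom1_simps[OF ring_hom1_fps_map[OF ring_hom1_lin_subst]]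
  note hS = ring_hom1_simps[OF ring_hom1_swap_series]
  note hu = ring_hom1_simps[OF ring_hom1_series_u]
  have xl: "y * (?x * z) = ?x * (y * z)" and kl: "y * (?k * z) = ?k * (y * z)" for y z
  proof -
    have "y * ?x = ?x * y" by (simp add: algebra_simps uinv_commute vinv_commute)
    then show "y * (?x * z) = ?x * (y * z)" by (metis mult.assoc)
    have "y * ?k = ?k * y" by (metis mult.assoc uinv_commute vinv_commute)
    then show "y * (?k * z) = ?k * (y * z)" by (metis mult.assoc)
  qed
  have u: "?x * (?v i j * ?u k l - ?u k l * ?v i j) = ?k * (?v k j * ?u i l - ?u k j * ?v i l)" for k l
    using arg_cong[OF RTT_uv[of i j k l], of swap_series]
    by (simp add: hS flip: vinv_commute[of uinv])
  \<comment> \<open>Clearing denominators gives u^{-1} v^{-1} (u + 1 - v) = \<open>?k - ?x\<close>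
    on the left. Moving \<open>?k * ?M\<close> across replaces \<open>?N\<close> by
    \<open>?N - ?M\<close>; as the rows agree, a product cancels there and only the factor
    \<open>?x\<close> is left.\<close>
  have w: "?x * (?v i j * ?w i l - ?w i l * ?v i j) = ?k * (?v i j * ?w i l - ?v i l * ?w i j)" for l
  proof -
    let ?p = "series_u (lin_subst 1 1 fps_X) :: 'a fps fps"
    let ?M = "?w i l * ?v i j - ?v i j * ?w i l" and ?N = "?w i l * ?v i j - ?v i l * ?w i j"
    have p: "(1 + uinv) * ?p = uinv"
      using arg_cong[OF lin_subst_X_pos_shift[where 'a = 'a], of series_u]
      by (simp add: hu) (simp add: series_u_def uinv_def)
    have "(vinv - ?p) * ?M = ?p * vinv * ?N"
      using arg_cong[OF RTT_uv[of i l i j], of "fps_map (lin_subst 1 1)"] by (simp add: hL)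
    then have "((1 + uinv) * (vinv - ?p)) * ?M = ((1 + uinv) * ?p * vinv) * ?N"
      by (simp only: mult.assoc)
    moreover have "(1 + uinv) * (vinv - ?p) = ?k - ?x"
      by (simp only: right_diff_distrib p) (simp add: algebra_simps)
    ultimately have "(?k - ?x) * ?M = ?k * ?N"
      by (simp only: p)
    then have "(?k - ?x) * ?M - ?k * ?M = ?k * (?N - ?M)"
      by (simp only: right_diff_distrib)
    moreover have "(?k - ?x) * ?M - ?k * ?M = ?x * (- ?M)"
      by (simp only: left_diff_distrib mult_minus_right) simp
    ultimately show ?thesis by simp
  qed
  have "series_u shifted_qdet = ?u ?n ?n * ?w i i - ?u ?n i * ?w i ?n"
    by (simp add: shifted_qdet_eq_row[of i] hu)
  then have "?x * (?v i j * series_u shifted_qdet - series_u shifted_qdet * ?v i j)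
     = ?k * ((?v ?n j * ?u i ?n - ?u ?n j * ?v i ?n) * ?w i i
      + ?u ?n ?n * (?v i j * ?w i i - ?v i i * ?w i j)
      - (?v ?n j * ?u i i - ?u ?n j * ?v i i) * ?w i ?n
      - ?u ?n i * (?v i j * ?w i ?n - ?v i ?n * ?w i j))"
    by (simp only:) (rule scaled_commutator_expand[OF xl kl u w u w])
  also have "(?v ?n j * ?u i ?n - ?u ?n j * ?v i ?n) * ?w i i
      + ?u ?n ?n * (?v i j * ?w i i - ?v i i * ?w i j)
      - (?v ?n j * ?u i i - ?u ?n j * ?v i i) * ?w i ?n
      - ?u ?n i * (?v i j * ?w i ?n - ?v i ?n * ?w i j) = 0"
  proof -
    \<comment> \<open>This identity removes the two terms beginning with \<open>?v ?n j\<close>. The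
      other six cancel in pairs, both for j = i and for j = -i.\<close>
    have "?u i ?n * ?w i i = ?u i i * ?w i ?n"
      using arg_cong[OF row_shift[of i ?n i], of series_u] by (simp add: hu)
    then have "?v ?n j * (?u i ?n * ?w i i) = ?v ?n j * (?u i i * ?w i ?n)" by simp
    moreover have "j = i \<or> j = ?n" by (cases i; cases j) auto
    ultimately show ?thesis by (auto simp: algebra_simps)
  qed
  finally have "?v i j * series_u shifted_qdet - series_u shifted_qdet * ?v i j = 0"
    using uinv_minus_vinv_cancel by (metis mult_zero_right)
  then show ?thesis by simp
qed

lemma shifted_qdet_nth_commute: "fps_nth shifted_qdet r * fps_nth (T $ i $ j) s = fps_nth (T $ i $ j) s * fps_nth shifted_qdet r"
  using arg_cong[OF series_v_shifted_qdet_commute[of i j], of "\<lambda>F. fps_nth (fps_nth F s) r"]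
  by (simp add: series_u_def series_v_def)

text \<open>Put s = \<epsilon> S_{--} and p = S_{++}. The relation at v = -u gives 2 (p(u) - s(-u))
  = \<epsilon> u^{-1} (p(u) - p(-u)). The right side is even in u, so for odd n the left side yields
  p_n + s_n = 0.\<close>

lemma twisted_trace:
  assumes eps: "\<epsilon> = 1 \<or> \<epsilon> = -1"
    and S: "S = T ** G ** t_minus T_neg"
    and G: "G $ Minus $ Minus = \<epsilon>" "G $ Plus $ Plus = 1" "G $ Minus $ Plus = 0" "G $ Plus $ Minus = 0"
    and n: "odd n"
  shows "fps_nth (\<epsilon> * S $ Minus $ Minus + S $ Plus $ Plus) n = 0"
proof -
  let ?a = "T $ Minus $ Minus" and ?b = "T $ Minus $ Plus" and ?c = "T $ Plus $ Minus" and ?d = "T $ Plus $ Plus"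
  let ?A = "T_neg $ Minus $ Minus" and ?B = "T_neg $ Minus $ Plus" and ?C = "T_neg $ Plus $ Minus" and ?D = "T_neg $ Plus $ Plus"
  let ?neg = "lin_subst (-1) 0"
  let ?s = "\<epsilon> * S $ Minus $ Minus" and ?p = "S $ Plus $ Plus"
  have s: "?s = ?a * ?D - \<epsilon> * (?b * ?C)" and p: "?p = ?d * ?A - \<epsilon> * (?c * ?B)"
    using eps by (auto simp: S matrix_mult_ix2 G algebra_simps)
  have ns: "?neg ?s = ?A * ?d - \<epsilon> * (?B * ?c)" and np: "?neg ?p = ?D * ?a - \<epsilon> * (?C * ?b)"
    unfolding s p using eps by (auto simp: lin_subst_simps lin_subst_lin_subst)
  have "(?p - ?neg ?s) + (?p - ?neg ?s) = \<epsilon> * (fps_X * (?p - ?neg ?p))"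
    using RTT_neg[of Minus Minus Plus Plus] RTT_neg[of Minus Plus Plus Minus] eps
    unfolding ns np unfolding p
    by (elim disjE; simp del: matrix_map_nth; simp del: matrix_map_nth add: algebra_simps)
  \<comment> \<open>p(u) - p(-u) has only odd degrees, and the factor \<open>fps_X\<close> makes
    them even.\<close>
  moreover have "fps_nth (\<epsilon> * (fps_X * (?p - ?neg ?p))) n = 0"
    using eps n by (auto simp: lin_subst_neg_nth scaleC_one elim!: oddE)
  ultimately have "fps_nth (?p - ?neg ?s) n + fps_nth (?p - ?neg ?s) n = 0"
    by (metis fps_add_nth)
  then have "(2::complex) *\<^sub>C fps_nth (?p - ?neg ?s) n = 0"
    using scaleC_add_left[of 1 1 "fps_nth (?p - ?neg ?s) n"] by (simp add: scaleC_one)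
  then have "(1/2) *\<^sub>C (2::complex) *\<^sub>C fps_nth (?p - ?neg ?s) n = 0"
    by simp
  then have "fps_nth (?p - ?neg ?s) n = 0"
    by (simp add: scaleC_scaleC scaleC_one del: fps_sub_nth)
  then show ?thesis
    using n by (simp add: lin_subst_neg_nth scaleC_minus_one add.commute)
qed

end

section \<open>Linear extensions\<close>

lemma pm_scale_single: "pm_scale c (Poly_Mapping.single k d) = Poly_Mapping.single k (c * d)"
  by (simp add: pm_scale_def mult_single)

lemma pm_induct [case_names zero single add]:
  fixes p :: "'m::monoid_add \<Rightarrow>\<^sub>0 complex"
  assumes "P 0" and "\<And>k c. P (Poly_Mapping.single k c)" and "\<And>p q. P p \<Longrightarrow> P q \<Longrightarrow> P (p + q)"
  shows "P p"
proof -
  have "P (\<Sum>k\<in>A. pm_scale (Poly_Mapping.lookup p k) (Poly_Mapping.single k 1))" for A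
    by (induction A rule: infinite_finite_induct) (simp_all add: assms pm_scale_single)
  then show ?thesis by (subst pm_expand)
qed

definition pm_lift :: "('m \<Rightarrow> 'b) \<Rightarrow> ('m \<Rightarrow>\<^sub>0 complex) \<Rightarrow> 'b::complex_algebra_1" where
  "pm_lift \<beta> p = (\<Sum>k\<in>Poly_Mapping.keys p. Poly_Mapping.lookup p k *\<^sub>C \<beta> k)"

lemma pm_lift_superset:
  assumes "finite A" "Poly_Mapping.keys p \<subseteq> A"
  shows "pm_lift \<beta> p = (\<Sum>k\<in>A. Poly_Mapping.lookup p k *\<^sub>C \<beta> k)"
  unfolding pm_lift_def by (rule sum.mono_neutral_left) (use assms in \<open>auto simp: in_keys_iff\<close>)

lemma pm_lift_zero [simp]: "pm_lift \<beta> 0 = 0"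
  by (simp add: pm_lift_def)

lemma pm_lift_single: "pm_lift \<beta> (Poly_Mapping.single k c) = c *\<^sub>C \<beta> k"
  using pm_lift_superset[of "{k}" "Poly_Mapping.single k c" \<beta>] by simp

lemma pm_lift_add: "pm_lift \<beta> (p + q) = pm_lift \<beta> p + pm_lift \<beta> q"
proof -
  let ?A = "Poly_Mapping.keys p \<union> Poly_Mapping.keys q"
  have "Poly_Mapping.keys (p + q) \<subseteq> ?A" by (rule keys_add)
  then show ?thesis
    using pm_lift_superset[of ?A p \<beta>] pm_lift_superset[of ?A q \<beta>] pm_lift_superset[of ?A "p + q" \<beta>]
    by (simp add: lookup_add scaleC_add_left sum.distrib)
qed

lemma pm_lift_mult:
  fixes \<beta> :: "'m::monoid_add \<Rightarrow> 'b::complex_algebra_1"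
  assumes \<beta>: "\<And>k l. \<beta> (k + l) = \<beta> k * \<beta> l"
  shows "pm_lift \<beta> (p * q) = pm_lift \<beta> p * pm_lift \<beta> q"
proof (induction p rule: pm_induct)
  case (single k c)
  show ?case
    by (induction q rule: pm_induct)
       (simp_all add: pm_lift_add pm_lift_single mult_single \<beta> scaleC_mult_scaleC distrib_left)
qed (simp_all add: pm_lift_add distrib_right)

lemma pm_lift_scale: "pm_lift \<beta> (pm_scale c p) = c *\<^sub>C pm_lift \<beta> (p :: 'm::monoid_add \<Rightarrow>\<^sub>0 complex)"
proof (induction p rule: pm_induct)
  case zero
  then show ?case by (simp add: pm_scale_def)
qed (simp_all add: pm_lift_add pm_lift_single pm_scale_single pm_scale_add_right scaleC_scaleC
       scaleC_add_right)

lemma pm_lift_one: "\<beta> 0 = 1 \<Longrightarrow> pm_lift \<beta> (1 :: 'm::monoid_add \<Rightarrow>\<^sub>0 complex) = 1"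
  using pm_lift_single[of \<beta> 0 1] by (simp add: scaleC_one flip: single_one)

subsection \<open>Tensor products\<close>

text \<open>Scalars are absorbed into the left factor and 0 is 0 \<otimes> 0, so every element is a
  sum of pure tensors.\<close>

lemma tensor_induct [case_names tensor add]:
  assumes "\<And>x y. P (x \<otimes> y)" and "\<And>s t. P s \<Longrightarrow> P t \<Longrightarrow> P (s + t)"
  shows "P (t :: ('a::complex_algebra_1, 'b::complex_algebra_1) tensor)"
proof -
  obtain p where t: "t = abs_tensor p" by (metis Quotient3_abs_rep[OF Quotient3_tensor])
  have "P (abs_tensor p)"
  proof (induction p rule: pm_induct)
    case zero
    have "abs_tensor 0 = (0 \<otimes> 0 :: ('a, 'b) tensor)"
      using tensor_linear(3)[of 0 "0 :: 'a" "0 :: 'b"] by (simp add: zero_tensor.abs_eq)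
    then show ?case using assms(1) by metis
  next
    case (single k c)
    obtain x y where "k = Mult_Pair x y" by (cases k)
    then have "abs_tensor (Poly_Mapping.single k c) = c *\<^sub>C (x \<otimes> y)"
      by (simp add: tensor.abs_eq pre_tensor_def scaleC_tensor.abs_eq pm_scale_single)
    then have "abs_tensor (Poly_Mapping.single k c) = (c *\<^sub>C x) \<otimes> y"
      by (simp only: tensor_linear(3))
    then show ?case using assms(1) by metis
  next
    case (add p q)
    then show ?case using assms(2) by (simp flip: plus_tensor.abs_eq)
  qed
  then show ?thesis by (simp add: t)
qed

lemma clinear_eq_on_tensor:
  assumes "clinear F" "clinear G" "\<And>x y. F (x \<otimes> y) = G (x \<otimes> y)"
  shows "F t = G t"
  by (induction t rule: tensor_induct) (use assms in \<open>simp_all add: clinear_def\<close>)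

lemma alg_hom_simps:
  assumes "alg_hom h"
  shows "h (x + y) = h x + h y" "h (x * y) = h x * h y" "h 1 = 1" "h 0 = 0" "h (- x) = - h x"
    "h (x - y) = h x - h y" "h (sum f A) = (\<Sum>a\<in>A. h (f a))" "h (c *\<^sub>C x) = c *\<^sub>C h x"
  using ring_hom1_simps[OF alg_hom_ring_hom1[OF assms]] alg_hom_scaleC[OF assms] by auto

lemma alg_hom_clinear: "alg_hom h \<Longrightarrow> clinear h"
  by (simp add: alg_hom_def)

lemma alg_hom_comp: "alg_hom f \<Longrightarrow> alg_hom g \<Longrightarrow> alg_hom (f \<circ> g)"
  by (simp add: alg_hom_def clinear_def)

lemma alg_hom_id: "alg_hom id"
  by (simp add: alg_hom_def clinear_def)

lemma alg_hom_tensor_left: "alg_hom (\<lambda>x :: 'a::complex_algebra_1. x \<otimes> (1 :: 'b::complex_algebra_1))"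
  and alg_hom_tensor_right: "alg_hom (\<lambda>y :: 'b::complex_algebra_1. (1 :: 'a::complex_algebra_1) \<otimes> y)"
  by (simp_all add: alg_hom_def clinear_def tensor_linear tensor_mult one_tensor_one)

text \<open>Universal property of the tensor product: two algebra maps with commuting images combine
  into one.\<close>

lemma tensor_lift_alg_hom:
  fixes f :: "'a::complex_algebra_1 \<Rightarrow> 'c::complex_algebra_1" and g :: "'b::complex_algebra_1 \<Rightarrow> 'c"
  assumes f: "alg_hom f" and g: "alg_hom g" and fg: "\<And>x y. f x * g y = g y * f x"
  shows "alg_hom (tensor_lift (\<lambda>x y. f x * g y))"
    and "tensor_lift (\<lambda>x y. f x * g y) (x \<otimes> y) = f x * g y"
proof -
  let ?\<beta> = "\<lambda>x y. f x * g y"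
  have \<beta>: "cbilinear ?\<beta>"
    by (simp add: cbilinear_def clinear_def alg_hom_simps[OF f] alg_hom_simps[OF g] distrib_left
        distrib_right mult_scaleC_left mult_scaleC_right)
  note [simp] = tensor_lift_tensor[OF \<beta>]
  have lin: "clinear (tensor_lift ?\<beta>)" by (rule clinear_tensor_lift[OF \<beta>])
  have mult_pure: "tensor_lift ?\<beta> ((x \<otimes> y) * (x' \<otimes> y')) = tensor_lift ?\<beta> (x \<otimes> y) * tensor_lift ?\<beta> (x' \<otimes> y')" for x y x' y'
    by (simp add: tensor_mult alg_hom_simps[OF f] alg_hom_simps[OF g]) (metis fg mult.assoc)
  have "tensor_lift ?\<beta> (s * t) = tensor_lift ?\<beta> s * tensor_lift ?\<beta> t" for s t
  proof (induction s rule: tensor_induct)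
    case (tensor x y)
    show ?case
      by (induction t rule: tensor_induct)
         (use lin mult_pure in \<open>simp_all add: clinear_def distrib_left\<close>)
  qed (use lin in \<open>simp add: clinear_def distrib_right\<close>)
  moreover have "tensor_lift ?\<beta> 1 = 1"
    by (simp add: alg_hom_simps[OF f] alg_hom_simps[OF g] flip: one_tensor_one)
  ultimately show "alg_hom (tensor_lift ?\<beta>)" using lin by (simp add: alg_hom_def)
  show "tensor_lift ?\<beta> (x \<otimes> y) = f x * g y" by simp
qed

lemma alg_hom_tensor_map:
  assumes f: "alg_hom f" and g: "alg_hom g"
  shows "alg_hom (tensor_map f g)"
proof -
  have "(\<lambda>x y. f x \<otimes> g y) = (\<lambda>x y. (f x \<otimes> 1) * (1 \<otimes> g y))"
    by (simp add: tensor_mult)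
  moreover have "alg_hom (tensor_lift (\<lambda>x y. (f x \<otimes> 1) * (1 \<otimes> g y)))"
    by (rule tensor_lift_alg_hom(1)[OF alg_hom_comp[OF alg_hom_tensor_left f, unfolded comp_def]
         alg_hom_comp[OF alg_hom_tensor_right g, unfolded comp_def]])
       (simp add: tensor_mult)
  ultimately show ?thesis by (simp add: tensor_map_def)
qed

lemma clinear_left_inverse:
  fixes f :: "'a::complex_algebra_1 \<Rightarrow> 'b::complex_algebra_1"
  assumes "clinear f" "inj f"
  obtains g where "clinear g" "\<And>x. g (f x) = x"
proof -
  have v: "vector_space (scaleC :: complex \<Rightarrow> 'x::complex_algebra_1 \<Rightarrow> 'x)"
    by unfold_locales (simp_all add: scaleC_add_left scaleC_add_right scaleC_scaleC scaleC_one)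
  interpret vector_space_pair "scaleC :: complex \<Rightarrow> 'a \<Rightarrow> 'a" "scaleC :: complex \<Rightarrow> 'b \<Rightarrow> 'b"
    by (intro vector_space_pair.intro v)
  have lf: "Vector_Spaces.linear scaleC scaleC f"
    by (rule Vector_Spaces.linear.intro[OF v v], unfold_locales) (use assms(1) in \<open>auto simp: clinear_def\<close>)
  from linear_injective_left_inverse[OF lf assms(2)]
  obtain g where g: "Vector_Spaces.linear scaleC scaleC g" "g \<circ> f = id" by (elim exE conjE)
  have "clinear g"
    using g(1) by (simp add: clinear_def Vector_Spaces.linear_iff)
  moreover have "g (f x) = x" for x using g(2) by (metis comp_apply id_apply)
  ultimately show thesis using that by blast
qed

text \<open>Over a field each injective map has a linear left inverse, and the tensor product of
  these inverses inverts \<open>tensor_map f g\<close>. The inverses are merely linear.\<close>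

lemma inj_tensor_map:
  assumes "clinear f" "inj f" "clinear g" "inj g"
  shows "inj (tensor_map f g)"
proof -
  obtain f' where f': "clinear f'" "\<And>x. f' (f x) = x" using clinear_left_inverse[OF assms(1,2)] by blast
  obtain g' where g': "clinear g'" "\<And>x. g' (g x) = x" using clinear_left_inverse[OF assms(3,4)] by blast
  have lin: "clinear (tensor_map h k)" if "clinear h" "clinear k"
    for h :: "'x::complex_algebra_1 \<Rightarrow> 'y::complex_algebra_1"
      and k :: "'z::complex_algebra_1 \<Rightarrow> 'w::complex_algebra_1"
    unfolding tensor_map_def
    by (rule clinear_tensor_lift) (use that in \<open>simp add: cbilinear_def clinear_def tensor_linear\<close>)
  have "clinear (\<lambda>t. tensor_map f' g' (tensor_map f g t))"
    using lin[OF assms(1,3)] lin[OF f'(1) g'(1)] by (simp add: clinear_def)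
  moreover have "clinear (\<lambda>t :: ('a, 'c) tensor. t)" by (simp add: clinear_def)
  ultimately have "tensor_map f' g' (tensor_map f g t) = t" for t
    by (rule clinear_eq_on_tensor) (simp add: tensor_map_tensor assms f' g')
  then show ?thesis by (rule inj_on_inverseI)
qed

section \<open>Subalgebras and central elements\<close>

definition subalgebra :: "'a::complex_algebra_1 set \<Rightarrow> bool" where
  "subalgebra B \<longleftrightarrow> 1 \<in> B \<and> (\<forall>x\<in>B. \<forall>y\<in>B. x + y \<in> B \<and> x * y \<in> B) \<and> (\<forall>c. \<forall>x\<in>B. c *\<^sub>C x \<in> B)"

lemma subalgebra_closed:
  assumes "subalgebra B"
  shows "1 \<in> B" "0 \<in> B" "x \<in> B \<Longrightarrow> y \<in> B \<Longrightarrow> x + y \<in> B" "x \<in> B \<Longrightarrow> y \<in> B \<Longrightarrow> x * y \<in> B"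
    "x \<in> B \<Longrightarrow> c *\<^sub>C x \<in> B" "x \<in> B \<Longrightarrow> - x \<in> B" "x \<in> B \<Longrightarrow> y \<in> B \<Longrightarrow> x - y \<in> B"
    "(\<And>a. a \<in> A \<Longrightarrow> f a \<in> B) \<Longrightarrow> sum f A \<in> B"
proof -
  show 1: "1 \<in> B" "\<And>x y. x \<in> B \<Longrightarrow> y \<in> B \<Longrightarrow> x + y \<in> B" "\<And>x y. x \<in> B \<Longrightarrow> y \<in> B \<Longrightarrow> x * y \<in> B"
    "\<And>x c. x \<in> B \<Longrightarrow> c *\<^sub>C x \<in> B"
    using assms by (auto simp: subalgebra_def)
  show 0: "0 \<in> B" using 1(4)[OF 1(1), of 0] by simp
  show um: "x \<in> B \<Longrightarrow> - x \<in> B" for x using 1(4)[of x "-1"] by (simp add: scaleC_minus_one)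
  show "x \<in> B \<Longrightarrow> y \<in> B \<Longrightarrow> x - y \<in> B" using 1(2)[of x "- y"] um by simp
  show "(\<And>a. a \<in> A \<Longrightarrow> f a \<in> B) \<Longrightarrow> sum f A \<in> B"
    by (induction A rule: infinite_finite_induct) (auto simp: 0 1)
qed

lemma subalgebra_range: "alg_hom h \<Longrightarrow> subalgebra (range h)"
  unfolding subalgebra_def by (safe; metis alg_hom_simps(1-3,8) rangeI)

lemma subalgebra_vimage: "alg_hom h \<Longrightarrow> subalgebra B \<Longrightarrow> subalgebra (h -` B)"
  by (auto simp: subalgebra_def alg_hom_simps)

lemma subalg_gen_least: "subalgebra B \<Longrightarrow> G \<subseteq> B \<Longrightarrow> subalg_gen G \<subseteq> B"
proof
  fix x assume B: "subalgebra B" "G \<subseteq> B" and "x \<in> subalg_gen G"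
  from this(3) show "x \<in> B"
    by induction (use B in \<open>auto intro: subalgebra_closed\<close>)
qed

lemma subalg_gen_image:
  assumes h: "alg_hom h"
  shows "subalg_gen (h ` G) \<subseteq> h ` subalg_gen G"
proof (rule subalg_gen_least)
  show "subalgebra (h ` subalg_gen G)"
    unfolding subalgebra_def
  proof (intro conjI ballI allI)
    show "1 \<in> h ` subalg_gen G"
      using h by (metis alg_hom_simps(3) image_eqI subalg_gen_one)
  next
    fix x y assume "x \<in> h ` subalg_gen G" "y \<in> h ` subalg_gen G"
    then obtain x' y' where "x' \<in> subalg_gen G" "y' \<in> subalg_gen G" "x = h x'" "y = h y'" by blast
    then show "x + y \<in> h ` subalg_gen G" "x * y \<in> h ` subalg_gen G"
      by (auto intro!: imageI subalg_gen_add subalg_gen_mult simp flip: alg_hom_simps(1,2)[OF h])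
  next
    fix c x assume "x \<in> h ` subalg_gen G"
    then show "c *\<^sub>C x \<in> h ` subalg_gen G"
      by (auto intro!: imageI subalg_gen_scale simp flip: alg_hom_simps(8)[OF h])
  qed
qed (auto intro: subalg_gen_base)

lemma alg_hom_eq_on_generated:
  assumes "alg_hom f" "alg_hom g" "\<And>x. x \<in> G \<Longrightarrow> f x = g x" "x \<in> subalg_gen G"
  shows "f x = g x"
  using assms(4) by induction (simp_all add: assms(3) alg_hom_simps[OF assms(1)] alg_hom_simps[OF assms(2)])

lemma commute_generated:
  assumes "\<And>x. x \<in> G \<Longrightarrow> x * z = z * x" "x \<in> subalg_gen G"
  shows "x * z = z * x"
  using assms(2)
proof induction
  case (subalg_gen_mult x y)
  then show ?case by (metis mult.assoc)
qed (simp_all add: assms(1) distrib_left distrib_right mult_scaleC_left mult_scaleC_right)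

lemma fps_mult_nth_in:
  assumes "subalgebra B" "\<And>n. fps_nth f n \<in> B" "\<And>n. fps_nth g n \<in> B"
  shows "fps_nth (f * g) n \<in> B"
  unfolding fps_mult_nth by (intro subalgebra_closed(8,4) assms)

lemma lin_subst_nth_in:
  assumes "subalgebra B" "\<And>n. fps_nth f n \<in> B"
  shows "fps_nth (lin_subst e b f) n \<in> B"
  unfolding lin_subst_nth by (intro subalgebra_closed(8,5) assms)

section \<open>Centralizers, the centre and central series\<close>

lemma subalgebra_centralizer: "subalgebra {x. x * z = z * x}"
  unfolding subalgebra_def
  by (auto simp: distrib_left distrib_right mult_scaleC_left mult_scaleC_right) (metis mult.assoc)

lemma central_fps_iff: "central f \<longleftrightarrow> (\<forall>n. central (fps_nth f n))"
proof
  assume f: "central f"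
  have "fps_nth f n * x = x * fps_nth f n" for n x
  proof -
    have "f * fps_const x = fps_const x * f" using f by (simp add: central_def)
    then have "fps_nth (f * fps_const x) n = fps_nth (fps_const x * f) n" by simp
    then show ?thesis by simp
  qed
  then show "\<forall>n. central (fps_nth f n)" by (simp add: central_def)
next
  assume f: "\<forall>n. central (fps_nth f n)"
  have "f * g = g * f" for g
  proof (rule fps_ext)
    fix n
    have "fps_nth (f * g) n = (\<Sum>i=0..n. fps_nth g (n - i) * fps_nth f i)"
      unfolding fps_mult_nth using f by (simp add: central_def)
    also have "\<dots> = fps_nth (g * f) n"
      unfolding fps_mult_nth by (subst sum.atLeastAtMost_rev) simp
    finally show "fps_nth (f * g) n = fps_nth (g * f) n" .
  qed
  then show "central f" by (simp add: central_def)
qed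

lemma subalgebra_central: "subalgebra {z :: 'a::complex_algebra_1. central z}"
proof -
  have *: "{z :: 'a. central z} = (\<Inter>x. {z. z * x = x * z})" unfolding central_def by blast
  have INT: "subalgebra (\<Inter>x. B x)" if "\<And>x. subalgebra (B x)" for B :: "'a \<Rightarrow> 'a set"
    using that by (simp add: subalgebra_def)
  show ?thesis unfolding * by (rule INT, rule subalgebra_centralizer)
qed

lemma central_lin_subst: "central f \<Longrightarrow> central (lin_subst e b f)"
  using lin_subst_nth_in[OF subalgebra_central, of f e b] unfolding central_fps_iff mem_Collect_eq by blast

lemma central_inverse:
  fixes d :: "'a::ring_1"
  assumes d: "central d" and e: "d * e = 1"
  shows "central e" "e * d = 1"
proof -
  show ed: "e * d = 1" using d e by (simp add: central_def)
  show "central e"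
    unfolding central_def
  proof
    fix x
    have "e * x = e * x * (d * e)" by (simp add: e)
    also have "\<dots> = e * (x * d) * e" by (simp add: mult.assoc)
    also have "x * d = d * x" using d by (simp add: central_def)
    also have "e * (d * x) * e = x * e" by (simp add: ed flip: mult.assoc)
    finally show "e * x = x * e" .
  qed
qed

text \<open>The coefficient of \<open>u\<^sup>-\<^sup>n\<close> in \<open>d(u - 1) d(u) = q(u)\<close> is \<open>2 d\<^sub>n\<close> plus terms in \<open>d\<^sub>m\<close> with \<open>m < n\<close>, so \<open>d\<close> is
  found recursively.\<close>

lemma central_shift_root:
  fixes q :: "'a::complex_algebra_1 fps"
  assumes q: "central q" "fps_nth q 0 = 1"
  obtains d where "central d" "fps_nth d 0 = 1" "lin_subst 1 (-1) d * d = q"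
proof -
  let ?p = "\<lambda>r. fps_nth (lin_series 1 (-1) ^ r)"
  \<comment> \<open>\<open>sub f n\<close> is the n-th coefficient of f(u - 1). \<open>L f n\<close>
    collects the part of the n-th coefficient of f(u - 1) f(u) that involves only f m with m < n,
    where f 0 = 1.\<close>
  define sub where "sub f n = (\<Sum>r\<le>n. ?p r n *\<^sub>C f r)" for f :: "nat \<Rightarrow> 'a" and n
  define L where "L f n = (\<Sum>r<n. ?p r n *\<^sub>C f r) + (\<Sum>i\<in>{1..<n}. sub f i * f (n - i))"
    for f :: "nat \<Rightarrow> 'a" and n
  define P where "P f n r \<longleftrightarrow> central r \<and> (if n = 0 then r = 1 else r + r + L f n = fps_nth q n)"
    for f :: "nat \<Rightarrow> 'a" and n r
  note closed = subalgebra_closed[OF subalgebra_central, unfolded mem_Collect_eq]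
  have "\<exists>f. \<forall>n. P f n (f n)"
  \<comment> \<open>Recursive choice along the order of the degrees: the condition on f n depends
    only on smaller values, and it is solvable whenever those satisfy theirs.\<close>
  proof (rule dependent_wf_choice[of less_than])
    fix f g :: "nat \<Rightarrow> 'a" and n r
    assume "\<And>m. (m, n) \<in> less_than \<Longrightarrow> f m = g m"
    then have eq: "f m = g m" if "m < n" for m using that by simp
    have "L f n = L g n"
      unfolding L_def sub_def using eq by (intro arg_cong2[where f = "(+)"] sum.cong refl arg_cong2[where f = "(*)"]) auto
    then show "P f n r = P g n r" by (simp add: P_def)
  next
    fix n and f :: "nat \<Rightarrow> 'a"
    assume "\<And>m. (m, n) \<in> less_than \<Longrightarrow> P f m (f m)"
    then have "central (f m)" if "m < n" for m using that by (simp add: P_def)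
    then have "central (L f n)"
      unfolding L_def sub_def by (intro closed) auto
    \<comment> \<open>The solution r of 2 r + L f n = q_n; the centre is closed under
      halving.\<close>
    then have c: "central ((1/2) *\<^sub>C (fps_nth q n - L f n))"
      using q(1) by (intro closed) (auto simp: central_fps_iff)
    have "(1/2) *\<^sub>C x + (1/2) *\<^sub>C x = x" for x :: 'a
      by (simp add: scaleC_one flip: scaleC_add_left)
    then show "\<exists>r. P f n r"
      using c closed(1) by (cases "n = 0") (auto simp: P_def intro!: exI[of _ "(1/2) *\<^sub>C (fps_nth q n - L f n)"])
  qed simp
  then obtain f where f: "\<And>n. P f n (f n)" by blast
  let ?d = "Abs_fps f"
  have sub: "fps_nth (lin_subst 1 (-1) ?d) n = sub f n" for n
    by (simp add: lin_subst_nth sub_def)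
  have "fps_nth (lin_subst 1 (-1) ?d * ?d) n = fps_nth q n" for n
  proof (cases "n = 0")
    case True then show ?thesis using f[of 0] q by (simp add: P_def)
  next
    case False
    have f0: "f 0 = 1" using f[of 0] by (simp add: P_def)
    have s0: "sub f 0 = 1" by (simp add: sub_def f0 scaleC_one)
    have sn: "sub f n = f n + (\<Sum>r<n. ?p r n *\<^sub>C f r)"
      using lin_subst_nth_lead[of 1 "-1" ?d n] by (simp add: sub scaleC_one)
    \<comment> \<open>The end terms i = 0 and i = n contribute f n and \<open>sub f n\<close>, which
      together hold f n twice.\<close>
    have "{0..n} = insert 0 (insert n {1..<n})" using False by auto
    then have "(\<Sum>i=0..n. sub f i * f (n - i)) = f n + sub f n + (\<Sum>i\<in>{1..<n}. sub f i * f (n - i))"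
      using False by (simp add: f0 s0)
    also have "\<dots> = fps_nth q n"
      using f[of n] False by (simp add: sn P_def L_def add.assoc)
    finally show ?thesis by (simp add: fps_mult_nth sub)
  qed
  moreover have "central ?d" "fps_nth ?d 0 = 1"
    using f f[of 0] by (auto simp: central_fps_iff P_def)
  ultimately show thesis using that[of ?d] by (simp add: fps_eq_iff)
qed

section \<open>Recovering two commuting factors from the products of their entries\<close>

lemma scaleC_diff_right: "c *\<^sub>C (x - y) = c *\<^sub>C x - c *\<^sub>C (y :: 'a::complex_algebra_1)"
  using scaleC_add_right[of c "x - y" y] by simp

lemma scaleC_minus_right: "c *\<^sub>C (- x) = - (c *\<^sub>C (x :: 'a::complex_algebra_1))"
  using scaleC_diff_right[of c 0 x] by simp

text \<open>The inverse relation for X eliminates X and puts Y(u) Y(-u - 1), entry by entry, into B.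
  The coefficients of Y follow recursively, then those of X. The signs e are the constant term of Y,
  and \<open>tr\<close> supplies the combination that these products miss in odd degree.\<close>

lemma product_generates:
  fixes X Y :: "'c::complex_algebra_1 fps^ix2^ix2" and e :: "ix2 \<Rightarrow> complex"
  assumes B: "subalgebra B"
    and XY: "\<And>a c b d n. fps_nth (X $ a $ c * Y $ b $ d) n \<in> B"
    and comm: "\<And>a c b d. Y $ b $ d * X $ a $ c = X $ a $ c * Y $ b $ d"
    and inv: "X ** matrix_map (lin_subst (-1) (-1)) X = mat 1"
    and Y0: "\<And>i j. fps_nth (Y $ i $ j) 0 = (if i = j then e i *\<^sub>C 1 else 0)"
    and e: "\<And>i. e i * e i = 1"
    and tr: "\<And>n. odd n \<Longrightarrow> e Minus *\<^sub>C fps_nth (Y $ Minus $ Minus) n + e Plus *\<^sub>C fps_nth (Y $ Plus $ Plus) n = 0"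
  shows "fps_nth (Y $ i $ j) n \<in> B" and "fps_nth (X $ i $ j) n \<in> B"
proof -
  let ?s = "lin_subst (-1) (-1) :: 'c fps \<Rightarrow> 'c fps"
  note closed = subalgebra_closed[OF B]
  have scale: "x \<in> B" if "e i *\<^sub>C x \<in> B" for x i
    using closed(5)[OF that, of "e i"] by (simp add: scaleC_scaleC e scaleC_one)
  have half: "x \<in> B" if "x + x \<in> B" for x
  proof -
    have "(1/2) *\<^sub>C (x + x) = x"
      by (simp add: scaleC_add_right scaleC_one flip: scaleC_add_left)
    then show ?thesis using closed(5)[OF that, of "1/2"] by simp
  qed
  \<comment> \<open>The (-,-) entry of X(u) X(-u - 1) = I is inserted between the two factors.
    Commuting X past Y then leaves products of X Y at u with X Y at -u - 1.\<close>
  have prod: "fps_nth (Y $ b $ d * ?s (Y $ b' $ d')) n \<in> B" for b d b' d' n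
  proof -
    have "X $ Minus $ Minus * ?s (X $ Minus $ Minus) + X $ Minus $ Plus * ?s (X $ Plus $ Minus) = 1"
      using arg_cong[OF inv, of "\<lambda>A. A $ Minus $ Minus"] by (simp add: matrix_mult_ix2 mat_def)
    then have "Y $ b $ d * ?s (Y $ b' $ d') = Y $ b $ d *
       (X $ Minus $ Minus * ?s (X $ Minus $ Minus) + X $ Minus $ Plus * ?s (X $ Plus $ Minus)) * ?s (Y $ b' $ d')"
      by simp
    also have "\<dots> = (Y $ b $ d * X $ Minus $ Minus) * (?s (X $ Minus $ Minus) * ?s (Y $ b' $ d'))
        + (Y $ b $ d * X $ Minus $ Plus) * (?s (X $ Plus $ Minus) * ?s (Y $ b' $ d'))"
      by (simp add: algebra_simps)
    also have "\<dots> = (X $ Minus $ Minus * Y $ b $ d) * ?s (X $ Minus $ Minus * Y $ b' $ d')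
        + (X $ Minus $ Plus * Y $ b $ d) * ?s (X $ Plus $ Minus * Y $ b' $ d')"
      by (simp only: comm lin_subst_mult)
    finally show ?thesis
      using fps_mult_nth_in[OF B XY lin_subst_nth_in[OF B XY]] by (simp add: closed)
  qed
  have Y: "\<forall>i j. fps_nth (Y $ i $ j) n \<in> B" for n
  proof (induction n rule: less_induct)
    case (less n)
    show ?case
    proof (cases "n = 0")
      case True
      then show ?thesis by (simp add: Y0 closed)
    next
      case False
      let ?y = "\<lambda>i j. fps_nth (Y $ i $ j) n"
      \<comment> \<open>Of the n-th coefficient of Y(u) Y(-u - 1) only the two end terms contain
        coefficients of degree n; the sign (-1)^n comes from u -> -u - 1. The remaining terms lie in
        B by induction.\<close>
      have key: "fps_nth (Y $ b $ d) 0 * ((-1) ^ n *\<^sub>C ?y b' d') + ?y b d * fps_nth (Y $ b' $ d') 0 \<in> B" for b d b' d'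
      proof -
        let ?low = "\<Sum>r<n. fps_nth (lin_series (-1) (-1) ^ r) n *\<^sub>C fps_nth (Y $ b' $ d') r"
        let ?mid = "\<Sum>i\<in>{1..<n}. fps_nth (Y $ b $ d) i * fps_nth (?s (Y $ b' $ d')) (n - i)"
        have set: "{0..n} = insert 0 (insert n {1..<n})" using False by auto
        have lead: "fps_nth (?s (Y $ b' $ d')) n = (-1) ^ n *\<^sub>C ?y b' d' + ?low"
          by (subst lin_subst_nth_lead) simp
        have "fps_nth (Y $ b $ d * ?s (Y $ b' $ d')) n =
          fps_nth (Y $ b $ d) 0 * fps_nth (?s (Y $ b' $ d')) n + ?y b d * fps_nth (Y $ b' $ d') 0 + ?mid"
          using False by (simp add: fps_mult_nth set add.assoc)
        then have eq: "fps_nth (Y $ b $ d) 0 * ((-1) ^ n *\<^sub>C ?y b' d') + ?y b d * fps_nth (Y $ b' $ d') 0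
          = fps_nth (Y $ b $ d * ?s (Y $ b' $ d')) n - fps_nth (Y $ b $ d) 0 * ?low - ?mid"
          by (simp add: lead algebra_simps)
        have low: "?low \<in> B" using less.IH by (intro closed) auto
        have "fps_nth (?s (Y $ b' $ d')) m \<in> B" if "m < n" for m
          unfolding lin_subst_nth using less.IH that by (intro closed) auto
        then have mid: "?mid \<in> B" using less.IH by (intro closed) auto
        show ?thesis
          unfolding eq by (intro closed(7,4) prod low mid) (simp add: Y0 closed)
      qed
      \<comment> \<open>The constant term of the (i, j) entry is zero, so pairing it with a diagonal
        entry leaves only \<open>?y i j\<close>, up to the sign e j.\<close>
      have off: "?y i j \<in> B" if "i \<noteq> j" for i j
        using key[of i j j j] that by (auto simp: Y0 mult_scaleC_right intro: scale)
      have diag: "?y i i \<in> B" for i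
      proof (cases "even n")
        case True
        then have "e i *\<^sub>C (?y i i + ?y i i) \<in> B"
          using key[of i i i i] by (simp add: Y0 mult_scaleC_left mult_scaleC_right scaleC_one scaleC_add_right)
        then show ?thesis by (rule half[OF scale])
      next
        case False
        \<comment> \<open>In odd degree an entry paired with itself cancels, so the two diagonal
          entries are paired with each other. This gives one combination, \<open>tr\<close> the
          complementary one.\<close>
        let ?p = "?y Minus Minus" and ?q = "?y Plus Plus"
        have "e Plus *\<^sub>C (e Plus *\<^sub>C ?p - e Minus *\<^sub>C ?q) \<in> B"
          using key[of Minus Minus Plus Plus] False
          by (intro closed(5)) (simp add: Y0 mult_scaleC_left mult_scaleC_right scaleC_one scaleC_minus_one
              scaleC_minus_right algebra_simps)
        then have 1: "?p - (e Plus * e Minus) *\<^sub>C ?q \<in> B"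
          by (simp add: scaleC_diff_right scaleC_scaleC e scaleC_one)
        have "e Minus *\<^sub>C (e Minus *\<^sub>C ?p + e Plus *\<^sub>C ?q) = 0"
          using tr[OF False] by simp
        then have 2: "?p + (e Plus * e Minus) *\<^sub>C ?q = 0"
          by (simp add: scaleC_add_right scaleC_scaleC e scaleC_one mult.commute)
        then have 3: "(e Plus * e Minus) *\<^sub>C ?q = - ?p"
          by (simp add: eq_neg_iff_add_eq_0 add.commute)
        then have p: "?p \<in> B"
          using 1 by (intro half[of ?p]) simp_all
        moreover have "?q \<in> B"
        proof -
          have "e Plus *\<^sub>C e Minus *\<^sub>C ?q \<in> B" using 3 p by (simp add: scaleC_scaleC closed)
          then show ?thesis by (rule scale[OF scale])
        qed
        ultimately show ?thesis by (cases i) simp_all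
      qed
      show ?thesis
      proof (intro allI)
        fix i j show "?y i j \<in> B" using off diag by (cases "i = j") auto
      qed
    qed
  qed
  then show "fps_nth (Y $ i $ j) n \<in> B" by blast
  \<comment> \<open>With Y known, the top term of X_ij Y_{++} is X_ij in degree n times the sign e
    Plus.\<close>
  show "fps_nth (X $ i $ j) n \<in> B"
  proof (induction n rule: less_induct)
    case (less n)
    have "fps_nth (X $ i $ j * Y $ Plus $ Plus) n
      = (\<Sum>m<n. fps_nth (X $ i $ j) m * fps_nth (Y $ Plus $ Plus) (n - m)) + e Plus *\<^sub>C fps_nth (X $ i $ j) n"
      by (simp add: fps_mult_nth atLeast0AtMost Y0 mult_scaleC_right flip: lessThan_Suc_atMost)
    then have "e Plus *\<^sub>C fps_nth (X $ i $ j) n = fps_nth (X $ i $ j * Y $ Plus $ Plus) n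
      - (\<Sum>m<n. fps_nth (X $ i $ j) m * fps_nth (Y $ Plus $ Plus) (n - m))"
      by simp
    also have "\<dots> \<in> B"
      using less.IH Y by (intro closed(7,8,4) XY) auto
    finally have "e Plus *\<^sub>C fps_nth (X $ i $ j) n \<in> B" .
    then show ?case by (rule scale)
  qed
qed

lemma t_minus_map:
  assumes "ring_hom1 h"
  shows "matrix_map h (t_minus A) = t_minus (matrix_map h A)"
  by (simp add: matrix_eq_ix2 ring_hom1_simps[OF assms])

text \<open>u -> -u - 1 exchanges T(-u) and T(u + 1). The adjugate relations with determinant 1
  collapse the product from the inside: first the adjugate against T, then G against G, then T
  against its adjugate.\<close>

lemma (in yangian_matrix) twisted_inverse:
  assumes q: "qdet T = 1" and G: "G ** G = mat 1" "matrix_map (lin_subst (-1) (-1)) G = G"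
    and A: "A = T ** G ** t_minus T_neg"
  shows "A ** matrix_map (lin_subst (-1) (-1)) A = mat 1"
proof -
  let ?s = "lin_subst (-1) (-1) :: 'a fps \<Rightarrow> 'a fps"
  note h = ring_hom1_lin_subst[of "-1" "-1", where 'a = 'a]
  have shifted_qdet: "shifted_qdet = 1" by (simp add: shifted_qdet_def q)
  have 1: "matrix_map ?s (t_minus T_neg) = t_minus T_shift" "matrix_map ?s (t_minus T_shift) = t_minus T_neg"
    by (simp_all add: t_minus_map[OF h]) (simp_all add: matrix_map_def lin_subst_lin_subst)
  have 2: "t_minus T_neg ** matrix_map ?s T = mat 1"
    using arg_cong[OF adjugate_T, of "matrix_map ?s"]
    by (simp add: matrix_map_mult[OF h] 1 shifted_qdet matrix_map_one[OF h])
  have "A ** matrix_map ?s A = T ** (G ** (t_minus T_neg ** matrix_map ?s T) ** G) ** t_minus T_shift"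
    by (simp add: A matrix_map_mult[OF h] G(2) 1 matrix_mul_assoc)
  also have "\<dots> = mat 1"
    using T_adjugate by (simp add: 2 G shifted_qdet)
  finally show ?thesis .
qed

section \<open>Homomorphisms out of the Yangian\<close>

lemma factor_through_surj:
  assumes "surj \<pi>" "\<And>p q. \<pi> p = \<pi> q \<Longrightarrow> H p = H q"
  obtains h where "\<And>p. h (\<pi> p) = H p"
proof
  show "(H \<circ> inv \<pi>) (\<pi> p) = H p" for p
    unfolding comp_apply by (rule assms(2)) (rule surj_f_inv_f[OF assms(1)])
qed

lemma surj_abs_Y2: "surj abs_Y2"
  by (rule surjI) (rule Quotient3_abs_rep[OF Quotient3_Y2])

lemma surj_abs_SY2: "surj abs_SY2"
  by (rule surjI) (rule Quotient3_abs_rep[OF Quotient3_SY2])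

text \<open>Universal property of the presentation. The constant term must be I because
  \<open>free_T\<close> has generators in positive degree only.\<close>

lemma Y2_hom:
  fixes T' :: "'b::complex_algebra_1 fps^ix2^ix2"
  assumes RTT': "RTT R_circ T' = 0" and T'0: "\<And>i j. fps_nth (T' $ i $ j) 0 = (if i = j then 1 else 0)"
  obtains h where "alg_hom h" "\<And>i j. fps_map h (T_circ $ i $ j) = T' $ i $ j"
proof -
  define f where "f = (\<lambda>(i, j, k). fps_nth (T' $ i $ j) (Suc k))"
  define H where "H = pm_lift (\<lambda>w. case w of Word gs \<Rightarrow> prod_list (map f gs))"
  have H_mult: "H (p * q) = H p * H q" for p q
    unfolding H_def
  proof (rule pm_lift_mult)
    fix k l :: "(ix2 \<times> ix2 \<times> nat) word"
    show "(case k + l of Word gs \<Rightarrow> prod_list (map f gs))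
        = (case k of Word gs \<Rightarrow> prod_list (map f gs)) * (case l of Word gs \<Rightarrow> prod_list (map f gs))"
      by (cases k; cases l) simp
  qed
  have H_one: "H 1 = 1"
    unfolding H_def by (rule pm_lift_one) (simp add: zero_word_def)
  have H_add: "H (p + q) = H p + H q" and H_scale: "H (pm_scale c p) = c *\<^sub>C H p" for p q c
    by (simp_all add: H_def pm_lift_add pm_lift_scale)
  have hom: "ring_hom1 H" by (simp add: ring_hom1_def H_add H_mult H_one)
  have gen: "H (free_gen g) = f g" for g
    by (simp add: H_def free_gen_def pm_lift_single scaleC_one)
  have T': "matrix_map (fps_map H) free_T = T'"
    by (auto simp: vec_eq_iff fps_eq_iff free_T_def gen f_def T'0 H_one ring_hom1_simps(4)[OF hom] split: nat.split)
  have "H x = 0" if "x \<in> Y2_rels" for x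
  proof -
    obtain p q r s where x: "x = fps_nth (fps_nth (RTT R_circ free_T $ p $ q) s) r"
      using \<open>x \<in> Y2_rels\<close> unfolding Y2_rels_def RTT_coeffs_def by blast
    have "matrix_map (fps_map (fps_map H)) (RTT R_circ free_T) = 0"
      using RTT_R_circ_map[OF hom, of free_T] by (simp add: T' RTT')
    then have "fps_map (fps_map H) (RTT R_circ free_T $ p $ q) = 0"
      by (metis matrix_map_nth zero_index)
    then have "fps_nth (fps_nth (fps_map (fps_map H) (RTT R_circ free_T $ p $ q)) s) r = 0" by simp
    then show ?thesis by (simp add: x)
  qed
  then have "H x = 0" if "x \<in> ideal_gen Y2_rels" for x
    using ring_hom1_ideal_gen[OF hom _ that] by blast
  then have "H p = H q" if "abs_Y2 p = abs_Y2 q" for p q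
    using that ring_hom1_simps(6)[OF hom, of p q] by (simp add: Y2.abs_eq_iff)
  then obtain h where h: "\<And>p. h (abs_Y2 p) = H p"
    using factor_through_surj[OF surj_abs_Y2] by metis
  have "alg_hom h"
    unfolding alg_hom_def clinear_def
  proof (intro conjI allI)
    fix x y c
    obtain p q where "x = abs_Y2 p" "y = abs_Y2 q" using surj_abs_Y2 by (metis surjD)
    then show "h (x + y) = h x + h y" "h (c *\<^sub>C x) = c *\<^sub>C h x" "h (x * y) = h x * h y"
      by (simp_all add: h plus_Y2.abs_eq times_Y2.abs_eq scaleC_Y2.abs_eq H_add H_mult H_scale)
  qed (simp add: h one_Y2.abs_eq H_one)
  moreover have "fps_map h (T_circ $ i $ j) = T' $ i $ j" for i j
    using arg_cong[OF T', of "\<lambda>A. A $ i $ j"] by (simp add: T_circ_def fps_eq_iff h)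
  ultimately show thesis using that by blast
qed

lemma SY2_hom:
  fixes h :: "Y2 \<Rightarrow> 'b::complex_algebra_1"
  assumes h: "alg_hom h" and q: "fps_map h (qdet T_circ) = 1"
  obtains g where "alg_hom g" "\<And>y. g (abs_SY2 y) = h y"
proof -
  note hom = alg_hom_simps[OF h]
  have "h x = 0" if "x \<in> SY2_rels" for x
  proof -
    obtain n where "x = fps_nth (qdet T_circ - 1) n" using \<open>x \<in> SY2_rels\<close> unfolding SY2_rels_def by blast
    then show ?thesis
      using arg_cong[OF q, of "\<lambda>f. fps_nth f n"] by (simp add: hom fps_one_nth split: if_splits)
  qed
  then have "h x = 0" if "x \<in> ideal_gen SY2_rels" for x
    using ring_hom1_ideal_gen[OF alg_hom_ring_hom1[OF h] _ that] by blast
  then have "h p = h q" if "abs_SY2 p = abs_SY2 q" for p q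
    using that hom(6)[of p q] by (simp add: SY2.abs_eq_iff)
  then obtain g where g: "\<And>p. g (abs_SY2 p) = h p"
    using factor_through_surj[OF surj_abs_SY2] by metis
  have "alg_hom g"
    unfolding alg_hom_def clinear_def
  proof (intro conjI allI)
    fix x y c
    obtain p q where "x = abs_SY2 p" "y = abs_SY2 q" using surj_abs_SY2 by (metis surjD)
    then show "g (x + y) = g x + g y" "g (c *\<^sub>C x) = c *\<^sub>C g x" "g (x * y) = g x * g y"
      by (simp_all add: g plus_SY2.abs_eq times_SY2.abs_eq scaleC_SY2.abs_eq hom)
  qed (simp add: g one_SY2.abs_eq hom)
  then show thesis using that g by blast
qed

lemma T_circ_nth_0: "fps_nth (T_circ $ i $ j) 0 = (if i = j then 1 else 0)"
  by (simp add: T_circ_def free_T_def one_Y2.abs_eq zero_Y2.abs_eq)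

lemma ring_hom1_abs_Y2: "ring_hom1 abs_Y2"
  by (simp add: ring_hom1_def plus_Y2.abs_eq times_Y2.abs_eq one_Y2.abs_eq)

interpretation Y2: yangian_matrix T_circ
proof
  have "abs_Y2 (fps_nth (fps_nth (RTT R_circ free_T $ p $ q) s) r) = 0" for p q s r
  proof -
    have "fps_nth (fps_nth (RTT R_circ free_T $ p $ q) s) r \<in> Y2_rels"
      unfolding Y2_rels_def RTT_coeffs_def by blast
    then show ?thesis by (simp add: zero_Y2.abs_eq Y2.abs_eq_iff ideal_gen_base)
  qed
  then show "RTT R_circ T_circ = 0"
    unfolding T_circ_def RTT_R_circ_map[OF ring_hom1_abs_Y2]
    by (simp add: vec_eq_iff fps_eq_iff del: split_paired_All)
qed

lemma Y2_generated: "y \<in> subalg_gen (series_coeffs T_circ)"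
proof -
  let ?A = "subalg_gen (series_coeffs T_circ)"
  have gen: "abs_Y2 (free_gen (i, j, k)) \<in> ?A" for i j k
  proof -
    have "abs_Y2 (free_gen (i, j, k)) = fps_nth (T_circ $ i $ j) (Suc k)"
      by (simp add: T_circ_def free_T_def)
    then show ?thesis by (metis in_series_coeffs subalg_gen_base)
  qed
  have "abs_Y2 p \<in> ?A" for p
  proof (induction p rule: pm_induct)
    case zero
    then show ?case by (simp add: subalg_gen_zero flip: zero_Y2.abs_eq)
  next
    case (single w c)
    obtain gs where w: "w = Word gs" by (cases w)
    have "abs_Y2 (Poly_Mapping.single (Word gs) 1) \<in> ?A"
    proof (induction gs)
      case Nil
      then show ?case by (simp add: subalg_gen_one flip: zero_word_def one_Y2.abs_eq)
    next
      case (Cons g gs)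
      have "Poly_Mapping.single (Word (g # gs)) 1 = free_gen g * Poly_Mapping.single (Word gs) (1 :: complex)"
        by (simp add: free_gen_def mult_single)
      then show ?case
        using gen Cons by (cases g) (simp add: subalg_gen_mult flip: times_Y2.abs_eq)
    qed
    then have "c *\<^sub>C abs_Y2 (Poly_Mapping.single w 1) \<in> ?A" by (simp add: w subalg_gen_scale)
    then show ?case by (simp add: scaleC_Y2.abs_eq pm_scale_single)
  next
    case (add p q)
    then show ?case by (simp add: subalg_gen_add flip: plus_Y2.abs_eq)
  qed
  then show ?thesis using surj_abs_Y2 by (metis surjD)
qed

text \<open>Commuting with the generators suffices, and undoing the shift by one preserves
  centrality.\<close>

lemma central_qdet_T_circ: "central (qdet T_circ)"
proof -
  have "x * fps_nth Y2.shifted_qdet r = fps_nth Y2.shifted_qdet r * x" for x r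
    by (rule commute_generated[OF _ Y2_generated]) (auto simp: series_coeffs_def Y2.shifted_qdet_nth_commute)
  then have "central Y2.shifted_qdet" by (simp add: central_fps_iff) (simp add: central_def)
  then show ?thesis by (simp add: Y2.qdet_eq central_lin_subst)
qed

lemma qdet_T_circ_nth_0: "fps_nth (qdet T_circ) 0 = 1"
  by (simp add: qdet_def T_circ_nth_0)

subsection \<open>Rescaling by central series\<close>

lemma qdet_map: "alg_hom h \<Longrightarrow> fps_map h (qdet T) = qdet (matrix_map (fps_map h) T)"
  by (simp add: qdet_def ring_hom1_simps[OF ring_hom1_fps_map[OF alg_hom_ring_hom1]] fps_map_lin_subst)

lemma twist_plus_map: "alg_hom h \<Longrightarrow> matrix_map (fps_map h) (twist_plus T) = twist_plus (matrix_map (fps_map h) T)"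
  and twist_minus_map: "alg_hom h \<Longrightarrow> matrix_map (fps_map h) (twist_minus T) = twist_minus (matrix_map (fps_map h) T)"
  by (simp_all add: matrix_eq_ix2 twist_plus_def twist_minus_def matrix_mult_ix2 flip_t_def
      ring_hom1_simps[OF ring_hom1_fps_map[OF alg_hom_ring_hom1]] fps_map_lin_subst)

lemma qdet_scale:
  assumes c: "central c"
  shows "qdet (\<chi> i j. c * T $ i $ j) = lin_subst 1 (-1) c * c * qdet T"
proof -
  have *: "(lin_subst 1 (-1) c * x) * (c * y) = lin_subst 1 (-1) c * c * (x * y)" for x y
    using central_lin_subst[OF c, of 1 "-1"] c by (intro central_mult_mult) (auto simp: central_def)
  show ?thesis
    by (simp add: qdet_def lin_subst_mult * right_diff_distrib)
qed

text \<open>Both twists acquire the same factor c(u) c(-u). Mutually inverse scalings of the two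
  tensor factors therefore cancel in products of entries.\<close>

lemma twist_scale:
  assumes c: "central c"
  shows "twist_plus (\<chi> i j. c * T $ i $ j) $ i $ j = (c * lin_subst (-1) 0 c) * twist_plus T $ i $ j"
    and "twist_minus (\<chi> i j. c * T $ i $ j) $ i $ j = (c * lin_subst (-1) 0 c) * twist_minus T $ i $ j"
proof -
  have *: "(c * x) * (lin_subst (-1) 0 c * y) = c * lin_subst (-1) 0 c * (x * y)" for x y
    using central_lin_subst[OF c, of "-1" 0] c by (intro central_mult_mult) (auto simp: central_def)
  show "twist_plus (\<chi> i j. c * T $ i $ j) $ i $ j = (c * lin_subst (-1) 0 c) * twist_plus T $ i $ j"
    by (simp add: twist_plus_def matrix_mult_ix2 flip_t_def lin_subst_mult * distrib_left)
  show "twist_minus (\<chi> i j. c * T $ i $ j) $ i $ j = (c * lin_subst (-1) 0 c) * twist_minus T $ i $ j"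
    by (cases j) (simp_all add: twist_minus_def matrix_mult_ix2 lin_subst_mult * right_diff_distrib distrib_left)
qed

text \<open>The map T(u) -> c(u) T(u) followed by \<open>\<iota>\<close>. The coefficients of c may
  be any central elements of the target; below they come from one tensor factor while
  \<open>\<iota>\<close> embeds the other.\<close>

lemma scaled_hom:
  fixes \<iota> :: "Y2 \<Rightarrow> 'c::complex_algebra_1"
  assumes \<iota>: "alg_hom \<iota>" and c: "central c" "fps_nth c 0 = 1"
  obtains h where "alg_hom h" "matrix_map (fps_map h) T_circ = (\<chi> i j. c * matrix_map (fps_map \<iota>) T_circ $ i $ j)"
proof -
  note hom = alg_hom_ring_hom1[OF \<iota>]
  have "matrix_map (fps_map (fps_map \<iota>)) 0 = 0"
    by (simp add: vec_eq_iff fps_eq_iff alg_hom_simps[OF \<iota>] del: split_paired_All)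
  then have "RTT R_circ (matrix_map (fps_map \<iota>) T_circ) = 0"
    by (simp add: RTT_R_circ_map[OF hom] Y2.RTT)
  from RTT_R_circ_scale[OF this c(1)]
  obtain h where "alg_hom h" "\<And>i j. fps_map h (T_circ $ i $ j) = (\<chi> i j. c * matrix_map (fps_map \<iota>) T_circ $ i $ j) $ i $ j"
    by (rule Y2_hom) (auto simp: c T_circ_nth_0 alg_hom_simps[OF \<iota>])
  then show thesis using that by (simp add: vec_eq_iff)
qed

text \<open>Scaling multiplies the quantum determinant by c(u - 1) c(u). Normalised to 1, the map
  factors through SY(2).\<close>

lemma scaled_special_hom:
  fixes \<iota> :: "Y2 \<Rightarrow> 'c::complex_algebra_1"
  assumes \<iota>: "alg_hom \<iota>" and c: "central c" "fps_nth c 0 = 1"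
    and q: "lin_subst 1 (-1) c * c * fps_map \<iota> (qdet T_circ) = 1"
  obtains g where "alg_hom g" "alg_hom (g \<circ> abs_SY2)"
    "matrix_map (fps_map (g \<circ> abs_SY2)) T_circ = (\<chi> i j. c * matrix_map (fps_map \<iota>) T_circ $ i $ j)"
proof -
  obtain h where h: "alg_hom h" "matrix_map (fps_map h) T_circ = (\<chi> i j. c * matrix_map (fps_map \<iota>) T_circ $ i $ j)"
    using scaled_hom[OF \<iota> c] by blast
  have "fps_map h (qdet T_circ) = 1"
    by (simp only: qdet_map[OF h(1)] h(2) qdet_scale[OF c(1)] q flip: qdet_map[OF \<iota>])
  then obtain g where g: "alg_hom g" "\<And>y. g (abs_SY2 y) = h y"
    using SY2_hom[OF h(1)] by blast
  then have "g \<circ> abs_SY2 = h" by (simp add: fun_eq_iff)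
  then show thesis using that g h by simp
qed

text \<open>Commutation is checked on the coefficients of \<open>T_circ\<close>, for one map at a
  time: first \<open>g\<close> against \<open>\<iota>\<close>, then \<open>f\<close> against
  \<open>g\<close>.\<close>

lemma scaled_homs_commute:
  fixes f g \<iota> \<kappa> :: "Y2 \<Rightarrow> 'c::complex_algebra_1"
  assumes f: "alg_hom f" "matrix_map (fps_map f) T_circ = (\<chi> i j. c * matrix_map (fps_map \<iota>) T_circ $ i $ j)"
    and g: "alg_hom g" "matrix_map (fps_map g) T_circ = (\<chi> i j. d * matrix_map (fps_map \<kappa>) T_circ $ i $ j)"
    and c: "central c" and d: "central d" and comm: "\<And>x y. \<iota> x * \<kappa> y = \<kappa> y * \<iota> x"
  shows "f x * g y = g y * f x"
proof -
  have nth: "fps_nth (c * fps_map \<iota> (T_circ $ i $ j)) m * z = z * fps_nth (c * fps_map \<iota> (T_circ $ i $ j)) m"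
    if "central c" "\<And>x. \<iota> x * z = z * \<iota> x" for c and \<iota> :: "Y2 \<Rightarrow> 'c" and z i j m
    using fps_mult_nth_in[OF subalgebra_centralizer[of z], of c "fps_map \<iota> (T_circ $ i $ j)" m] that
    by (simp add: central_fps_iff) (simp add: central_def)
  have gen: "h x * z = z * h x"
    if "alg_hom h" "\<And>i j m. h (fps_nth (T_circ $ i $ j) m) * z = z * h (fps_nth (T_circ $ i $ j) m)"
    for h :: "Y2 \<Rightarrow> 'c" and x z
  proof -
    have "subalg_gen (series_coeffs T_circ) \<subseteq> h -` {x. x * z = z * x}"
      by (rule subalg_gen_least[OF subalgebra_vimage[OF that(1) subalgebra_centralizer]])
         (auto simp: series_coeffs_def that(2))
    then show ?thesis using Y2_generated by blast
  qed
  have f': "f (fps_nth (T_circ $ i $ j) m) = fps_nth (c * fps_map \<iota> (T_circ $ i $ j)) m" for i j m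
    using arg_cong[OF f(2), of "\<lambda>A. fps_nth (A $ i $ j) m"] by simp
  have g': "g (fps_nth (T_circ $ i $ j) m) = fps_nth (d * fps_map \<kappa> (T_circ $ i $ j)) m" for i j m
    using arg_cong[OF g(2), of "\<lambda>A. fps_nth (A $ i $ j) m"] by simp
  have 1: "g y * \<iota> x = \<iota> x * g y" for x y
    by (rule gen[OF g(1)], unfold g', rule nth[OF d]) (simp add: comm)
  show ?thesis
    by (rule gen[OF f(1)], unfold f', rule nth[OF c]) (simp add: 1)
qed

lemma fps_map_fps_map [simp]: "fps_map f (fps_map g a) = fps_map (f \<circ> g) a"
  by (simp add: fps_eq_iff)

lemma fps_map_commute:
  assumes "\<And>x y. f x * g y = g y * (f x :: 'c::ring_1)"
  shows "fps_map f a * fps_map g b = fps_map g b * fps_map f a"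
proof (rule fps_ext)
  fix n
  have "fps_nth (fps_map f a * fps_map g b) n = (\<Sum>i=0..n. g (fps_nth b (n - i)) * f (fps_nth a i))"
    by (simp add: fps_mult_nth assms)
  also have "\<dots> = fps_nth (fps_map g b * fps_map f a) n"
    unfolding fps_mult_nth by (subst sum.atLeastAtMost_rev) simp
  finally show "fps_nth (fps_map f a * fps_map g b) n = fps_nth (fps_map g b * fps_map f a) n" .
qed

lemma matrix_map_inj:
  assumes "inj h" "matrix_map (fps_map h) A = matrix_map (fps_map h) B"
  shows "A = B"
  using assms by (simp add: vec_eq_iff fps_eq_iff inj_eq)

lemma matrix_map_inverse:
  assumes h: "alg_hom h"
  shows "matrix_map (fps_map h) (A ** matrix_map (lin_subst e b) A)
    = matrix_map (fps_map h) A ** matrix_map (lin_subst e b) (matrix_map (fps_map h) A)"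
  unfolding matrix_map_mult[OF ring_hom1_fps_map[OF alg_hom_ring_hom1[OF h]]]
  by (rule arg_cong2[where f = "(**)"]) (simp_all add: vec_eq_iff fps_map_lin_subst[OF h])

lemma K_mat_simps [simp]:
  "K_mat $ Minus $ Minus = -1" "K_mat $ Plus $ Plus = 1" "K_mat $ Minus $ Plus = 0" "K_mat $ Plus $ Minus = 0"
  by (simp_all add: K_mat_def matrix_unit_def)

lemma K_mat_square: "K_mat ** K_mat = (mat 1 :: 'a::ring_1^ix2^ix2)"
  by (simp add: matrix_eq_ix2 matrix_mult_ix2 mat_def)

lemma matrix_map_K_mat: "ring_hom1 h \<Longrightarrow> matrix_map h K_mat = K_mat"
  by (simp add: matrix_eq_ix2 ring_hom1_simps)

lemma mult_K_mat_nth: "(A ** K_mat) $ i $ j = A $ i $ j * ix_sign j" for A :: "'a::ring_1^ix2^ix2"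
  by (cases j) (simp_all add: matrix_mult_ix2)

section \<open>The twisted Yangians\<close>

interpretation SY2: yangian_matrix T_cal
proof
  have "matrix_map (fps_map (fps_map abs_SY2)) 0 = 0"
    by (simp add: vec_eq_iff fps_eq_iff alg_hom_simps[OF alg_hom_abs_SY2] del: split_paired_All)
  then show "RTT R_circ T_cal = 0"
    by (simp add: T_cal_def RTT_R_circ_map[OF alg_hom_ring_hom1[OF alg_hom_abs_SY2]] Y2.RTT)
qed

lemma qdet_T_cal: "qdet T_cal = 1"
proof -
  have "abs_SY2 (fps_nth (qdet T_circ - 1) n) = 0" for n
    by (simp add: zero_SY2.abs_eq SY2.abs_eq_iff SY2_rels_def ideal_gen_base del: fps_sub_nth)
  then have "fps_map abs_SY2 (qdet T_circ) = 1"
    by (simp add: fps_eq_iff alg_hom_simps[OF alg_hom_abs_SY2] fps_one_nth split: if_splits)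
  then show ?thesis
    by (simp add: T_cal_def qdet_map[OF alg_hom_abs_SY2])
qed

text \<open>Conjugation by K turns t_+ into t_-. So S^o(u) K and S^\<bullet>(u) both have the form
  T(u) G T(-u)^{t_-}, with G = K and G = I.\<close>

lemma flip_t_K_mat: "flip_t A ** K_mat = K_mat ** t_minus A"
  for A :: "'a::ring_1^ix2^ix2"
  by (simp add: matrix_eq_ix2 matrix_mult_ix2 flip_t_def)

lemma twist_plus_K_mat:
  "twist_plus T ** K_mat = T ** K_mat ** t_minus (matrix_map (lin_subst (-1) 0) T)"
  by (simp add: twist_plus_def flip_t_K_mat flip: matrix_mul_assoc)

lemma twist_minus_eq: "twist_minus T = T ** mat 1 ** t_minus (matrix_map (lin_subst (-1) 0) T)"
  by (simp add: twist_minus_def)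

lemma twisted_inverse_T_cal:
  "twist_plus T_cal ** K_mat ** matrix_map (lin_subst (-1) (-1)) (twist_plus T_cal ** K_mat) = mat 1"
  "twist_minus T_cal ** matrix_map (lin_subst (-1) (-1)) (twist_minus T_cal) = mat 1"
  by (rule SY2.twisted_inverse[OF qdet_T_cal K_mat_square matrix_map_K_mat[OF ring_hom1_lin_subst] twist_plus_K_mat],
      rule SY2.twisted_inverse[OF qdet_T_cal _ matrix_map_one[OF ring_hom1_lin_subst] twist_minus_eq]) simp

text \<open>Absorbs the middle factor K_1 of the embedding, so that both signs can be treated
  alike.\<close>

definition A_circ :: "Yplus fps^ix2^ix2" where
  "A_circ = S_circ ** K_mat"

lemma alg_hom_Rep: "alg_hom Rep_Yplus" "alg_hom Rep_Yminus" "alg_hom Rep_SYplus" "alg_hom Rep_SYminus" "alg_hom Rep_Xtw"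
  by (simp_all add: alg_hom_def clinear_def plus_Yplus.rep_eq times_Yplus.rep_eq scaleC_Yplus.rep_eq one_Yplus.rep_eq
      plus_Yminus.rep_eq times_Yminus.rep_eq scaleC_Yminus.rep_eq one_Yminus.rep_eq
      plus_SYplus.rep_eq times_SYplus.rep_eq scaleC_SYplus.rep_eq one_SYplus.rep_eq
      plus_SYminus.rep_eq times_SYminus.rep_eq scaleC_SYminus.rep_eq one_SYminus.rep_eq
      plus_Xtw.rep_eq times_Xtw.rep_eq scaleC_Xtw.rep_eq one_Xtw.rep_eq)

lemma inj_Rep: "inj Rep_Yplus" "inj Rep_Yminus" "inj Rep_SYplus" "inj Rep_SYminus" "inj Rep_Xtw"
  by (simp_all add: inj_def Rep_Yplus_inject Rep_Yminus_inject Rep_SYplus_inject Rep_SYminus_inject Rep_Xtw_inject)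

lemma Rep_A_circ: "matrix_map (fps_map Rep_Yplus) A_circ = twist_plus T_circ ** K_mat"
proof -
  note h = ring_hom1_fps_map[OF alg_hom_ring_hom1[OF alg_hom_Rep(1)]]
  show ?thesis by (simp add: A_circ_def matrix_map_mult[OF h] matrix_map_K_mat[OF h] Rep_S_circ)
qed

lemma A_circ_nth_0: "fps_nth (A_circ $ i $ j) 0 = (if i = j then ix_sign i else 0)"
proof -
  have "Rep_Yplus (fps_nth (A_circ $ i $ j) 0) = Rep_Yplus (if i = j then ix_sign i else 0)"
    using arg_cong[OF Rep_A_circ, of "\<lambda>A. fps_nth (A $ i $ j) 0"]
    by (cases i; cases j)
       (simp_all add: twist_plus_def matrix_mult_ix2 flip_t_def T_circ_nth_0 alg_hom_simps[OF alg_hom_Rep(1)])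
  then show ?thesis by (simp only: Rep_Yplus_inject)
qed

lemma S_bullet_nth_0: "fps_nth (S_bullet $ i $ j) 0 = (if i = j then 1 else 0)"
proof -
  have "Rep_Yminus (fps_nth (S_bullet $ i $ j) 0) = Rep_Yminus (if i = j then 1 else 0)"
    using arg_cong[OF Rep_S_bullet, of "\<lambda>A. fps_nth (A $ i $ j) 0"]
    by (cases i; cases j)
       (simp_all add: twist_minus_def matrix_mult_ix2 T_circ_nth_0 alg_hom_simps[OF alg_hom_Rep(2)])
  then show ?thesis by (simp only: Rep_Yminus_inject)
qed

lemma A_circ_trace:
  assumes "odd n"
  shows "- fps_nth (A_circ $ Minus $ Minus) n + fps_nth (A_circ $ Plus $ Plus) n = 0"
proof -
  have "fps_nth (- 1 * (twist_plus T_circ ** K_mat) $ Minus $ Minus + (twist_plus T_circ ** K_mat) $ Plus $ Plus) n = 0"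
    by (rule Y2.twisted_trace[OF _ twist_plus_K_mat]) (simp_all add: assms)
  then have "Rep_Yplus (- fps_nth (A_circ $ Minus $ Minus) n + fps_nth (A_circ $ Plus $ Plus) n) = Rep_Yplus 0"
    by (simp add: alg_hom_simps[OF alg_hom_Rep(1)] flip: Rep_A_circ)
  then show ?thesis by (simp only: Rep_Yplus_inject)
qed

lemma S_bullet_trace:
  assumes "odd n"
  shows "fps_nth (S_bullet $ Minus $ Minus) n + fps_nth (S_bullet $ Plus $ Plus) n = 0"
proof -
  have "fps_nth (1 * twist_minus T_circ $ Minus $ Minus + twist_minus T_circ $ Plus $ Plus) n = 0"
    by (rule Y2.twisted_trace[OF _ twist_minus_eq]) (simp_all add: assms mat_def)
  then have "Rep_Yminus (fps_nth (S_bullet $ Minus $ Minus) n + fps_nth (S_bullet $ Plus $ Plus) n) = Rep_Yminus 0"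
    by (simp add: alg_hom_simps[OF alg_hom_Rep(2)] flip: Rep_S_bullet)
  then show ?thesis by (simp only: Rep_Yminus_inject)
qed

section \<open>Generators of the twisted subalgebras and properties of the projections\<close>

lemma generated_subtype:
  assumes R: "alg_hom R" "inj R" and "\<And>x. R x \<in> subalg_gen (R ` G)"
  shows "x \<in> subalg_gen G"
  using assms(3)[of x] subalg_gen_image[OF R(1), of G] R(2) by (auto simp: inj_eq dest!: subsetD)

lemma Yplus_generated: "x \<in> subalg_gen (series_coeffs S_circ)"
  by (rule generated_subtype[OF alg_hom_Rep(1) inj_Rep(1)])
     (use Rep_Yplus in \<open>simp add: Rep_S_circ flip: series_coeffs_map\<close>)

lemma Yminus_generated: "x \<in> subalg_gen (series_coeffs S_bullet)"
  by (rule generated_subtype[OF alg_hom_Rep(2) inj_Rep(2)])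
     (use Rep_Yminus in \<open>simp add: Rep_S_bullet flip: series_coeffs_map\<close>)

lemma Xtw_generated: "x \<in> subalg_gen (series_coeffs S_mat)"
  by (rule generated_subtype[OF alg_hom_Rep(5) inj_Rep(5)])
     (use Rep_Xtw in \<open>simp add: Rep_S_mat flip: series_coeffs_map\<close>)

lemma alg_hom_Pr: "alg_hom Pr_plus" "alg_hom Pr_minus"
  by (simp_all add: alg_hom_def clinear_def Pr_plus.rep_eq Pr_minus.rep_eq alg_hom_simps[OF alg_hom_Rep(3)] alg_hom_simps[OF alg_hom_Rep(4)]
      alg_hom_simps[OF alg_hom_Rep(1)] alg_hom_simps[OF alg_hom_Rep(2)] alg_hom_simps[OF alg_hom_abs_SY2]
      flip: Rep_SYplus_inject Rep_SYminus_inject)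

lemma surj_Pr_plus: "surj Pr_plus"
proof
  show "UNIV \<subseteq> range Pr_plus"
  proof
    fix z
    have "Rep_SYplus z \<in> abs_SY2 ` subalg_gen (series_coeffs (twist_plus T_circ))"
      using Rep_SYplus[of z] subalg_gen_image[OF alg_hom_abs_SY2]
      by (auto simp: T_cal_twist_plus series_coeffs_map)
    then obtain w where w: "w \<in> subalg_gen (series_coeffs (twist_plus T_circ))" "Rep_SYplus z = abs_SY2 w" by blast
    then have "Rep_SYplus z = Rep_SYplus (Pr_plus (Abs_Yplus w))"
      by (simp add: Pr_plus.rep_eq Abs_Yplus_inverse)
    then show "z \<in> range Pr_plus" by (simp add: Rep_SYplus_inject)
  qed
qed simp

lemma surj_Pr_minus: "surj Pr_minus"
proof
  show "UNIV \<subseteq> range Pr_minus"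
  proof
    fix z
    have "Rep_SYminus z \<in> abs_SY2 ` subalg_gen (series_coeffs (twist_minus T_circ))"
      using Rep_SYminus[of z] subalg_gen_image[OF alg_hom_abs_SY2]
      by (auto simp: T_cal_twist_minus series_coeffs_map)
    then obtain w where w: "w \<in> subalg_gen (series_coeffs (twist_minus T_circ))" "Rep_SYminus z = abs_SY2 w" by blast
    then have "Rep_SYminus z = Rep_SYminus (Pr_minus (Abs_Yminus w))"
      by (simp add: Pr_minus.rep_eq Abs_Yminus_inverse)
    then show "z \<in> range Pr_minus" by (simp add: Rep_SYminus_inject)
  qed
qed simp

lemma Pr_plus_inverse:
  "matrix_map (fps_map Pr_plus) A_circ ** matrix_map (lin_subst (-1) (-1)) (matrix_map (fps_map Pr_plus) A_circ) = mat 1"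
proof (rule matrix_map_inj[OF inj_Rep(3)])
  have "matrix_map (fps_map Rep_SYplus) (matrix_map (fps_map Pr_plus) A_circ)
      = matrix_map (fps_map abs_SY2) (matrix_map (fps_map Rep_Yplus) A_circ)"
    by (simp add: vec_eq_iff fps_eq_iff Pr_plus.rep_eq)
  also have "\<dots> = twist_plus T_cal ** K_mat"
  proof -
    note h = ring_hom1_fps_map[OF alg_hom_ring_hom1[OF alg_hom_abs_SY2]]
    show ?thesis by (simp only: Rep_A_circ matrix_map_mult[OF h] matrix_map_K_mat[OF h] T_cal_twist_plus)
  qed
  finally show "matrix_map (fps_map Rep_SYplus) (matrix_map (fps_map Pr_plus) A_circ
       ** matrix_map (lin_subst (-1) (-1)) (matrix_map (fps_map Pr_plus) A_circ)) = matrix_map (fps_map Rep_SYplus) (mat 1)"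
    by (simp only: matrix_map_inverse[OF alg_hom_Rep(3)] twisted_inverse_T_cal
        matrix_map_one[OF ring_hom1_fps_map[OF alg_hom_ring_hom1[OF alg_hom_Rep(3)]]])
qed

lemma Pr_minus_inverse:
  "matrix_map (fps_map Pr_minus) S_bullet ** matrix_map (lin_subst (-1) (-1)) (matrix_map (fps_map Pr_minus) S_bullet) = mat 1"
proof (rule matrix_map_inj[OF inj_Rep(4)])
  have "matrix_map (fps_map Rep_SYminus) (matrix_map (fps_map Pr_minus) S_bullet)
      = matrix_map (fps_map abs_SY2) (matrix_map (fps_map Rep_Yminus) S_bullet)"
    by (simp add: vec_eq_iff fps_eq_iff Pr_minus.rep_eq)
  also have "\<dots> = twist_minus T_cal"
    by (simp only: Rep_S_bullet T_cal_twist_minus)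
  finally show "matrix_map (fps_map Rep_SYminus) (matrix_map (fps_map Pr_minus) S_bullet
       ** matrix_map (lin_subst (-1) (-1)) (matrix_map (fps_map Pr_minus) S_bullet)) = matrix_map (fps_map Rep_SYminus) (mat 1)"
    by (simp only: matrix_map_inverse[OF alg_hom_Rep(4)] twisted_inverse_T_cal
        matrix_map_one[OF ring_hom1_fps_map[OF alg_hom_ring_hom1[OF alg_hom_Rep(4)]]])
qed

section \<open>The embedding and its projections\<close>

lemma sum_ix2_pair:
  "(\<Sum>p\<in>UNIV. f p) = f (Minus, Minus) + f (Minus, Plus) + f (Plus, Minus) + f (Plus, Plus)"
proof -
  have *: "(UNIV :: (ix2 \<times> ix2) set) = {(Minus, Minus), (Minus, Plus), (Plus, Minus), (Plus, Plus)}"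
    unfolding UNIV_Times_UNIV[symmetric] UNIV_ix2 by auto
  show ?thesis unfolding * by (simp add: add.assoc)
qed

lemma kron_mult_left: "kron A (mat 1) ** kron B (mat 1) = kron (A ** B) (mat 1 :: 'a::ring_1^ix2^ix2)"
  for A B :: "'a::ring_1^ix2^ix2"
proof -
  have "(kron A (mat 1) ** kron B (mat 1)) $ (i, k) $ (j, l) = kron (A ** B) (mat 1 :: 'a^ix2^ix2) $ (i, k) $ (j, l)"
    for i j k l
    unfolding matrix_matrix_mult_def vec_lambda_beta sum_ix2_pair
    by (cases k; cases l) (simp_all add: kron_def mat_def matrix_matrix_mult_def sum_ix2)
  then show ?thesis by (simp add: vec_eq_iff)
qed

text \<open>Up to the basis signs, an entry is one entry of \<open>A_circ\<close> times one of
  \<open>S_bullet\<close>. The shift u - 1/2 is multiplicative, so it is taken out of the product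
  and can later be undone.\<close>

lemma phi0_image_nth:
  "phi0_image $ i $ j = basis_sign i * lin_subst 1 (-1/2)
     (fps_map (\<lambda>x. x \<otimes> 1) (A_circ $ fst (basis_ix i) $ fst (basis_ix j))
      * fps_map (\<lambda>y. 1 \<otimes> y) (S_bullet $ snd (basis_ix i) $ snd (basis_ix j))) * basis_sign j"
proof -
  let ?f = "fps_map (\<lambda>x. x \<otimes> 1) \<circ> lin_subst 1 (-1/2) :: Yplus fps \<Rightarrow> (Yplus, Yminus) tensor fps"
  note h = ring_hom1_simps[OF ring_hom1_fps_map[OF alg_hom_ring_hom1[OF alg_hom_tensor_left]]]
  have f: "ring_hom1 ?f"
    by (simp add: ring_hom1_def h lin_subst_simps)
  have "matrix_map ?f S_circ ** K_mat = matrix_map ?f A_circ"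
    unfolding A_circ_def matrix_map_mult[OF f] matrix_map_K_mat[OF f] by (rule refl)
  then show ?thesis
    unfolding phi0_image_def in_basis_v_def kron_mult_left vec_lambda_beta kron_mult_nth
    by (simp add: lin_subst_mult fps_map_lin_subst[OF alg_hom_tensor_left] fps_map_lin_subst[OF alg_hom_tensor_right])
qed

lemma basis_ix_surj: obtains i where "basis_ix i = p"
  using that[of M2] that[of M1] that[of P1] that[of P2]
  by (cases p; cases "fst p"; cases "snd p") auto

lemma Rep_A_circ_nth: "fps_map Rep_Yplus (A_circ $ i $ j) = (twist_plus T_circ ** K_mat) $ i $ j"
  by (simp flip: Rep_A_circ)

lemma Rep_S_bullet_nth: "fps_map Rep_Yminus (S_bullet $ i $ j) = twist_minus T_circ $ i $ j"
  by (simp flip: Rep_S_bullet)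

section \<open>Central series in tensor products and the root of the quantum determinant\<close>

lemma central_tensor_left: "central z \<Longrightarrow> central (z \<otimes> 1)"
  unfolding central_def
proof
  fix t assume "\<forall>x. z * x = x * z"
  then show "(z \<otimes> 1) * t = t * (z \<otimes> 1)"
    by (induction t rule: tensor_induct) (simp_all add: tensor_mult distrib_left distrib_right)
qed

lemma central_tensor_right: "central z \<Longrightarrow> central (1 \<otimes> z)"
  unfolding central_def
proof
  fix t assume "\<forall>x. z * x = x * z"
  then show "(1 \<otimes> z) * t = t * (1 \<otimes> z)"
    by (induction t rule: tensor_induct) (simp_all add: tensor_mult distrib_left distrib_right)
qed

lemma central_fps_map:
  "central f \<Longrightarrow> (\<And>z. central z \<Longrightarrow> central (h z)) \<Longrightarrow> central (fps_map h f)"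
  by (simp add: central_fps_iff)

text \<open>From qdet T(u) = d(u - 1) d(u), the inverse e of d is the scaling that makes the quantum
  determinant equal to 1.\<close>

lemma qdet_T_circ_root:
  obtains d e where "central d" "central e" "fps_nth d 0 = 1" "fps_nth e 0 = 1" "d * e = 1" "e * d = 1"
    "lin_subst 1 (-1) e * e * qdet T_circ = 1"
proof -
  obtain d where d: "central d" "fps_nth d 0 = 1" "lin_subst 1 (-1) d * d = qdet T_circ"
    using central_shift_root[OF central_qdet_T_circ qdet_T_circ_nth_0] .
  \<comment> \<open>A right inverse exists because d has constant term 1; centrality of d makes it
    two-sided and central.\<close>
  let ?e = "fps_right_inverse d 1"
  have de: "d * ?e = 1" by (rule fps_right_inverse) (simp add: d)
  note e = central_inverse[OF d(1) de]
  have e0: "fps_nth ?e 0 = 1"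
    using arg_cong[OF de, of "\<lambda>f. fps_nth f 0"] by (simp add: d)
  have "lin_subst 1 (-1) ?e * ?e * (lin_subst 1 (-1) d * d)
      = lin_subst 1 (-1) ?e * (?e * lin_subst 1 (-1) d) * d"
    by (simp only: mult.assoc)
  also have "?e * lin_subst 1 (-1) d = lin_subst 1 (-1) d * ?e"
    using e(1) by (simp add: central_def)
  also have "lin_subst 1 (-1) ?e * (lin_subst 1 (-1) d * ?e) * d = lin_subst 1 (-1) (?e * d) * (?e * d)"
    by (simp only: lin_subst_mult mult.assoc)
  finally have "lin_subst 1 (-1) ?e * ?e * qdet T_circ = 1"
    by (simp add: e d(3))
  then show thesis using that[OF d(1) e(1) d(2) e0 de e(2)] by blast
qed

lemma scaled_twist:
  assumes h: "alg_hom h" "matrix_map (fps_map h) T_circ = (\<chi> i j. c * matrix_map (fps_map \<iota>) T_circ $ i $ j)"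
    and \<iota>: "alg_hom \<iota>" and c: "central c"
  shows "fps_map h ((twist_plus T_circ ** K_mat) $ i $ j)
      = (c * lin_subst (-1) 0 c) * fps_map \<iota> ((twist_plus T_circ ** K_mat) $ i $ j)"
    and "fps_map h (twist_minus T_circ $ i $ j) = (c * lin_subst (-1) 0 c) * fps_map \<iota> (twist_minus T_circ $ i $ j)"
proof -
  have plus: "fps_map k (twist_plus T_circ $ i $ j) = twist_plus (matrix_map (fps_map k) T_circ) $ i $ j"
    and minus: "fps_map k (twist_minus T_circ $ i $ j) = twist_minus (matrix_map (fps_map k) T_circ) $ i $ j"
    if "alg_hom k" for k :: "Y2 \<Rightarrow> 'a"
    by (simp_all flip: twist_plus_map[OF that] twist_minus_map[OF that])
  note hom = ring_hom1_simps[OF ring_hom1_fps_map[OF alg_hom_ring_hom1[OF h(1)]]]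
    ring_hom1_simps[OF ring_hom1_fps_map[OF alg_hom_ring_hom1[OF \<iota>]]]
  have "fps_map h (twist_plus T_circ $ i $ j) = (c * lin_subst (-1) 0 c) * fps_map \<iota> (twist_plus T_circ $ i $ j)"
    by (simp only: plus[OF h(1)] plus[OF \<iota>] h(2) twist_scale[OF c])
  then show "fps_map h ((twist_plus T_circ ** K_mat) $ i $ j)
      = (c * lin_subst (-1) 0 c) * fps_map \<iota> ((twist_plus T_circ ** K_mat) $ i $ j)"
    by (cases j) (simp_all add: mult_K_mat_nth hom)
  show "fps_map h (twist_minus T_circ $ i $ j) = (c * lin_subst (-1) 0 c) * fps_map \<iota> (twist_minus T_circ $ i $ j)"
    by (simp only: minus[OF h(1)] minus[OF \<iota>] h(2) twist_scale[OF c])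
qed

section \<open>Reduction of injectivity and surjectivity to products of generating series\<close>

locale phi0_embedding =
  fixes \<phi>\<^sub>0 :: "Xtw \<Rightarrow> (Yplus, Yminus) tensor"
  assumes hom: "alg_hom \<phi>\<^sub>0" and inj: "inj \<phi>\<^sub>0"
    and image: "matrix_map (fps_map \<phi>\<^sub>0) S_mat = phi0_image"
begin

lemma phi0_nth: "\<phi>\<^sub>0 (fps_nth (S_mat $ i $ j) n) = fps_nth (phi0_image $ i $ j) n"
  by (simp flip: image)

lemma map_phi0_image:
  assumes \<Phi>: "alg_hom \<Phi>"
  shows "fps_map \<Phi> (phi0_image $ i $ j) = basis_sign i * lin_subst 1 (-1/2)
     (fps_map (\<lambda>x. \<Phi> (x \<otimes> 1)) (A_circ $ fst (basis_ix i) $ fst (basis_ix j))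
      * fps_map (\<lambda>y. \<Phi> (1 \<otimes> y)) (S_bullet $ snd (basis_ix i) $ snd (basis_ix j))) * basis_sign j"
proof -
  note h = ring_hom1_simps[OF ring_hom1_fps_map[OF alg_hom_ring_hom1[OF \<Phi>]]]
  have "fps_map \<Phi> (basis_sign i) = basis_sign i" for i
    by (cases i) (simp_all add: h)
  then show ?thesis
    by (simp add: phi0_image_nth h fps_map_lin_subst[OF \<Phi>] comp_def)
qed

text \<open>The image of the embedding is generated by coefficients of shifted products of
  \<open>A_circ\<close> and \<open>S_bullet\<close> entries, so two maps need only agree on these
  products, not on each factor.\<close>

lemma agree_on_image:
  assumes \<Phi>: "alg_hom \<Phi>" and \<Psi>: "alg_hom \<Psi>"
    and eq: "\<And>a c b d. fps_map (\<lambda>x. \<Phi> (x \<otimes> 1)) (A_circ $ a $ c) * fps_map (\<lambda>y. \<Phi> (1 \<otimes> y)) (S_bullet $ b $ d)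
        = fps_map (\<lambda>x. \<Psi> (x \<otimes> 1)) (A_circ $ a $ c) * fps_map (\<lambda>y. \<Psi> (1 \<otimes> y)) (S_bullet $ b $ d)"
  shows "\<Phi> (\<phi>\<^sub>0 x) = \<Psi> (\<phi>\<^sub>0 x)"
proof -
  have "(\<Phi> \<circ> \<phi>\<^sub>0) x = (\<Psi> \<circ> \<phi>\<^sub>0) x"
  proof (rule alg_hom_eq_on_generated[OF alg_hom_comp[OF \<Phi> hom] alg_hom_comp[OF \<Psi> hom] _ Xtw_generated])
    fix z assume "z \<in> series_coeffs S_mat"
    then obtain i j n where z: "z = fps_nth (S_mat $ i $ j) n" by (auto simp: series_coeffs_def)
    have "fps_map \<Phi> (phi0_image $ i $ j) = fps_map \<Psi> (phi0_image $ i $ j)"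
      by (simp only: map_phi0_image[OF \<Phi>] map_phi0_image[OF \<Psi>] eq)
    then have "fps_nth (fps_map \<Phi> (phi0_image $ i $ j)) n = fps_nth (fps_map \<Psi> (phi0_image $ i $ j)) n" by simp
    then show "(\<Phi> \<circ> \<phi>\<^sub>0) z = (\<Psi> \<circ> \<phi>\<^sub>0) z" by (simp add: z phi0_nth)
  qed
  then show ?thesis by simp
qed

text \<open>The basis signs and the shift by -1/2 are invertible, so the unshifted products also
  have coefficients in the range.\<close>

lemma product_in_range:
  fixes \<Phi> :: "(Yplus, Yminus) tensor \<Rightarrow> 'c::complex_algebra_1"
  assumes \<Phi>: "alg_hom \<Phi>"
  shows "fps_nth (fps_map (\<lambda>x. \<Phi> (x \<otimes> 1)) (A_circ $ a $ c) * fps_map (\<lambda>y. \<Phi> (1 \<otimes> y)) (S_bullet $ b $ d)) n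
    \<in> range (\<Phi> \<circ> \<phi>\<^sub>0)" (is "fps_nth ?P n \<in> ?B")
proof -
  have B: "subalgebra ?B" by (intro subalgebra_range alg_hom_comp \<Phi> hom)
  obtain i where i: "basis_ix i = (a, b)" by (rule basis_ix_surj)
  obtain j where j: "basis_ix j = (c, d)" by (rule basis_ix_surj)
  have "lin_subst 1 (-1/2) ?P = basis_sign i * fps_map \<Phi> (phi0_image $ i $ j) * basis_sign j"
    unfolding map_phi0_image[OF \<Phi>] i j by (cases i; cases j) simp_all
  moreover have "fps_nth (fps_map \<Phi> (phi0_image $ i $ j)) m \<in> ?B" for m
    by (simp flip: phi0_nth)
  ultimately have "fps_nth (lin_subst 1 (-1/2) ?P) m \<in> ?B" for m
    using subalgebra_closed(6)[OF B] by (cases i; cases j) (simp_all del: comp_apply)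
  then have "fps_nth (lin_subst 1 (1/2) (lin_subst 1 (-1/2) ?P)) n \<in> ?B"
    by (rule lin_subst_nth_in[OF B])
  then show ?thesis by (simp add: lin_subst_lin_subst)
qed

text \<open>\<open>\<Theta>\<close> takes values in Y(2) \<otimes> Y(2), so its composition with
  \<open>\<Phi>\<close> is compared with the inclusion of the twisted subalgebras. Agreement on the
  image of the embedding is enough.\<close>

lemma inj_if_left_inverse:
  assumes "alg_hom \<Theta>" "alg_hom \<Phi>"
    and "\<And>a c b d. fps_map (\<lambda>x. \<Theta> (\<Phi> (x \<otimes> 1))) (A_circ $ a $ c) * fps_map (\<lambda>y. \<Theta> (\<Phi> (1 \<otimes> y))) (S_bullet $ b $ d)
       = fps_map (\<lambda>x. Rep_Yplus x \<otimes> 1) (A_circ $ a $ c) * fps_map (\<lambda>y. 1 \<otimes> Rep_Yminus y) (S_bullet $ b $ d)"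
  shows "inj (\<Phi> \<circ> \<phi>\<^sub>0)"
proof -
  let ?J = "tensor_map Rep_Yplus Rep_Yminus"
  note lin = alg_hom_clinear[OF alg_hom_Rep(1)] alg_hom_clinear[OF alg_hom_Rep(2)]
  have J: "alg_hom ?J" "inj ?J"
    by (intro alg_hom_tensor_map alg_hom_Rep) (intro inj_tensor_map lin inj_Rep)
  have "(\<Theta> \<circ> \<Phi>) (\<phi>\<^sub>0 x) = ?J (\<phi>\<^sub>0 x)" for x
    by (rule agree_on_image[OF alg_hom_comp[OF assms(1,2)] J(1)])
       (simp add: assms(3) tensor_map_tensor lin alg_hom_simps(3)[OF alg_hom_Rep(1)] alg_hom_simps(3)[OF alg_hom_Rep(2)])
  then have *: "?J (\<phi>\<^sub>0 x) = \<Theta> ((\<Phi> \<circ> \<phi>\<^sub>0) x)" for x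
    by simp
  show ?thesis
  proof (rule injI)
    fix x y assume "(\<Phi> \<circ> \<phi>\<^sub>0) x = (\<Phi> \<circ> \<phi>\<^sub>0) y"
    then have "?J (\<phi>\<^sub>0 x) = ?J (\<phi>\<^sub>0 y)" by (simp only: *)
    then show "x = y" by (intro injD[OF inj] injD[OF J(2)])
  qed
qed

lemma surj_if_coeffs_in_range:
  assumes p: "alg_hom p" "surj p" and q: "alg_hom q" "surj q"
    and A: "\<And>i j n. p (fps_nth (A_circ $ i $ j) n) \<otimes> 1 \<in> range (tensor_map p q \<circ> \<phi>\<^sub>0)"
    and S: "\<And>i j n. 1 \<otimes> q (fps_nth (S_bullet $ i $ j) n) \<in> range (tensor_map p q \<circ> \<phi>\<^sub>0)"
  shows "surj (tensor_map p q \<circ> \<phi>\<^sub>0)"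
proof -
  let ?B = "range (tensor_map p q \<circ> \<phi>\<^sub>0)"
  have B: "subalgebra ?B" by (intro subalgebra_range alg_hom_comp alg_hom_tensor_map p q hom)
  have left: "p x \<otimes> 1 \<in> ?B" for x
  proof -
    have "subalg_gen (series_coeffs S_circ) \<subseteq> (\<lambda>x. p x \<otimes> 1) -` ?B"
    proof (rule subalg_gen_least)
      show "subalgebra ((\<lambda>x. p x \<otimes> 1) -` ?B)"
        using subalgebra_vimage[OF alg_hom_comp[OF alg_hom_tensor_left p(1)] B] by (simp add: comp_def)
      \<comment> \<open>Multiplication by K changes only the signs of columns.\<close>
      have "fps_nth (S_circ $ i $ j) n = fps_nth (A_circ $ i $ j) n
          \<or> fps_nth (S_circ $ i $ j) n = - fps_nth (A_circ $ i $ j) n" for i j n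
        by (cases j) (simp_all add: A_circ_def mult_K_mat_nth)
      moreover have "p (- x) \<otimes> 1 = - (p x \<otimes> 1)" for x
        using alg_hom_simps(5)[OF alg_hom_comp[OF alg_hom_tensor_left p(1)]] by (simp add: comp_def)
      ultimately have "p (fps_nth (S_circ $ i $ j) n) \<otimes> 1 \<in> ?B" for i j n
        using A[of i j n] subalgebra_closed(6)[OF B] by metis
      then show "series_coeffs S_circ \<subseteq> (\<lambda>x. p x \<otimes> 1) -` ?B"
        unfolding series_coeffs_def by blast
    qed
    then show ?thesis using Yplus_generated by blast
  qed
  have right: "1 \<otimes> q y \<in> ?B" for y
  proof -
    have "subalg_gen (series_coeffs S_bullet) \<subseteq> (\<lambda>x. 1 \<otimes> q x) -` ?B"
    proof (rule subalg_gen_least)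
      show "subalgebra ((\<lambda>x. 1 \<otimes> q x) -` ?B)"
        using subalgebra_vimage[OF alg_hom_comp[OF alg_hom_tensor_right q(1)] B] by (simp add: comp_def)
      show "series_coeffs S_bullet \<subseteq> (\<lambda>x. 1 \<otimes> q x) -` ?B"
        using S unfolding series_coeffs_def by blast
    qed
    then show ?thesis using Yminus_generated by blast
  qed
  have "t \<in> ?B" for t
  proof (induction t rule: tensor_induct)
    case (tensor x y)
    obtain x' y' where "x = p x'" "y = q y'" using p(2) q(2) by (metis surjD)
    then have "x \<otimes> y = (p x' \<otimes> 1) * (1 \<otimes> q y')" by (simp add: tensor_mult)
    then show ?case using left right subalgebra_closed(4)[OF B] by metis
  qed (rule subalgebra_closed(3)[OF B])
  then show ?thesis by blast
qed

text \<open>The two factors are recovered only up to c(u) c(-u) and d(u) d(-u). Since c d = 1, these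
  scalars cancel in every product of an \<open>A_circ\<close> entry with an \<open>S_bullet\<close>
  entry.\<close>

lemma inj_if_rescaling:
  fixes f g :: "Y2 \<Rightarrow> (Y2, Y2) tensor"
  assumes f: "alg_hom f" "matrix_map (fps_map f) T_circ = (\<chi> i j. c * matrix_map (fps_map (\<lambda>x. x \<otimes> 1)) T_circ $ i $ j)"
    and g: "alg_hom g" "matrix_map (fps_map g) T_circ = (\<chi> i j. d * matrix_map (fps_map (\<lambda>y. 1 \<otimes> y)) T_circ $ i $ j)"
    and c: "central c" and d: "central d" and cd: "c * d = 1"
    and hom: "alg_hom \<Theta>" "alg_hom \<Phi>"
    and \<Theta>: "\<And>x. \<Theta> (\<Phi> (x \<otimes> 1)) = f (Rep_Yplus x)" "\<And>y. \<Theta> (\<Phi> (1 \<otimes> y)) = g (Rep_Yminus y)"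
  shows "inj (\<Phi> \<circ> \<phi>\<^sub>0)"
proof (rule inj_if_left_inverse[OF hom])
  fix a b k l
  let ?s = "lin_subst (-1) 0 :: (Y2, Y2) tensor fps \<Rightarrow> _"
  let ?X = "fps_map (\<lambda>x. x \<otimes> 1) (fps_map Rep_Yplus (A_circ $ a $ b)) :: (Y2, Y2) tensor fps"
    and ?Y = "fps_map (\<lambda>y. 1 \<otimes> y) (fps_map Rep_Yminus (S_bullet $ k $ l)) :: (Y2, Y2) tensor fps"
  note cen = c[unfolded central_def, rule_format, symmetric] d[unfolded central_def, rule_format, symmetric]
    central_lin_subst[OF c, unfolded central_def, rule_format, symmetric]
    central_lin_subst[OF d, unfolded central_def, rule_format, symmetric]
  have "fps_map f (fps_map Rep_Yplus (A_circ $ a $ b)) * fps_map g (fps_map Rep_Yminus (S_bullet $ k $ l))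
      = ((c * ?s c) * ?X) * ((d * ?s d) * ?Y)"
    unfolding Rep_A_circ_nth Rep_S_bullet_nth
    by (simp only: scaled_twist(1)[OF f alg_hom_tensor_left c] scaled_twist(2)[OF g alg_hom_tensor_right d])
  also have "\<dots> = ((c * ?s c) * (d * ?s d)) * (?X * ?Y)"
    by (rule central_mult_mult) (metis cen mult.assoc)+
  also have "(c * ?s c) * (d * ?s d) = (c * d) * ?s (c * d)"
    by (simp only: lin_subst_mult) (rule central_mult_mult; rule cen)
  finally show "fps_map (\<lambda>x. \<Theta> (\<Phi> (x \<otimes> 1))) (A_circ $ a $ b) * fps_map (\<lambda>y. \<Theta> (\<Phi> (1 \<otimes> y))) (S_bullet $ k $ l)
       = fps_map (\<lambda>x. Rep_Yplus x \<otimes> 1) (A_circ $ a $ b) * fps_map (\<lambda>y. 1 \<otimes> Rep_Yminus y) (S_bullet $ k $ l)"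
    by (simp add: cd \<Theta> comp_def)
qed

section \<open>Injectivity of the two compositions by rescaling\<close>

lemma inj_Pr1: "inj (Pr1 \<circ> \<phi>\<^sub>0)"
proof -
  obtain d e where de: "central d" "central e" "fps_nth d 0 = 1" "fps_nth e 0 = 1" "e * d = 1"
    and q: "lin_subst 1 (-1) e * e * qdet T_circ = 1"
    using qdet_T_circ_root by metis
  let ?l = "\<lambda>x :: Y2. x \<otimes> (1 :: Y2)" and ?r = "\<lambda>y :: Y2. (1 :: Y2) \<otimes> y"
  note l = ring_hom1_simps[OF ring_hom1_fps_map[OF alg_hom_ring_hom1[OF alg_hom_tensor_left[where 'a = Y2 and 'b = Y2]]]]
  have c: "central (fps_map ?l d)" "central (fps_map ?l e)" "fps_nth (fps_map ?l d) 0 = 1" "fps_nth (fps_map ?l e) 0 = 1"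
    by (simp_all add: central_fps_map[OF _ central_tensor_left] de one_tensor_one)
  \<comment> \<open>The condition for e(u) T(u) \<otimes> 1 to have quantum determinant 1, hence to
    define a map on SY(2).\<close>
  have "lin_subst 1 (-1) (fps_map ?l e) * fps_map ?l e * fps_map ?l (qdet T_circ) = 1"
    by (simp only: q l flip: fps_map_lin_subst[OF alg_hom_tensor_left] l(2))
  then obtain f where f: "alg_hom f" "alg_hom (f \<circ> abs_SY2)"
      "matrix_map (fps_map (f \<circ> abs_SY2)) T_circ = (\<chi> i j. fps_map ?l e * matrix_map (fps_map ?l) T_circ $ i $ j)"
    using scaled_special_hom[OF alg_hom_tensor_left c(2,4)] by blast
  \<comment> \<open>The series d compensates e but still has its coefficients in the first tensor
    factor: the second generating matrix 1 \<otimes> T(u) is multiplied by d(u) \<otimes> 1.\<close>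
  obtain g where g: "alg_hom g" "matrix_map (fps_map g) T_circ = (\<chi> i j. fps_map ?l d * matrix_map (fps_map ?r) T_circ $ i $ j)"
    using scaled_hom[OF alg_hom_tensor_right c(1,3)] by blast
  have "(f \<circ> abs_SY2) x * g y = g y * (f \<circ> abs_SY2) x" for x y
    by (rule scaled_homs_commute[OF f(2,3) g c(2,1)]) (simp add: tensor_mult)
  then have "f x * g y = g y * f x" for x y
    using surj_abs_SY2 by (metis comp_apply surjD)
  then have fg: "(f \<circ> Rep_SYplus) x * (g \<circ> Rep_Yminus) y = (g \<circ> Rep_Yminus) y * (f \<circ> Rep_SYplus) x" for x y
    by simp
  note lift = tensor_lift_alg_hom[OF alg_hom_comp[OF f(1) alg_hom_Rep(3)] alg_hom_comp[OF g(1) alg_hom_Rep(2)] fg, unfolded comp_apply]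
  note Pr = tensor_map_tensor[OF alg_hom_clinear[OF alg_hom_Pr(1)] alg_hom_clinear[OF alg_hom_id]]
  show ?thesis
    by (rule inj_if_rescaling[OF f(2,3) g c(2,1) _ lift(1)])
       (simp_all add: de l(3) Pr1_def alg_hom_tensor_map alg_hom_Pr alg_hom_id Pr lift(2) Pr_plus.rep_eq
         alg_hom_simps(3)[OF alg_hom_Rep(2)] alg_hom_simps(3)[OF alg_hom_Rep(3)] alg_hom_simps(3)[OF f(1)]
         alg_hom_simps(3)[OF g(1)] alg_hom_simps(3)[OF alg_hom_Pr(1)] flip: l(2))
qed

lemma inj_Pr2: "inj (Pr2 \<circ> \<phi>\<^sub>0)"
proof -
  obtain d e where de: "central d" "central e" "fps_nth d 0 = 1" "fps_nth e 0 = 1" "d * e = 1"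
    and q: "lin_subst 1 (-1) e * e * qdet T_circ = 1"
    using qdet_T_circ_root by metis
  let ?l = "\<lambda>x :: Y2. x \<otimes> (1 :: Y2)" and ?r = "\<lambda>y :: Y2. (1 :: Y2) \<otimes> y"
  note r = ring_hom1_simps[OF ring_hom1_fps_map[OF alg_hom_ring_hom1[OF alg_hom_tensor_right[where 'a = Y2 and 'b = Y2]]]]
  have c: "central (fps_map ?r d)" "central (fps_map ?r e)" "fps_nth (fps_map ?r d) 0 = 1" "fps_nth (fps_map ?r e) 0 = 1"
    by (simp_all add: central_fps_map[OF _ central_tensor_right] de one_tensor_one)
  have "lin_subst 1 (-1) (fps_map ?r e) * fps_map ?r e * fps_map ?r (qdet T_circ) = 1"
    by (simp only: q r flip: fps_map_lin_subst[OF alg_hom_tensor_right] r(2))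
  then obtain g where g: "alg_hom g" "alg_hom (g \<circ> abs_SY2)"
      "matrix_map (fps_map (g \<circ> abs_SY2)) T_circ = (\<chi> i j. fps_map ?r e * matrix_map (fps_map ?r) T_circ $ i $ j)"
    using scaled_special_hom[OF alg_hom_tensor_right c(2,4)] by blast
  \<comment> \<open>Mirror image of the first case: d now lies in the second tensor factor and
    multiplies T(u) \<otimes> 1.\<close>
  obtain f where f: "alg_hom f" "matrix_map (fps_map f) T_circ = (\<chi> i j. fps_map ?r d * matrix_map (fps_map ?l) T_circ $ i $ j)"
    using scaled_hom[OF alg_hom_tensor_left c(1,3)] by blast
  have "f x * (g \<circ> abs_SY2) y = (g \<circ> abs_SY2) y * f x" for x y
    by (rule scaled_homs_commute[OF f g(2,3) c(1,2)]) (simp add: tensor_mult)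
  then have "f x * g y = g y * f x" for x y
    using surj_abs_SY2 by (metis comp_apply surjD)
  then have fg: "(f \<circ> Rep_Yplus) x * (g \<circ> Rep_SYminus) y = (g \<circ> Rep_SYminus) y * (f \<circ> Rep_Yplus) x" for x y
    by simp
  note lift = tensor_lift_alg_hom[OF alg_hom_comp[OF f(1) alg_hom_Rep(1)] alg_hom_comp[OF g(1) alg_hom_Rep(4)] fg, unfolded comp_apply]
  note Pr = tensor_map_tensor[OF alg_hom_clinear[OF alg_hom_id] alg_hom_clinear[OF alg_hom_Pr(2)]]
  show ?thesis
    by (rule inj_if_rescaling[OF f g(2,3) c(1,2) _ lift(1)])
       (simp_all add: de r(3) Pr2_def alg_hom_tensor_map alg_hom_Pr alg_hom_id Pr lift(2) Pr_minus.rep_eq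
         alg_hom_simps(3)[OF alg_hom_Rep(1)] alg_hom_simps(3)[OF alg_hom_Rep(4)] alg_hom_simps(3)[OF f(1)]
         alg_hom_simps(3)[OF g(1)] alg_hom_simps(3)[OF alg_hom_Pr(2)] flip: r(2))
qed

section \<open>Surjectivity of the two compositions by recovering the generators\<close>

lemma surj_Pr1: "surj (Pr1 \<circ> \<phi>\<^sub>0)"
proof -
  let ?X = "matrix_map (fps_map (\<lambda>x. Pr_plus x \<otimes> 1)) A_circ :: (SYplus, Yminus) tensor fps^ix2^ix2"
    and ?Y = "matrix_map (fps_map (\<lambda>y. 1 \<otimes> y)) S_bullet :: (SYplus, Yminus) tensor fps^ix2^ix2"
  have Pr1: "alg_hom Pr1" unfolding Pr1_def by (intro alg_hom_tensor_map alg_hom_Pr alg_hom_id)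
  have pure: "Pr1 (x \<otimes> y) = Pr_plus x \<otimes> y" for x y
    by (simp add: Pr1_def tensor_map_tensor alg_hom_clinear alg_hom_Pr alg_hom_id)
  note l = alg_hom_tensor_left[where 'a = SYplus and 'b = Yminus] and r = alg_hom_tensor_right[where 'a = SYplus and 'b = Yminus]
  \<comment> \<open>X is the special factor, which satisfies the inverse relation; Y is
    \<open>S_bullet\<close>, whose constant term I gives the signs 1.\<close>
  note gen = product_generates[where X = ?X and Y = ?Y and e = "\<lambda>_. 1" and B = "range (Pr1 \<circ> \<phi>\<^sub>0)"]
  have B: "subalgebra (range (Pr1 \<circ> \<phi>\<^sub>0))" by (intro subalgebra_range alg_hom_comp Pr1 hom)
  have XY: "fps_nth (?X $ a $ c * ?Y $ b $ d) n \<in> range (Pr1 \<circ> \<phi>\<^sub>0)" for a c b d n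
    using product_in_range[OF Pr1, of a c b d n] by (simp add: pure alg_hom_simps(3)[OF alg_hom_Pr(1)] del: comp_apply)
  have comm: "?Y $ b $ d * ?X $ a $ c = ?X $ a $ c * ?Y $ b $ d" for a c b d
    unfolding matrix_map_nth by (rule fps_map_commute[symmetric]) (simp add: tensor_mult)
  have inv: "?X ** matrix_map (lin_subst (-1) (-1)) ?X = mat 1"
  proof -
    have X: "?X = matrix_map (fps_map (\<lambda>x. x \<otimes> (1 :: Yminus))) (matrix_map (fps_map Pr_plus) A_circ)"
      by (simp add: vec_eq_iff fps_eq_iff)
    show ?thesis
      unfolding X matrix_map_inverse[OF l, symmetric] Pr_plus_inverse
      by (rule matrix_map_one[OF ring_hom1_fps_map[OF alg_hom_ring_hom1[OF l]]])
  qed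
  have Y0: "fps_nth (?Y $ i $ j) 0 = (if i = j then 1 *\<^sub>C 1 else 0)" for i j
    by (simp add: S_bullet_nth_0 one_tensor_one scaleC_one alg_hom_simps(4)[OF r])
  have tr: "1 *\<^sub>C fps_nth (?Y $ Minus $ Minus) n + 1 *\<^sub>C fps_nth (?Y $ Plus $ Plus) n = 0" if "odd n" for n
    using S_bullet_trace[OF that] by (simp add: scaleC_one alg_hom_simps(4)[OF r] flip: alg_hom_simps(1)[OF r])
  note coeffs = gen[OF B XY comm inv Y0 _ tr]
  show ?thesis
    unfolding Pr1_def
    by (rule surj_if_coeffs_in_range)
       (use coeffs in \<open>simp_all add: alg_hom_Pr alg_hom_id surj_Pr_plus flip: Pr1_def\<close>)
qed

lemma surj_Pr2: "surj (Pr2 \<circ> \<phi>\<^sub>0)"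
proof -
  let ?X = "matrix_map (fps_map (\<lambda>y. 1 \<otimes> Pr_minus y)) S_bullet :: (Yplus, SYminus) tensor fps^ix2^ix2"
    and ?Y = "matrix_map (fps_map (\<lambda>x. x \<otimes> 1)) A_circ :: (Yplus, SYminus) tensor fps^ix2^ix2"
  have Pr2: "alg_hom Pr2" unfolding Pr2_def by (intro alg_hom_tensor_map alg_hom_Pr alg_hom_id)
  have pure: "Pr2 (x \<otimes> y) = x \<otimes> Pr_minus y" for x y
    by (simp add: Pr2_def tensor_map_tensor alg_hom_clinear alg_hom_Pr alg_hom_id)
  note l = alg_hom_tensor_left[where 'a = Yplus and 'b = SYminus] and r = alg_hom_tensor_right[where 'a = Yplus and 'b = SYminus]
  \<comment> \<open>The roles are exchanged: \<open>S_bullet\<close> is now special, and Y comes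
    from \<open>A_circ\<close>, whose constant term K gives the signs
    \<open>ix_sign\<close>.\<close>
  note gen = product_generates[where X = ?X and Y = ?Y and e = ix_sign and B = "range (Pr2 \<circ> \<phi>\<^sub>0)"]
  have B: "subalgebra (range (Pr2 \<circ> \<phi>\<^sub>0))" by (intro subalgebra_range alg_hom_comp Pr2 hom)
  have comm: "?Y $ b $ d * ?X $ a $ c = ?X $ a $ c * ?Y $ b $ d" for a c b d
    unfolding matrix_map_nth by (rule fps_map_commute) (simp add: tensor_mult)
  have XY: "fps_nth (?X $ a $ c * ?Y $ b $ d) n \<in> range (Pr2 \<circ> \<phi>\<^sub>0)" for a c b d n
    \<comment> \<open>The embedding yields the products with the \<open>A_circ\<close> entry first;
      \<open>comm\<close> puts X in front.\<close>
    using product_in_range[OF Pr2, of b d a c n] comm[of b d a c]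
    by (simp add: pure alg_hom_simps(3)[OF alg_hom_Pr(2)] del: comp_apply)
  have inv: "?X ** matrix_map (lin_subst (-1) (-1)) ?X = mat 1"
  proof -
    have X: "?X = matrix_map (fps_map (\<lambda>y. (1 :: Yplus) \<otimes> y)) (matrix_map (fps_map Pr_minus) S_bullet)"
      by (simp add: vec_eq_iff fps_eq_iff)
    show ?thesis
      unfolding X matrix_map_inverse[OF r, symmetric] Pr_minus_inverse
      by (rule matrix_map_one[OF ring_hom1_fps_map[OF alg_hom_ring_hom1[OF r]]])
  qed
  have Y0: "fps_nth (?Y $ i $ j) 0 = (if i = j then ix_sign i *\<^sub>C 1 else 0)" for i j
    by (cases i) (simp_all add: A_circ_nth_0 one_tensor_one scaleC_one scaleC_minus_one alg_hom_simps(3-5)[OF l])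
  have tr: "ix_sign Minus *\<^sub>C fps_nth (?Y $ Minus $ Minus) n + ix_sign Plus *\<^sub>C fps_nth (?Y $ Plus $ Plus) n = 0" if "odd n" for n
    using arg_cong[OF A_circ_trace[OF that], of "\<lambda>x. x \<otimes> (1 :: SYminus)"]
    by (simp add: scaleC_one scaleC_minus_one alg_hom_simps[OF l])
  have sq: "ix_sign i * ix_sign i = (1 :: complex)" for i by (cases i) simp_all
  note coeffs = gen[OF B XY comm inv Y0 sq tr]
  show ?thesis
    unfolding Pr2_def
    by (rule surj_if_coeffs_in_range)
       (use coeffs in \<open>simp_all add: alg_hom_Pr alg_hom_id surj_Pr_minus flip: Pr2_def\<close>)
qed

end

theorem corollary4p9:
  fixes \<phi>\<^sub>0 :: "Xtw \<Rightarrow> (Yplus, Yminus) tensor"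
  assumes "alg_hom \<phi>\<^sub>0" and "inj \<phi>\<^sub>0"
    and "matrix_map (fps_map \<phi>\<^sub>0) S_mat = phi0_image"
  shows "alg_iso (Pr1 \<circ> \<phi>\<^sub>0) \<and> alg_iso (Pr2 \<circ> \<phi>\<^sub>0)"
proof -
  interpret phi0_embedding \<phi>\<^sub>0 by standard (fact assms)+
  have "alg_hom Pr1" "alg_hom Pr2"
    unfolding Pr1_def Pr2_def by (intro alg_hom_tensor_map alg_hom_Pr alg_hom_id)+
  then show ?thesis
    by (simp add: alg_iso_def bij_def alg_hom_comp hom inj_Pr1 inj_Pr2 surj_Pr1 surj_Pr2 del: comp_apply)
qed

end
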